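(* There is an absolute constant $C>0$ such that for every nondecreasing function $F:[1,\infty)\to(0,\infty)$ there exist a finitely generated stable group $\Gamma$, a free group $\mathbb{F}$ of finite rank on a basis $X$, and an epimorphism $\pi:\mathbb{F}\twoheadrightarrow\Gamma$ such that $F_{\Gamma}^{\pi}(x)\ge F(x)$ for all $x\ge C$.
   Context: For a finite set $\Omega$, $d_\Omega$ is the normalised Hamming metric on $\mathrm{Sym}(\Omega)$: $d_\Omega(\sigma,\tau)=|\{\omega\in\Omega:\sigma(\omega)\ne\tau(\omega)\}|/|\Omega|$. Let $\mathbb{F}$ be a free group on a finite basis $X$ and $\pi:\mathbb{F}\twoheadrightarrow\Gamma$ an epimorphism. For $\epsilon>0$, a pair $(\delta,E)$ with $\delta\in(0,1]$ and $E\subseteq\ker\pi$ finite is called valid for $\epsilon$ if for every finite set $\Omega$ and every homomorphism $\rho:\mathbb{F}\to\mathrm{Sym}(\Omega)$ with $d_\Omega(\rho(r),\mathrm{id}_\Omega)<\delta$ for all $r\in E$, there is a homomorphism $\phi:\Gamma\to\mathrm{Sym}(\Omega)$ with $d_\Omega(\rho(x),\phi(\pi(x)))<\epsilon$ for all $x\in X$. The group $\Gamma$ is stable (with respect to $\pi$) if a valid pair exists for every $\epsilon>0$. For finite $E\subseteq\mathbb{F}$, $\|E\|=\sum_{r\in E}|r|$ where $|r|$ is the word length with respect to $X$. The stability growth function is $F_\Gamma^\pi(x)=\inf\{\|E\|/\delta : (\delta,E)\text{ valid for }\epsilon=1/x\}$ for $x\in[1,\infty)$. *)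

theory Defs
  imports Complex_Main "HOL-Algebra.Bij"
begin

text \<open>Letters are pairs (generator index, sign); True = generator, False = its inverse.
  Elements of the free group are freely reduced words.\<close>

type_synonym fword = "(nat \<times> bool) list"

definition reduced_word :: "fword \<Rightarrow> bool" where
  "reduced_word w \<longleftrightarrow>
     (\<forall>i. Suc i < length w \<longrightarrow> \<not> (fst (w ! i) = fst (w ! Suc i) \<and> snd (w ! i) \<noteq> snd (w ! Suc i)))"

fun cancel_cons :: "nat \<times> bool \<Rightarrow> fword \<Rightarrow> fword" where
  "cancel_cons x [] = [x]"
| "cancel_cons x (y # ys) = (if fst x = fst y \<and> snd x \<noteq> snd y then ys else x # y # ys)"

definition free_reduce :: "fword \<Rightarrow> fword" where
  "free_reduce w = foldr cancel_cons w []"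

definition free_group :: "nat \<Rightarrow> fword monoid" where
  "free_group n =
    \<lparr>carrier = {w. set (map fst w) \<subseteq> {0..<n} \<and> reduced_word w},
     mult = (\<lambda>u v. free_reduce (u @ v)),
     one = []\<rparr>"

definition free_gen :: "nat \<Rightarrow> fword" where
  "free_gen x = [(x, True)]"

definition word_norm :: "fword set \<Rightarrow> nat" where
  "word_norm E = (\<Sum>r\<in>E. length r)"

definition hamming :: "nat set \<Rightarrow> (nat \<Rightarrow> nat) \<Rightarrow> (nat \<Rightarrow> nat) \<Rightarrow> real" where
  "hamming \<Omega> \<sigma> \<tau> = real (card {\<omega>\<in>\<Omega>. \<sigma> \<omega> \<noteq> \<tau> \<omega>}) / real (card \<Omega>)"

text \<open>Sym(\<Omega>) is the HOL-Algebra group BijGroup \<Omega>; finite sets \<Omega> range over finite sets of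
  natural numbers (every finite set is in bijection with one of these).\<close>

definition valid_pair ::
  "nat \<Rightarrow> ('g, 'b) monoid_scheme \<Rightarrow> (fword \<Rightarrow> 'g) \<Rightarrow> real \<Rightarrow> real \<Rightarrow> fword set \<Rightarrow> bool" where
  "valid_pair n G \<pi> \<epsilon> \<delta> E \<longleftrightarrow>
     0 < \<delta> \<and> \<delta> \<le> 1 \<and> finite E \<and>
     E \<subseteq> {r \<in> carrier (free_group n). \<pi> r = \<one>\<^bsub>G\<^esub>} \<and>
     (\<forall>\<Omega> :: nat set. finite \<Omega> \<longrightarrow>
        (\<forall>\<rho> \<in> hom (free_group n) (BijGroup \<Omega>).
           (\<forall>r\<in>E. hamming \<Omega> (\<rho> r) (\<one>\<^bsub>BijGroup \<Omega>\<^esub>) < \<delta>) \<longrightarrow>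
           (\<exists>\<phi> \<in> hom G (BijGroup \<Omega>).
              \<forall>x\<in>{0..<n}. hamming \<Omega> (\<rho> (free_gen x)) (\<phi> (\<pi> (free_gen x))) < \<epsilon>)))"

definition stable_wrt :: "nat \<Rightarrow> ('g, 'b) monoid_scheme \<Rightarrow> (fword \<Rightarrow> 'g) \<Rightarrow> bool" where
  "stable_wrt n G \<pi> \<longleftrightarrow> (\<forall>\<epsilon>>0. \<exists>\<delta> E. valid_pair n G \<pi> \<epsilon> \<delta> E)"

definition stability_growth :: "nat \<Rightarrow> ('g, 'b) monoid_scheme \<Rightarrow> (fword \<Rightarrow> 'g) \<Rightarrow> real \<Rightarrow> real" where
  "stability_growth n G \<pi> x =
     Inf {real (word_norm E) / \<delta> | \<delta> E. valid_pair n G \<pi> (1 / x) \<delta> E}"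

end

theory Submission
  imports Defs "HOL-Library.Countable" "HOL-Combinatorics.Permutations"
begin

text \<open>
  The group is generated by \<open>a\<close> and \<open>t\<close>. The conjugates $a_i = t^i a t^{-i}$ are involutions that generate a
  group of class two (they satisfy all laws of involutions of the Heisenberg group over the field with
  two elements), and $a_0$ commutes with $a_k$ for $k$ in a sparse set $S = \{N_0, N_1, \dots\}$ where
  $N_j$ is $2^j$ times an odd number and divides $N_{j+1}$.

  Growth: let $a$ act on $2^{j+1}$ copies of the Heisenberg group, permuted cyclically by $t$, through two
  non-commuting involutions at opposite copies. This violates only the commutation at distance
  $N_j$, so it satisfies all relations much shorter than $N_j$, but on a set of $2^{j+4}$ points every
  genuine action differs from it by at least the inverse of the cardinality. Letting $N_j$ grow fast
  makes the stability growth as large as desired.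

  Stability: let \<open>A\<close>, \<open>T\<close> be permutations of a finite set satisfying many relations at most points. A
  point returning under a bounded power of \<open>T\<close> to its own orbit under a finite block of the $a_i$
  lies, with few exceptions, in a bounded orbit of the whole group, where all relations hold already
  once enough of them do. The remaining points are cut into towers of height $l = N_j$ over bases invariant under
  $a_{-l}, \dots, a_0$, the cuts being placed by a random ordering of the block orbits; closing up each
  tower cyclically and making \<open>a\<close> trivial near the top gives a genuine action.
\<close>

section \<open>Laws of involutions in the Heisenberg group\<close>

text \<open>An absolute constant \<open>C\<close> forces the test sets at scale \<open>j\<close> to
  have a size independent of \<open>F\<close>, although the distance to be detected there depends on
  \<open>F\<close>. A cycle of length \<open>2 * 2 ^ j\<close> sees distances only modulo its
  length, and an odd multiple of \<open>2 ^ j\<close>, however large, leads to the opposite copy.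
  Each copy has 8 points, so the sets have \<open>16 * 2 ^ j\<close> points: \<open>C = 16\<close>
  is the case \<open>j = 0\<close>, and consecutive sizes differ by a factor 2, so that every
  \<open>x \<ge> 16\<close> lies between two of them.

  Stability pulls the other way: a tower can be closed only if each distance is negligible against
  its height or a multiple of it, whence the divisibility chain with growing ratios. Class two tames
  the periodic points: finitely many letters generate a finite group, and conjugation depends on the
  conjugator only modulo the centre, so that a translated block still normalises the block. The
  bases of the towers are invariant because the labels that place the cuts depend only on block
  orbits.\<close>

definition zpow :: "('a \<Rightarrow> 'a) \<Rightarrow> int \<Rightarrow> 'a \<Rightarrow> 'a" where
  "zpow T i = (if 0 \<le> i then T ^^ nat i else inv_into UNIV T ^^ nat (- i))"

lemma zpow_0 [simp]: "zpow T 0 = id"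
  by (simp add: zpow_def)

lemma zpow_1 [simp]: "zpow T 1 = T"
  by (simp add: zpow_def)

lemma zpow_Suc_left:
  assumes "bij T"
  shows "zpow T (i + 1) x = T (zpow T i x)"
proof (cases "0 \<le> i")
  case True
  then have "nat (i + 1) = Suc (nat i)" by simp
  with True show ?thesis by (simp add: zpow_def)
next
  case False
  then obtain n where n: "i = - int (Suc n)"
    by (metis int_cases not_le negative_zle of_nat_0_le_iff)
  then have i: "nat (- i) = Suc n" "\<not> 0 \<le> i" by simp_all
  have "zpow T (i + 1) = inv_into UNIV T ^^ n"
  proof -
    have "i + 1 = - int n" using n by simp
    then show ?thesis by (cases "n = 0") (simp_all add: zpow_def)
  qed
  moreover have "zpow T i = inv_into UNIV T ^^ Suc n"
    using i by (simp add: zpow_def del: funpow.simps)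
  ultimately show ?thesis
    using assms by (simp add: bij_is_surj surj_f_inv_f)
qed

lemma zpow_add:
  assumes "bij T"
  shows "zpow T (i + j) x = zpow T i (zpow T j x)"
proof (induction i rule: int_induct[where k = 0])
  case base
  then show ?case by simp
next
  case (step1 i)
  have "zpow T (i + 1 + j) x = T (zpow T (i + j) x)"
    using zpow_Suc_left[OF assms, of "i + j"] by (simp add: ac_simps)
  then show ?case using step1 zpow_Suc_left[OF assms, of i] by simp
next
  case (step2 i)
  have "T (zpow T (i - 1 + j) x) = zpow T (i + j) x"
    using zpow_Suc_left[OF assms, of "i - 1 + j"] by (simp add: algebra_simps)
  also have "\<dots> = T (zpow T (i - 1) (zpow T j x))"
    using zpow_Suc_left[OF assms, of "i - 1"] step2 by simp
  finally show ?case
    using bij_is_inj[OF assms] by (simp add: inj_eq)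
qed

lemma zpow_add_apply: "bij T \<Longrightarrow> zpow T i (zpow T j x) = zpow T (i + j) x"
  by (simp add: zpow_add)

lemma zpow_inverse [simp]:
  assumes "bij T"
  shows "zpow T i (zpow T (- i) x) = x" "zpow T (- i) (zpow T i x) = x"
  using zpow_add_apply[OF assms, of i "- i" x] zpow_add_apply[OF assms, of "- i" i x] by simp_all

lemma zpow_shift:
  assumes "bij T"
  shows "zpow T i (T x) = zpow T (i + 1) x" "T (zpow T i x) = zpow T (i + 1) x"
  using zpow_add_apply[OF assms, of i 1] zpow_add_apply[OF assms, of 1 i] by (simp_all add: add.commute)

lemma bij_zpow: "bij T \<Longrightarrow> bij (zpow T i)"
  by (rule bijI') (metis zpow_inverse)+

lemma zpow_eq_iff [simp]: "bij T \<Longrightarrow> zpow T i x = zpow T i y \<longleftrightarrow> x = y"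
  by (metis zpow_inverse(2))

definition cj :: "('a \<Rightarrow> 'a) \<Rightarrow> ('a \<Rightarrow> 'a) \<Rightarrow> int \<Rightarrow> 'a \<Rightarrow> 'a" where
  "cj A T i = zpow T i \<circ> A \<circ> zpow T (- i)"

lemma cj_0 [simp]: "cj A T 0 = A"
  by (simp add: cj_def)

lemma bij_cj: "bij A \<Longrightarrow> bij T \<Longrightarrow> bij (cj A T i)"
  by (simp add: cj_def bij_comp bij_zpow)

lemma zpow_cj: "bij T \<Longrightarrow> zpow T j (cj A T i x) = cj A T (i + j) (zpow T j x)"
  by (simp add: cj_def zpow_add_apply algebra_simps)

definition acts :: "('a \<Rightarrow> 'a) \<Rightarrow> ('a \<Rightarrow> 'a) \<Rightarrow> int list \<Rightarrow> 'a \<Rightarrow> 'a" where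
  "acts A T is = foldr (\<lambda>i. (\<circ>) (cj A T i)) is id"

lemma acts_Nil [simp]: "acts A T [] = id"
  by (simp add: acts_def)

lemma acts_Cons: "acts A T (i # is) = cj A T i \<circ> acts A T is"
  by (simp add: acts_def)

lemma acts_append: "acts A T (is @ js) = acts A T is \<circ> acts A T js"
  by (induction "is") (auto simp: acts_Cons)

lemma acts_single [simp]: "acts A T [i] = cj A T i"
  by (simp add: acts_Cons)

lemma bij_acts: "bij A \<Longrightarrow> bij T \<Longrightarrow> bij (acts A T is)"
  by (induction "is") (auto simp: acts_Cons bij_cj bij_comp)

lemma zpow_acts: "bij T \<Longrightarrow> zpow T j (acts A T is x) = acts A T (map (\<lambda>i. i + j) is) (zpow T j x)"
  by (induction "is" arbitrary: x) (auto simp: acts_Cons zpow_cj)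

lemma acts_zpow: "bij T \<Longrightarrow> acts A T is (zpow T j x) = zpow T j (acts A T (map (\<lambda>i. i - j) is) x)"
  by (simp add: zpow_acts comp_def)

type_synonym heis = "bool \<times> bool \<times> bool"

text \<open>Upper unitriangular $3\times 3$ matrices over the field with two elements:
  $(a,b,c)$ has $a$, $b$ above the diagonal and $c$ in the corner.\<close>

fun hmul :: "heis \<Rightarrow> heis \<Rightarrow> heis" where
  "hmul (a, b, c) (a', b', c') = (a \<noteq> a', b \<noteq> b', (c \<noteq> c') \<noteq> (a \<and> b'))"

definition hone :: heis where
  "hone = (False, False, False)"

lemma hmul_assoc: "hmul (hmul x y) z = hmul x (hmul y z)"
  by (cases x; cases y; cases z) auto

lemma hmul_one [simp]: "hmul hone x = x" "hmul x hone = x"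
  by (cases x; simp add: hone_def)+

definition hprod :: "(int \<Rightarrow> heis) \<Rightarrow> int list \<Rightarrow> heis" where
  "hprod g is = foldr (\<lambda>i. hmul (g i)) is hone"

lemma hprod_Nil [simp]: "hprod g [] = hone"
  by (simp add: hprod_def)

lemma hprod_Cons [simp]: "hprod g (i # is) = hmul (g i) (hprod g is)"
  by (simp add: hprod_def)

lemma hprod_append: "hprod g (is @ js) = hmul (hprod g is) (hprod g js)"
  by (induction "is") (auto simp: hmul_assoc)

definition involutive :: "(int \<Rightarrow> heis) \<Rightarrow> bool" where
  "involutive g \<longleftrightarrow> (\<forall>i. hmul (g i) (g i) = hone)"

definition law_eq :: "int list \<Rightarrow> int list \<Rightarrow> bool" where
  "law_eq is js \<longleftrightarrow> (\<forall>g. involutive g \<longrightarrow> hprod g is = hprod g js)"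

lemma law_eq_append: "law_eq is is' \<Longrightarrow> law_eq js js' \<Longrightarrow> law_eq (is @ js) (is' @ js')"
  by (simp add: law_eq_def hprod_append)

lemma hprod_rev:
  assumes "involutive g"
  shows "hmul (hprod g is) (hprod g (rev is)) = hone"
proof (induction "is")
  case (Cons i "is")
  have "hmul (hprod g (i # is)) (hprod g (rev (i # is))) =
        hmul (g i) (hmul (hmul (hprod g is) (hprod g (rev is))) (g i))"
    by (simp add: hprod_append hmul_assoc)
  then show ?case using Cons assms by (simp add: involutive_def)
qed simp

lemma law_eq_rev: "law_eq (is @ rev is) []" "law_eq (rev is @ is) []"
  using hprod_rev[of _ "is"] hprod_rev[of _ "rev is"] by (simp_all add: law_eq_def hprod_append)

lemma hprod_map_filter:
  "hprod g (map \<phi> (filter Q is)) = hprod (\<lambda>i. if Q i then g (\<phi> i) else hone) is"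
  by (induction "is") auto

lemma law_eq_map_filter:
  assumes "law_eq is js"
  shows "law_eq (map \<phi> (filter Q is)) (map \<phi> (filter Q js))"
  using assms unfolding law_eq_def hprod_map_filter by (simp add: involutive_def)

lemma law_eq_map: "law_eq is js \<Longrightarrow> law_eq (map \<phi> is) (map \<phi> js)"
  using law_eq_map_filter[where Q = "\<lambda>_. True"] by simp

text \<open>The two entries above the diagonal form the abelianisation, where only the parity of the
  number of occurrences of each letter matters.\<close>

lemma hprod_coords:
  "fst (hprod g is) = odd (length (filter (\<lambda>i. fst (g i)) is))"
  "fst (snd (hprod g is)) = odd (length (filter (\<lambda>i. fst (snd (g i))) is))"
proof (induction "is")
  case (Cons i "is")
  obtain a b c a' b' c' where "g i = (a, b, c)" "hprod g is = (a', b', c')"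
    by (metis prod_cases3)
  then show "fst (hprod g (i # is)) = odd (length (filter (\<lambda>i. fst (g i)) (i # is)))"
    "fst (snd (hprod g (i # is))) = odd (length (filter (\<lambda>i. fst (snd (g i))) (i # is)))"
    using Cons by auto
qed (auto simp: hone_def)

lemma even_length_filter:
  assumes "\<And>x. Q x \<Longrightarrow> even (count_list xs x)"
  shows "even (length (filter Q xs))"
proof -
  have *: "count_list (filter Q xs) x = (if Q x then count_list xs x else 0)" for x
    by (induction xs) auto
  have "length (filter Q xs) = (\<Sum>x\<in>set xs. count_list (filter Q xs) x)"
    by (rule sum_count_set[symmetric]) auto
  also have "even \<dots>"
    by (rule dvd_sum) (use assms in \<open>auto simp: *\<close>)
  finally show ?thesis .
qed

lemma odd_length_filter_drop:
  assumes "\<And>x. \<not> D x \<Longrightarrow> even (count_list xs x)"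
  shows "odd (length (filter Q (filter D xs))) = odd (length (filter Q xs))"
proof -
  have "length (filter Q xs) = length (filter Q (filter D xs)) + length (filter (\<lambda>x. Q x \<and> \<not> D x) xs)"
    by (induction xs) auto
  moreover have "even (length (filter (\<lambda>x. Q x \<and> \<not> D x) xs))"
    by (rule even_length_filter) (use assms in auto)
  ultimately show ?thesis by simp
qed

text \<open>Elements \<open>y\<close> and \<open>y'\<close> that agree off the corner differ by a
  central element, so they conjugate \<open>z\<close> in the same way; \<open>r\<close> is the
  inverse of \<open>y'\<close>.\<close>

lemma hmul_conj:
  assumes "fst y' = fst y" "fst (snd y') = fst (snd y)" "hmul y' r = hone"
  shows "hmul y z = hmul (hmul (hmul y' z) r) y"
  using assms by (cases y; cases y'; cases z; cases r) (auto simp: hone_def)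

text \<open>Conjugation in a group of class two only depends on the conjugating element modulo the centre,
  so letters occurring an even number of times can be dropped from it.\<close>

lemma law_eq_conj:
  assumes "\<And>x. \<not> D x \<Longrightarrow> even (count_list ys x)"
  shows "law_eq (ys @ zs) ((filter D ys @ zs @ rev (filter D ys)) @ ys)"
  unfolding law_eq_def
proof (intro allI impI)
  fix g assume g: "involutive g"
  show "hprod g (ys @ zs) = hprod g ((filter D ys @ zs @ rev (filter D ys)) @ ys)"
    unfolding hprod_append hmul_assoc[symmetric]
  proof (rule hmul_conj)
    show "fst (hprod g (filter D ys)) = fst (hprod g ys)"
      "fst (snd (hprod g (filter D ys))) = fst (snd (hprod g ys))"
      unfolding hprod_coords by (intro odd_length_filter_drop assms; assumption)+
  qed (rule hprod_rev[OF g])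
qed

text \<open>Law-equality classes of words over a finite alphabet inject into a finite function space.\<close>

lemma finite_law_representatives:
  assumes "finite I"
  shows "\<exists>R. finite R \<and> R \<subseteq> {is. set is \<subseteq> I} \<and> (\<forall>is. set is \<subseteq> I \<longrightarrow> (\<exists>r\<in>R. law_eq is r))"
proof -
  define val where
    "val is = (\<lambda>g\<in>PiE I (\<lambda>_. UNIV). hprod (\<lambda>i. if i \<in> I then g i else hone) is)" for "is"
  have "val ` {is. set is \<subseteq> I} \<subseteq> PiE (PiE I (\<lambda>_. UNIV)) (\<lambda>_. UNIV)"
    unfolding val_def image_subset_iff restrict_PiE_iff by blast
  moreover have "finite (PiE (PiE I (\<lambda>_. UNIV :: heis set)) (\<lambda>_. UNIV :: heis set))"
    using assms by (intro finite_PiE) auto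
  ultimately have "finite (val ` {is. set is \<subseteq> I})"
    by (rule finite_subset)
  from finite_subset_image[OF this order_refl]
  obtain R where R: "R \<subseteq> {is. set is \<subseteq> I}" "finite R" "val ` {is. set is \<subseteq> I} = val ` R"
    by blast
  \<comment> \<open>An assignment matters only through its values on \<open>I\<close>, so finitely
    many assignments tell the words over \<open>I\<close> apart.\<close>
  have same: "hprod (\<lambda>i. if i \<in> I then (restrict g I) i else hone) is = hprod g is" if "set is \<subseteq> I" for g "is"
    using that by (induction "is") auto
  have law: "law_eq is r" if "set is \<subseteq> I" "set r \<subseteq> I" "val is = val r" for "is" r
    unfolding law_eq_def
  proof (intro allI impI)
    fix g
    have "val is (restrict g I) = val r (restrict g I)" using that by simp
    then show "hprod g is = hprod g r"
      using same[of "is" g] same[of r g] that by (simp add: val_def)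
  qed
  have "\<exists>r\<in>R. law_eq is r" if "set is \<subseteq> I" for "is"
  proof -
    have "val is \<in> val ` R" using that R(3) by blast
    then obtain r where "r \<in> R" "val is = val r" by blast
    then show ?thesis using law[OF that, of r] R(1) by blast
  qed
  with R show ?thesis by blast
qed

text \<open>The conjugates \<open>cj A T i\<close> satisfy every relation that holds for all families of involutions of the
  Heisenberg group; in particular they are involutions generating a group of class two.\<close>

definition admissible :: "int set \<Rightarrow> ('a \<Rightarrow> 'a) \<Rightarrow> ('a \<Rightarrow> 'a) \<Rightarrow> bool" where
  "admissible S A T \<longleftrightarrow> bij A \<and> bij T \<and> (\<forall>is. law_eq is [] \<longrightarrow> acts A T is = id) \<and>
     (\<forall>k\<in>S. acts A T [0, k] = acts A T [k, 0])"

lemma admissible_law_eq: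
  assumes "admissible S A T" "law_eq is js"
  shows "acts A T is = acts A T js"
proof -
  have "law_eq (rev js @ is) []"
    using law_eq_append[OF _ assms(2), of "rev js" "rev js"] law_eq_rev(2)[of js]
    by (auto simp: law_eq_def)
  then have "acts A T (js @ rev js @ is) = acts A T js"
    using assms(1) acts_append[of A T js "rev js @ is"] by (simp add: admissible_def)
  moreover have "acts A T (js @ rev js) = id"
    using assms(1) law_eq_rev(1) by (auto simp: admissible_def)
  ultimately show ?thesis by (metis acts_append append_assoc id_comp)
qed

text \<open>Restricting to pairs on the natural numbers loses nothing, since an admissible pair on any countable
  type can be transported there.\<close>

definition rel_eq :: "int set \<Rightarrow> int list \<Rightarrow> int list \<Rightarrow> bool" where
  "rel_eq S is js \<longleftrightarrow> (\<forall>A T :: nat \<Rightarrow> nat. admissible S A T \<longrightarrow> acts A T is = acts A T js)"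

lemma rel_eq_law: "law_eq is js \<Longrightarrow> rel_eq S is js"
  by (simp add: rel_eq_def admissible_law_eq)

lemma rel_eq_append: "rel_eq S is is' \<Longrightarrow> rel_eq S js js' \<Longrightarrow> rel_eq S (is @ js) (is' @ js')"
  by (simp add: rel_eq_def acts_append)

lemma rel_eq_refl [simp]: "rel_eq S is is"
  by (simp add: rel_eq_def)

lemma rel_eq_sym: "rel_eq S is js \<Longrightarrow> rel_eq S js is"
  by (simp add: rel_eq_def)

lemma rel_eq_trans: "rel_eq S is js \<Longrightarrow> rel_eq S js ks \<Longrightarrow> rel_eq S is ks"
  by (simp add: rel_eq_def)

lemma rel_eq_shift:
  assumes "rel_eq S is js"
  shows "rel_eq S (map (\<lambda>i. i + c) is) (map (\<lambda>i. i + c) js)"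
  unfolding rel_eq_def
proof (intro allI impI)
  fix A T :: "nat \<Rightarrow> nat" assume adm: "admissible S A T"
  then have T: "bij T" by (simp add: admissible_def)
  have "acts A T (map (\<lambda>i. i + c) is) x = acts A T (map (\<lambda>i. i + c) js) x" for x
    using zpow_acts[OF T, of c A "is" "zpow T (- c) x"] zpow_acts[OF T, of c A js "zpow T (- c) x"]
      assms adm T by (simp add: rel_eq_def)
  then show "acts A T (map (\<lambda>i. i + c) is) = acts A T (map (\<lambda>i. i + c) js)" by auto
qed

lemma rel_eq_comm:
  assumes "k \<in> S"
  shows "rel_eq S [i, i + k] [i + k, i]"
proof -
  have "rel_eq S [0, k] [k, 0]"
    using assms by (simp add: rel_eq_def admissible_def)
  from rel_eq_shift[OF this, of i] show ?thesis by (simp add: add.commute)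
qed

section \<open>Random orderings and cyclic permutations\<close>

text \<open>In a uniformly random order of \<open>X\<close> each of the \<open>Q + 1\<close>
  distinct labels of a window is equally likely to be its minimum, because exchanging two labels
  exchanges the two events. Membership in \<open>extensional\<close> fixes the values outside
  \<open>X\<close>, so that orders can be counted.\<close>

lemma card_window_end:
  fixes X :: "'x set" and c :: "nat \<Rightarrow> 'x"
  assumes "finite X" and inj: "inj_on c {0..Q}" and c: "\<And>i. i \<le> Q \<Longrightarrow> c i \<in> X" and e: "e \<le> Q"
  shows "Suc Q * card {f. bij_betw f X {..<card X} \<and> f \<in> extensional X \<and> (\<forall>i\<le>Q. f (c e) \<le> f (c i))}
    = card {f. bij_betw f X {..<card X} \<and> f \<in> extensional X}"
proof -
  define F where "F = {f. bij_betw f X {..<card X} \<and> f \<in> extensional X}"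
  define M where "M q = {f \<in> F. \<forall>i\<le>Q. f (c q) \<le> f (c i)}" for q
  have fin: "finite F"
  proof (rule finite_subset)
    show "F \<subseteq> PiE X (\<lambda>_. {..<card X})"
      by (auto simp: F_def PiE_def bij_betw_def)
  qed (use assms in \<open>auto intro: finite_PiE\<close>)
  have le: "card (M q) \<le> card (M q')" if "q \<le> Q" "q' \<le> Q" for q q'
  proof -
    define \<tau> where "\<tau> = Transposition.transpose (c q) (c q')"
    have \<tau>: "bij_betw \<tau> X X"
      unfolding \<tau>_def using c that by (intro permutes_imp_bij permutes_swap_id) auto
    define \<Phi> where "\<Phi> f = (\<lambda>x. if x \<in> X then f (\<tau> x) else f x)" for f :: "'x \<Rightarrow> nat"
    have \<tau>\<tau>: "\<tau> (\<tau> x) = x" for x by (simp add: \<tau>_def)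
    have \<tau>X: "\<tau> x \<in> X" if "x \<in> X" for x using \<tau> that by (auto simp: bij_betw_def)
    have "\<Phi> ` M q \<subseteq> M q'"
    proof
      fix g assume "g \<in> \<Phi> ` M q"
      then obtain f where f: "f \<in> M q" "g = \<Phi> f" by blast
      have "bij_betw (f \<circ> \<tau>) X {..<card X}"
        using f \<tau> by (auto simp: M_def F_def intro: bij_betw_trans)
      then have "bij_betw g X {..<card X}"
        using f by (simp add: \<Phi>_def cong: bij_betw_cong)
      moreover have "g \<in> extensional X"
        using f by (auto simp: M_def F_def \<Phi>_def extensional_def)
      moreover have "g (c q') \<le> g (c i)" if "i \<le> Q" for i
      proof -
        have "\<exists>k\<le>Q. \<tau> (c i) = c k"
          using that \<open>q \<le> Q\<close> \<open>q' \<le> Q\<close> by (auto simp: \<tau>_def Transposition.transpose_def)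
        moreover have "\<tau> (c q') = c q" by (simp add: \<tau>_def)
        ultimately show ?thesis
          using f that c \<open>q' \<le> Q\<close> by (auto simp: M_def \<Phi>_def)
      qed
      ultimately show "g \<in> M q'" by (auto simp: M_def F_def)
    qed
    moreover have "inj_on \<Phi> (M q)"
    proof (rule inj_on_inverseI)
      show "\<Phi> (\<Phi> f) = f" if "f \<in> M q" for f
        using \<tau>\<tau> \<tau>X by (auto simp: \<Phi>_def)
    qed
    ultimately show ?thesis
      using fin by (intro card_inj_on_le[of \<Phi>]) (auto simp: M_def)
  qed
  have eq: "card (M q) = card (M e)" if "q \<le> Q" for q
    using le[OF that e] le[OF e that] by simp
  have "F = (\<Union>q\<in>{0..Q}. M q)"
  proof
    show "F \<subseteq> (\<Union>q\<in>{0..Q}. M q)"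
    proof
      fix f assume f: "f \<in> F"
      have "Min ((\<lambda>i. f (c i)) ` {0..Q}) \<in> (\<lambda>i. f (c i)) ` {0..Q}"
        by (rule Min_in) auto
      then obtain q where q: "q \<in> {0..Q}" "f (c q) = Min ((\<lambda>i. f (c i)) ` {0..Q})" by force
      have "f (c q) \<le> f (c i)" if "i \<le> Q" for i
        unfolding q(2) using that by (intro Min_le) auto
      then have "f \<in> M q" using f by (simp add: M_def)
      then show "f \<in> (\<Union>q\<in>{0..Q}. M q)" using q(1) by blast
    qed
  qed (auto simp: M_def)
  moreover have "disjoint_family_on M {0..Q}"
    unfolding disjoint_family_on_def
  proof (intro ballI impI)
    fix q q' assume q: "q \<in> {0..Q}" "q' \<in> {0..Q}" "q \<noteq> q'"
    then have "c q \<noteq> c q'" using inj by (auto simp: inj_on_def)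
    show "M q \<inter> M q' = {}"
    proof (rule ccontr)
      assume "M q \<inter> M q' \<noteq> {}"
      then obtain f where f: "f \<in> M q" "f \<in> M q'" by blast
      then have "f (c q) = f (c q')" using q by (auto simp: M_def intro: antisym)
      then show False
        using \<open>c q \<noteq> c q'\<close> f q c by (auto simp: M_def F_def bij_betw_def inj_on_def)
    qed
  qed
  ultimately have "card F = (\<Sum>q\<in>{0..Q}. card (M q))"
    using fin by (subst card_UN_disjoint'[symmetric]) (auto simp: M_def)
  also have "\<dots> = Suc Q * card (M e)" using eq by simp
  finally show ?thesis by (simp add: M_def F_def conj_assoc)
qed

text \<open>Averaging over all linear orders of the finite set of labels.\<close>

lemma exists_order_few_window_ends:
  fixes c :: "'y \<Rightarrow> nat \<Rightarrow> 'x"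
  assumes "finite X" "finite Y"
    and inj: "\<And>y. y \<in> Y \<Longrightarrow> inj_on (c y) {0..Q}"
    and c: "\<And>y i. y \<in> Y \<Longrightarrow> i \<le> Q \<Longrightarrow> c y i \<in> X"
  shows "\<exists>f :: 'x \<Rightarrow> nat. inj_on f X \<and>
    Suc Q * card {y \<in> Y. \<exists>e\<in>{0, Q}. \<forall>i\<le>Q. f (c y e) \<le> f (c y i)} \<le> 2 * card Y"
proof -
  define F where "F = {f. bij_betw f X {..<card X} \<and> f \<in> extensional X}"
  define bad where "bad f = {y \<in> Y. \<exists>e\<in>{0, Q}. \<forall>i\<le>Q. f (c y e) \<le> f (c y i)}" for f :: "'x \<Rightarrow> nat"
  have fin: "finite F"
  proof (rule finite_subset)
    show "F \<subseteq> PiE X (\<lambda>_. {..<card X})"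
      by (auto simp: F_def PiE_def bij_betw_def)
  qed (use assms in \<open>auto intro: finite_PiE\<close>)
  have "F \<noteq> {}"
  proof -
    obtain h where "bij_betw h X {..<card X}"
      using ex_bij_betw_finite_nat[OF \<open>finite X\<close>] by (auto simp: atLeast0LessThan)
    then have "restrict h X \<in> F" by (simp add: F_def cong: bij_betw_cong)
    then show ?thesis by blast
  qed
  have one: "Suc Q * card {f \<in> F. \<forall>i\<le>Q. f (c y e) \<le> f (c y i)} = card F" if "y \<in> Y" "e \<le> Q" for y e
    using card_window_end[OF \<open>finite X\<close> inj[OF that(1)] c[OF that(1)] that(2)]
    by (simp add: F_def conj_assoc)
  have two: "Suc Q * card {f \<in> F. y \<in> bad f} \<le> 2 * card F" if "y \<in> Y" for y
  proof -
    have "{f \<in> F. y \<in> bad f} \<subseteq>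
        {f \<in> F. \<forall>i\<le>Q. f (c y 0) \<le> f (c y i)} \<union> {f \<in> F. \<forall>i\<le>Q. f (c y Q) \<le> f (c y i)}"
      by (auto simp: bad_def)
    then have "card {f \<in> F. y \<in> bad f} \<le>
        card {f \<in> F. \<forall>i\<le>Q. f (c y 0) \<le> f (c y i)} + card {f \<in> F. \<forall>i\<le>Q. f (c y Q) \<le> f (c y i)}"
      using fin by (intro order.trans[OF card_mono card_Un_le]) auto
    then have "Suc Q * card {f \<in> F. y \<in> bad f} \<le>
        Suc Q * (card {f \<in> F. \<forall>i\<le>Q. f (c y 0) \<le> f (c y i)} + card {f \<in> F. \<forall>i\<le>Q. f (c y Q) \<le> f (c y i)})"
      by (rule mult_le_mono2)
    also have "\<dots> = 2 * card F"
      using one[OF that, of 0] one[OF that, of Q] by (simp only: distrib_left)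
    finally show ?thesis .
  qed
  have swap: "(\<Sum>f\<in>F. card (bad f)) = (\<Sum>y\<in>Y. card {f \<in> F. y \<in> bad f})"
  proof -
    have "(\<Sum>f\<in>F. card (bad f)) = (\<Sum>f\<in>F. \<Sum>y\<in>Y. if y \<in> bad f then 1 else 0)"
      using assms(2) by (intro sum.cong) (auto simp: bad_def sum.If_cases Int_def)
    also have "\<dots> = (\<Sum>y\<in>Y. \<Sum>f\<in>F. if y \<in> bad f then 1 else 0)"
      by (rule sum.swap)
    also have "\<dots> = (\<Sum>y\<in>Y. card {f \<in> F. y \<in> bad f})"
      using fin by (intro sum.cong) (auto simp: sum.If_cases Int_def)
    finally show ?thesis .
  qed
  have "\<exists>f\<in>F. Suc Q * card (bad f) \<le> 2 * card Y"
  proof (rule ccontr)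
    assume "\<not> ?thesis"
    then have "\<And>f. f \<in> F \<Longrightarrow> 2 * card Y < Suc Q * card (bad f)" by (meson not_le)
    then have "(\<Sum>f\<in>F. 2 * card Y) < (\<Sum>f\<in>F. Suc Q * card (bad f))"
      using fin \<open>F \<noteq> {}\<close> by (intro sum_strict_mono) auto
    also have "\<dots> = (\<Sum>y\<in>Y. Suc Q * card {f \<in> F. y \<in> bad f})"
      by (simp only: sum_distrib_left[symmetric] swap)
    also have "\<dots> \<le> (\<Sum>y\<in>Y. 2 * card F)" by (rule sum_mono) (rule two)
    finally show False by (simp add: mult.commute)
  qed
  then show ?thesis by (auto simp: F_def bad_def bij_betw_def)
qed

section \<open>Periods of injections on finite sets\<close>

lemma funpow_return:
  assumes "finite D" "inj_on f D" "f ` D \<subseteq> D" "x \<in> D"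
  shows "\<exists>n. 0 < n \<and> n \<le> card D \<and> (f ^^ n) x = x"
proof -
  have inD: "(f ^^ n) x \<in> D" for n using assms by (induction n) auto
  have "\<not> inj_on (\<lambda>n. (f ^^ n) x) {0..card D}"
  proof
    assume "inj_on (\<lambda>n. (f ^^ n) x) {0..card D}"
    then have "card {0..card D} \<le> card D"
      using inD assms(1) by (intro card_inj_on_le) auto
    then show False by simp
  qed
  then obtain a b where ab: "a < b" "b \<le> card D" "(f ^^ a) x = (f ^^ b) x"
    unfolding inj_on_def by (metis atLeastAtMost_iff linorder_neqE_nat)
  have "(f ^^ a) ((f ^^ (b - a)) x) = (f ^^ a) x"
    using ab by (metis comp_apply funpow_add le_add_diff_inverse less_imp_le)
  moreover have "inj_on (f ^^ a) D"
    by (induction a) (use assms inD in \<open>auto simp: inj_on_def image_subset_iff\<close>,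
      metis assms(3) funpow_swap1 image_subset_iff)
  ultimately have "(f ^^ (b - a)) x = x"
    using inD assms(4) by (auto simp: inj_on_def)
  with ab show ?thesis by (intro exI[of _ "b - a"]) auto
qed

lemma funpow_mult_fixed: "(f ^^ n) x = x \<Longrightarrow> (f ^^ (n * m)) x = x"
  by (induction m) (auto simp: funpow_add)

text \<open>The return time of \<open>x\<close> is at most \<open>K\<close> and therefore divides
  \<open>K!\<close>, a period that depends neither on \<open>D\<close> nor on
  \<open>x\<close>.\<close>

lemma funpow_fact_fixed:
  assumes "finite D" "inj_on f D" "f ` D \<subseteq> D" "x \<in> D" "card D \<le> K"
  shows "(f ^^ fact K) x = x"
proof -
  obtain n where n: "0 < n" "n \<le> card D" "(f ^^ n) x = x"
    using funpow_return[OF assms(1-4)] by blast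
  then have "n dvd fact K" using assms(5) by (intro dvd_fact) auto
  then show ?thesis using funpow_mult_fixed[OF n(3)] by (auto simp: dvd_def)
qed

section \<open>Closing up towers\<close>

locale perm_pair =
  fixes \<Omega> :: "'a set" and A T :: "'a \<Rightarrow> 'a"
  assumes finite_\<Omega>: "finite \<Omega>" and A_permutes: "A permutes \<Omega>" and T_permutes: "T permutes \<Omega>"
begin

lemma bij_A: "bij A" and bij_T: "bij T"
  using A_permutes T_permutes permutes_bij by blast+

lemma zpow_in_iff [simp]: "zpow T i x \<in> \<Omega> \<longleftrightarrow> x \<in> \<Omega>"
proof -
  have "(T ^^ n) x \<in> \<Omega> \<longleftrightarrow> x \<in> \<Omega>" for n x
    by (induction n) (auto simp: permutes_in_image[OF T_permutes])
  moreover have "(inv_into UNIV T ^^ n) x \<in> \<Omega> \<longleftrightarrow> x \<in> \<Omega>" for n x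
    by (induction n) (auto simp: permutes_in_image[OF permutes_inv[OF T_permutes]])
  ultimately show ?thesis by (simp add: zpow_def)
qed

lemma cj_in_iff [simp]: "cj A T i x \<in> \<Omega> \<longleftrightarrow> x \<in> \<Omega>"
  by (simp add: cj_def permutes_in_image[OF A_permutes])

lemma acts_in_iff [simp]: "acts A T is x \<in> \<Omega> \<longleftrightarrow> x \<in> \<Omega>"
  by (induction "is") (auto simp: acts_Cons)

text \<open>Finiteness turns forward invariance into invariance under the inverses, hence under all
  integer powers of \<open>T\<close>.\<close>

lemma invariant_iff:
  assumes V: "V \<subseteq> \<Omega>" "A ` V \<subseteq> V" "T ` V \<subseteq> V"
  shows "A x \<in> V \<longleftrightarrow> x \<in> V" and "zpow T i x \<in> V \<longleftrightarrow> x \<in> V"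
    and "A ` V = V" and "T ` V = V"
proof -
  have "finite V" using V(1) finite_\<Omega> finite_subset by blast
  then show surj: "A ` V = V" "T ` V = V"
    using V bij_A bij_T by (metis bij_is_inj endo_inj_surj inj_on_subset top_greatest)+
  show "A x \<in> V \<longleftrightarrow> x \<in> V"
    using surj(1) bij_is_inj[OF bij_A] by (metis image_iff injD)
  have T: "T x \<in> V \<longleftrightarrow> x \<in> V" for x
    using surj(2) bij_is_inj[OF bij_T] by (metis image_iff injD)
  have inv: "inv_into UNIV T x \<in> V \<longleftrightarrow> x \<in> V" for x
    using T[of "inv_into UNIV T x"] bij_T by (simp add: bij_is_surj surj_f_inv_f)
  have "(T ^^ n) x \<in> V \<longleftrightarrow> x \<in> V" for n x
    by (induction n) (auto simp: T)
  moreover have "(inv_into UNIV T ^^ n) x \<in> V \<longleftrightarrow> x \<in> V" for n x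
    by (induction n) (auto simp: inv)
  ultimately show "zpow T i x \<in> V \<longleftrightarrow> x \<in> V" by (simp add: zpow_def)
qed

end

text \<open>\<open>B\<close> is the base of towers of height \<open>l\<close>, and \<open>V\<close>
  is an invariant part on which the pair is kept. A letter read at any level of a closed tower
  becomes one of \<open>a_{-l}, ..., a_0\<close> at the base, which is why \<open>B_rel\<close> asks
  for relations in these letters only. From level \<open>l'\<close> on \<open>A\<close> is to be
  made trivial, so \<open>B_inv\<close> concerns only the levels below. The last condition says that
  a distance either wraps around completely or fits into the trivial top.\<close>

locale tower = perm_pair \<Omega> A T for \<Omega> :: "'a set" and A T +
  fixes S :: "int set" and l l' :: int and B V :: "'a set"
  assumes l': "0 \<le> l'" "l' \<le> l" "0 < l"
    and B_sub: "B \<subseteq> \<Omega>" and V_sub: "V \<subseteq> \<Omega>"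
    and levels_disjoint: "\<And>b b' s s'. b \<in> B \<Longrightarrow> b' \<in> B \<Longrightarrow> 0 \<le> s \<Longrightarrow> s < l \<Longrightarrow> 0 \<le> s' \<Longrightarrow> s' < l \<Longrightarrow>
      zpow T s b = zpow T s' b' \<Longrightarrow> s = s' \<and> b = b'"
    and B_inv: "\<And>b s. b \<in> B \<Longrightarrow> 0 \<le> s \<Longrightarrow> s < l' \<Longrightarrow> cj A T (- s) b \<in> B"
    and V_inv: "A ` V \<subseteq> V" "T ` V \<subseteq> V"
    and V_B: "V \<inter> B = {}"
    and B_rel: "\<And>b is js. b \<in> B \<Longrightarrow> set is \<subseteq> {- l..0} \<Longrightarrow> set js \<subseteq> {- l..0} \<Longrightarrow> rel_eq S is js \<Longrightarrow>
      acts A T is b = acts A T js b"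
    and V_law: "\<And>v is. v \<in> V \<Longrightarrow> law_eq is [] \<Longrightarrow> acts A T is v = v"
    and V_comm: "\<And>v k. v \<in> V \<Longrightarrow> k \<in> S \<Longrightarrow> acts A T [0, k] v = acts A T [k, 0] v"
    and S: "\<And>k. k \<in> S \<Longrightarrow> l dvd k \<or> 0 \<le> k \<and> k \<le> l - l'"
begin

definition level :: "int \<Rightarrow> 'a set" where
  "level s = zpow T s ` B"

definition towers :: "'a set" where
  "towers = (\<Union>s\<in>{0..<l}. level s)"

text \<open>Each tower is closed up to cycles of length \<open>l\<close>. Making \<open>A'\<close> trivial on the levels from \<open>l'\<close> on keeps
  the commutations at distances at most \<open>l - l'\<close> valid across the seam, and those at multiples
  of \<open>l\<close> become trivial.\<close>

definition A' :: "'a \<Rightarrow> 'a" where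
  "A' x = (if x \<in> V \<or> (\<exists>s\<in>{0..<l'}. x \<in> level s) then A x else x)"

definition T' :: "'a \<Rightarrow> 'a" where
  "T' x = (if x \<in> V \<or> (\<exists>s\<in>{0..<l - 1}. x \<in> level s) then T x
     else if x \<in> level (l - 1) then zpow T (1 - l) x else x)"

lemmas V_surj = invariant_iff(3,4)[OF V_sub V_inv]
  and A_V [simp] = invariant_iff(1)[OF V_sub V_inv]
  and zpow_V [simp] = invariant_iff(2)[OF V_sub V_inv]

lemma zpow_B_notin_V: "b \<in> B \<Longrightarrow> zpow T s b \<notin> V"
  using V_B by auto

lemma zpow_level_iff:
  "b \<in> B \<Longrightarrow> 0 \<le> s \<Longrightarrow> s < l \<Longrightarrow> 0 \<le> s' \<Longrightarrow> s' < l \<Longrightarrow> zpow T s b \<in> level s' \<longleftrightarrow> s = s'"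
  using levels_disjoint by (auto simp: level_def)

lemma A'_level:
  assumes "b \<in> B" "0 \<le> s" "s < l"
  shows "A' (zpow T s b) = zpow T s (if s < l' then cj A T (- s) b else b)"
proof -
  have "(\<exists>s'\<in>{0..<l'}. zpow T s b \<in> level s') \<longleftrightarrow> s < l'"
    using zpow_level_iff[OF assms] l' assms by auto
  then show ?thesis
    using zpow_B_notin_V[OF assms(1)] by (simp add: A'_def cj_def bij_T)
qed

lemma T'_level:
  assumes "b \<in> B" "0 \<le> s" "s < l"
  shows "T' (zpow T s b) = zpow T ((s + 1) mod l) b"
proof -
  have 1: "(\<exists>s'\<in>{0..<l - 1}. zpow T s b \<in> level s') \<longleftrightarrow> s < l - 1"
    using zpow_level_iff[OF assms] l' assms by auto
  have 2: "zpow T s b \<in> level (l - 1) \<longleftrightarrow> s = l - 1"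
    using zpow_level_iff[OF assms] l' assms by auto
  show ?thesis
  proof (cases "s < l - 1")
    case True
    with 1 2 show ?thesis
      using zpow_B_notin_V[OF assms(1)] assms by (simp add: T'_def zpow_shift bij_T)
  next
    case False
    then have "s = l - 1" using assms by simp
    with 1 2 show ?thesis
      using zpow_B_notin_V[OF assms(1)] assms by (simp add: T'_def zpow_add_apply bij_T)
  qed
qed

lemma A'_V: "v \<in> V \<Longrightarrow> A' v = A v" and T'_V: "v \<in> V \<Longrightarrow> T' v = T v"
  by (simp_all add: A'_def T'_def)

lemma A'_other: "x \<notin> V \<Longrightarrow> x \<notin> towers \<Longrightarrow> A' x = x"
  using l' by (force simp: A'_def towers_def)

lemma T'_other: "x \<notin> V \<Longrightarrow> x \<notin> towers \<Longrightarrow> T' x = x"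
  using l' by (force simp: T'_def towers_def)

lemma towers_cases:
  assumes "x \<in> towers"
  obtains s b where "0 \<le> s" "s < l" "b \<in> B" "x = zpow T s b"
  using assms by (auto simp: towers_def level_def)

lemma towers_sub: "towers \<subseteq> \<Omega>"
  using B_sub by (auto simp: towers_def level_def)

lemma finite_B: "finite B"
  using B_sub finite_\<Omega> finite_subset by blast

lemma B_surj:
  assumes "b \<in> B" "0 \<le> s" "s < l'"
  obtains b' where "b' \<in> B" "cj A T (- s) b' = b"
proof -
  have "cj A T (- s) ` B = B"
    using B_inv assms finite_B bij_is_inj[OF bij_cj[OF bij_A bij_T, of "- s"]]
    by (intro endo_inj_surj) (auto intro: inj_on_subset)
  then show ?thesis using assms that by (metis imageE)
qed

lemma A'_permutes: "A' permutes \<Omega>"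
proof -
  have "\<Omega> \<subseteq> A' ` \<Omega>"
  proof
    fix x assume x: "x \<in> \<Omega>"
    consider "x \<in> V" | "x \<notin> V" "x \<in> towers" | "x \<notin> V" "x \<notin> towers" by blast
    then show "x \<in> A' ` \<Omega>"
    proof cases
      case 1
      then obtain v where "v \<in> V" "x = A v" using V_surj(1) by blast
      then show ?thesis using A'_V V_sub by (metis image_eqI subsetD)
    next
      case 2
      then obtain s b where sb: "0 \<le> s" "s < l" "b \<in> B" "x = zpow T s b" by (elim towers_cases)
      show ?thesis
      proof (cases "s < l'")
        case True
        then obtain b' where b': "b' \<in> B" "cj A T (- s) b' = b" using B_surj sb by metis
        then have "A' (zpow T s b') = x" using A'_level sb True by simp
        then show ?thesis using b' B_sub by (metis image_eqI subsetD zpow_in_iff)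
      next
        case False
        then have "A' x = x" using A'_level sb by simp
        then show ?thesis using x by (metis image_eqI)
      qed
    next
      case 3
      then show ?thesis using x A'_other by (metis image_eqI)
    qed
  qed
  moreover have "A' ` \<Omega> \<subseteq> \<Omega>"
    by (auto simp: A'_def permutes_in_image[OF A_permutes])
  ultimately have "A' ` \<Omega> = \<Omega>" by blast
  then have "bij_betw A' \<Omega> \<Omega>"
    using finite_\<Omega> by (simp add: bij_betw_def finite_surj_inj)
  moreover have "A' x = x" if "x \<notin> \<Omega>" for x
    using that A'_other V_sub towers_sub by blast
  ultimately show ?thesis by (simp add: bij_imp_permutes)
qed

lemma T'_permutes: "T' permutes \<Omega>"
proof -
  have "\<Omega> \<subseteq> T' ` \<Omega>"
  proof
    fix x assume x: "x \<in> \<Omega>"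
    consider "x \<in> V" | "x \<notin> V" "x \<in> towers" | "x \<notin> V" "x \<notin> towers" by blast
    then show "x \<in> T' ` \<Omega>"
    proof cases
      case 1
      then obtain v where "v \<in> V" "x = T v" using V_surj(2) by blast
      then show ?thesis using T'_V V_sub by (metis image_eqI subsetD)
    next
      case 2
      then obtain s b where sb: "0 \<le> s" "s < l" "b \<in> B" "x = zpow T s b" by (elim towers_cases)
      have "T' (zpow T ((s - 1) mod l) b) = zpow T (((s - 1) mod l + 1) mod l) b"
        using l' sb by (intro T'_level) auto
      also have "((s - 1) mod l + 1) mod l = s"
        using sb by (simp add: mod_simps)
      finally show ?thesis using sb B_sub by (metis image_eqI subsetD zpow_in_iff)
    next
      case 3
      then show ?thesis using x T'_other by (metis image_eqI)
    qed
  qed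
  moreover have "T' ` \<Omega> \<subseteq> \<Omega>"
    by (auto simp: T'_def permutes_in_image[OF T_permutes])
  ultimately have "T' ` \<Omega> = \<Omega>" by blast
  then have "bij_betw T' \<Omega> \<Omega>"
    using finite_\<Omega> by (simp add: bij_betw_def finite_surj_inj)
  moreover have "T' x = x" if "x \<notin> \<Omega>" for x
    using that T'_other V_sub towers_sub by blast
  ultimately show ?thesis by (simp add: bij_imp_permutes)
qed

lemma bij_A': "bij A'" and bij_T': "bij T'"
  using A'_permutes T'_permutes permutes_bij by blast+

lemma zpow_T'_level:
  assumes "b \<in> B" "0 \<le> s" "s < l"
  shows "zpow T' i (zpow T s b) = zpow T ((s + i) mod l) b"
proof (induction i rule: int_induct[where k = 0])
  case base
  then show ?case using assms by simp
next
  case (step1 i)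
  have "zpow T' (i + 1) (zpow T s b) = T' (zpow T ((s + i) mod l) b)"
    using zpow_Suc_left[OF bij_T', of i] step1 by simp
  also have "\<dots> = zpow T (((s + i) mod l + 1) mod l) b"
    using assms l' by (intro T'_level) auto
  finally show ?case by (simp add: mod_simps add.assoc)
next
  case (step2 i)
  have "T' (zpow T' (i - 1) (zpow T s b)) = zpow T ((s + i) mod l) b"
    using zpow_Suc_left[OF bij_T', of "i - 1"] step2 by simp
  also have "\<dots> = zpow T (((s + (i - 1)) mod l + 1) mod l) b"
    by (simp add: mod_simps)
  also have "\<dots> = T' (zpow T ((s + (i - 1)) mod l) b)"
    using assms l' by (intro T'_level[symmetric]) auto
  finally show ?case using bij_is_inj[OF bij_T'] by (simp add: inj_eq)
qed

text \<open>Going back \<open>i\<close> steps along the closed tower leads from level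
  \<open>s\<close> to level \<open>r = (s - i) mod l\<close>, where \<open>A'\<close> is, seen from
  the base, the letter \<open>- r\<close> if \<open>r < l'\<close> and trivial otherwise.\<close>

lemma cj_level:
  assumes "b \<in> B" "0 \<le> s" "s < l"
  shows "cj A' T' i (zpow T s b) =
    zpow T s (if (s - i) mod l < l' then cj A T (- ((s - i) mod l)) b else b)"
proof -
  define r where "r = (s - i) mod l"
  define b' where "b' = (if r < l' then cj A T (- r) b else b)"
  have r: "0 \<le> r" "r < l" using l' by (auto simp: r_def)
  have b': "b' \<in> B" using B_inv assms r by (simp add: b'_def)
  have "cj A' T' i (zpow T s b) = zpow T' i (A' (zpow T r b))"
    using zpow_T'_level[OF assms, of "- i"] by (simp add: cj_def r_def)
  also have "\<dots> = zpow T' i (zpow T r b')"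
    using A'_level[OF assms(1) r] by (simp add: b'_def)
  also have "\<dots> = zpow T ((r + i) mod l) b'"
    using zpow_T'_level[OF b' r] .
  also have "(r + i) mod l = s"
    using assms by (simp add: r_def mod_simps)
  finally show ?thesis by (simp add: b'_def r_def)
qed

text \<open>What the word \<open>is\<close>, read at level \<open>s\<close> of a closed tower,
  spells at the base in terms of the original pair. It arises by renaming and deleting letters, so
  laws unroll to laws.\<close>

definition unroll :: "int \<Rightarrow> int list \<Rightarrow> int list" where
  "unroll s is = map (\<lambda>i. - ((s - i) mod l)) (filter (\<lambda>i. (s - i) mod l < l') is)"

lemma acts_level:
  assumes "b \<in> B" "0 \<le> s" "s < l"
  shows "acts A' T' is (zpow T s b) = zpow T s (acts A T (unroll s is) b) \<and> acts A T (unroll s is) b \<in> B"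
proof (induction "is")
  case Nil
  then show ?case using assms by (simp add: unroll_def)
next
  case (Cons i "is")
  then have IH: "acts A' T' is (zpow T s b) = zpow T s (acts A T (unroll s is) b)"
    "acts A T (unroll s is) b \<in> B" by auto
  then show ?case
    using cj_level[OF IH(2) assms(2,3), of i] B_inv[OF IH(2), of "(s - i) mod l"] l'
    by (auto simp: acts_Cons unroll_def)
qed

lemma unroll_range: "set (unroll s is) \<subseteq> {- l..0}"
  using l' by (auto simp: unroll_def less_imp_le)

lemma acts_V:
  assumes "v \<in> V"
  shows "acts A' T' is v = acts A T is v \<and> acts A T is v \<in> V"
proof -
  have z: "zpow T' i v = zpow T i v" if "v \<in> V" for i v
  proof (induction i rule: int_induct[where k = 0])
    case (step1 i)
    then show ?case
      using that by (simp add: zpow_Suc_left[OF bij_T] zpow_Suc_left[OF bij_T'] T'_V)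
  next
    case (step2 i)
    have "T' (zpow T' (i - 1) v) = T' (zpow T (i - 1) v)"
      using that step2 zpow_Suc_left[OF bij_T, of "i - 1" v] zpow_Suc_left[OF bij_T', of "i - 1" v]
      by (simp add: T'_V)
    then show ?case using bij_is_inj[OF bij_T'] by (simp add: inj_eq)
  qed simp
  show ?thesis
    using assms by (induction "is") (auto simp: acts_Cons cj_def z A'_V)
qed

lemma acts_other:
  assumes "x \<notin> V" "x \<notin> towers"
  shows "acts A' T' is x = x"
proof -
  have "zpow T' i x = x" for i
  proof (induction i rule: int_induct[where k = 0])
    case (step1 i)
    then show ?case using T'_other[OF assms] by (simp add: zpow_Suc_left[OF bij_T'])
  next
    case (step2 i)
    have "T' (zpow T' (i - 1) x) = T' x"
      using step2 zpow_Suc_left[OF bij_T', of "i - 1" x] T'_other[OF assms] by simp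
    then show ?case using bij_is_inj[OF bij_T'] by (simp add: inj_eq)
  qed simp
  then show ?thesis
    by (induction "is") (auto simp: acts_Cons cj_def A'_other[OF assms])
qed

text \<open>If \<open>l\<close> divides \<open>k\<close>, both letters unroll to the same one. If
  \<open>0 \<le> k \<le> l - l'\<close> and going back \<open>k\<close> steps crosses the seam, it
  ends at level \<open>s - k + l \<ge> l'\<close>, where the letter is deleted; without crossing,
  the two letters are still \<open>k\<close> apart.\<close>

lemma unroll_comm:
  assumes "k \<in> S" "0 \<le> s" "s < l"
  shows "rel_eq S (unroll s [0, k]) (unroll s [k, 0])"
proof (cases "s < l' \<and> (s - k) mod l < l'")
  case True
  then have u: "unroll s [0, k] = [- s, - ((s - k) mod l)]" "unroll s [k, 0] = [- ((s - k) mod l), - s]"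
    using assms by (auto simp: unroll_def)
  from S[OF assms(1)] show ?thesis
  proof
    assume "l dvd k"
    then have "(s - k) mod l = s mod l" by (simp add: mod_eq_dvd_iff)
    then show ?thesis using u assms by simp
  next
    assume k: "0 \<le> k \<and> k \<le> l - l'"
    have "k \<le> s"
    proof (rule ccontr)
      assume "\<not> k \<le> s"
      then have "0 \<le> s - k + l" "s - k + l < l"
        using k l' assms by auto
      then have "(s - k + l) mod l = s - k + l" by (rule mod_pos_pos_trivial)
      then have "(s - k) mod l = s - k + l" by simp
      then show False using True k assms by linarith
    qed
    then have "(s - k) mod l = s - k" using k assms by simp
    then show ?thesis using u rel_eq_comm[OF assms(1), of "- s"] by simp
  qed
next
  case False
  then have "unroll s [0, k] = unroll s [k, 0]"
    using assms by (auto simp: unroll_def)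
  then show ?thesis by simp
qed

theorem admissible_tower: "admissible S A' T'"
  unfolding admissible_def
proof (intro conjI bij_A' bij_T' allI impI ballI)
  fix "is" :: "int list" assume law: "law_eq is []"
  have "acts A' T' is x = x" for x
  proof -
    consider "x \<in> V" | "x \<notin> V" "x \<in> towers" | "x \<notin> V" "x \<notin> towers" by blast
    then show ?thesis
    proof cases
      case 1
      then show ?thesis using acts_V V_law law by simp
    next
      case 2
      then obtain s b where sb: "0 \<le> s" "s < l" "b \<in> B" "x = zpow T s b" by (elim towers_cases)
      have "rel_eq S (unroll s is) []"
        using law_eq_map_filter[OF law] by (intro rel_eq_law) (simp add: unroll_def)
      then have "acts A T (unroll s is) b = b"
        using B_rel[OF sb(3) unroll_range, of "[]" s "is"] by simp
      then show ?thesis using acts_level[OF sb(3,1,2), of "is"] sb by simp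
    next
      case 3
      then show ?thesis by (rule acts_other)
    qed
  qed
  then show "acts A' T' is = id" by auto
next
  fix k assume k: "k \<in> S"
  have "acts A' T' [0, k] x = acts A' T' [k, 0] x" for x
  proof -
    consider "x \<in> V" | "x \<notin> V" "x \<in> towers" | "x \<notin> V" "x \<notin> towers" by blast
    then show ?thesis
    proof cases
      case 1
      then show ?thesis using acts_V V_comm[OF _ k] by metis
    next
      case 2
      then obtain s b where sb: "0 \<le> s" "s < l" "b \<in> B" "x = zpow T s b" by (elim towers_cases)
      then have "acts A T (unroll s [0, k]) b = acts A T (unroll s [k, 0]) b"
        using B_rel[OF sb(3) unroll_range unroll_range unroll_comm[OF k sb(1,2)]] by simp
      then show ?thesis
        using acts_level[OF sb(3,1,2), of "[0, k]"] acts_level[OF sb(3,1,2), of "[k, 0]"] sb by metis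
    next
      case 3
      then show ?thesis using acts_other by metis
    qed
  qed
  then show "acts A' T' [0, k] = acts A' T' [k, 0]" by auto
qed

lemma card_level: "card (level s) = card B"
  unfolding level_def using bij_is_inj[OF bij_zpow[OF bij_T]]
  by (intro card_image) (auto intro: inj_on_subset)

lemma card_levels:
  assumes "I \<subseteq> {0..<l}"
  shows "card (\<Union>s\<in>I. level s) = card I * card B"
proof -
  have "finite I" using assms finite_subset by blast
  then have "card (\<Union>s\<in>I. level s) = (\<Sum>s\<in>I. card (level s))"
  proof (intro card_UN_disjoint ballI impI)
    fix s s' assume s: "s \<in> I" "s' \<in> I" "s \<noteq> s'"
    then have "0 \<le> s" "s < l" "0 \<le> s'" "s' < l" using assms by auto
    then show "level s \<inter> level s' = {}"
      using levels_disjoint[of _ _ s s'] s(3) unfolding level_def by blast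
  qed (use finite_B in \<open>auto simp: level_def\<close>)
  then show ?thesis by (simp add: card_level)
qed

lemma card_towers: "nat l * card B \<le> card \<Omega>"
  using card_levels[of "{0..<l}"] card_mono[OF finite_\<Omega> towers_sub] by (simp add: towers_def)

lemma A'_differs: "{x \<in> \<Omega>. A x \<noteq> A' x} \<subseteq> (\<Omega> - V - towers) \<union> (\<Union>s\<in>{l'..<l}. level s)"
proof
  fix x assume "x \<in> {x \<in> \<Omega>. A x \<noteq> A' x}"
  then have x: "x \<in> \<Omega>" "x \<notin> V" "\<And>s. 0 \<le> s \<Longrightarrow> s < l' \<Longrightarrow> x \<notin> level s"
    by (auto simp: A'_def split: if_splits)
  show "x \<in> (\<Omega> - V - towers) \<union> (\<Union>s\<in>{l'..<l}. level s)"
  proof (cases "x \<in> towers")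
    case True
    then obtain s where "s \<in> {0..<l}" "x \<in> level s" by (auto simp: towers_def)
    with x(3)[of s] have "s \<in> {l'..<l}" by (cases "s < l'") auto
    with \<open>x \<in> level s\<close> show ?thesis by blast
  qed (use x in blast)
qed

lemma T'_differs: "{x \<in> \<Omega>. T x \<noteq> T' x} \<subseteq> (\<Omega> - V - towers) \<union> (\<Union>s\<in>{l - 1}. level s)"
proof
  fix x assume "x \<in> {x \<in> \<Omega>. T x \<noteq> T' x}"
  then have x: "x \<in> \<Omega>" "x \<notin> V" "\<And>s. 0 \<le> s \<Longrightarrow> s < l - 1 \<Longrightarrow> x \<notin> level s"
    by (auto simp: T'_def split: if_splits)
  show "x \<in> (\<Omega> - V - towers) \<union> (\<Union>s\<in>{l - 1}. level s)"
  proof (cases "x \<in> towers")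
    case True
    then obtain s where s: "s \<in> {0..<l}" "x \<in> level s" by (auto simp: towers_def)
    with x(3)[of s] have "s = l - 1" by (cases "s < l - 1") auto
    with s show ?thesis by blast
  qed (use x in blast)
qed

lemma card_A'_differs: "card {x \<in> \<Omega>. A x \<noteq> A' x} \<le> card (\<Omega> - V - towers) + nat (l - l') * card B"
proof -
  have "card {x \<in> \<Omega>. A x \<noteq> A' x} \<le> card ((\<Omega> - V - towers) \<union> (\<Union>s\<in>{l'..<l}. level s))"
    using finite_\<Omega> finite_B by (intro card_mono A'_differs) (auto simp: level_def)
  also have "\<dots> \<le> card (\<Omega> - V - towers) + card (\<Union>s\<in>{l'..<l}. level s)"
    by (rule card_Un_le)
  also have "card (\<Union>s\<in>{l'..<l}. level s) = nat (l - l') * card B"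
    using card_levels[of "{l'..<l}"] l' by simp
  finally show ?thesis .
qed

lemma card_T'_differs: "card {x \<in> \<Omega>. T x \<noteq> T' x} \<le> card (\<Omega> - V - towers) + card B"
proof -
  have "card {x \<in> \<Omega>. T x \<noteq> T' x} \<le> card ((\<Omega> - V - towers) \<union> (\<Union>s\<in>{l - 1}. level s))"
    using finite_\<Omega> finite_B by (intro card_mono T'_differs) (auto simp: level_def)
  also have "\<dots> \<le> card (\<Omega> - V - towers) + card (\<Union>s\<in>{l - 1}. level s)"
    by (rule card_Un_le)
  also have "card (\<Union>s\<in>{l - 1}. level s) = card B"
    using card_levels[of "{l - 1}"] l' by simp
  finally show ?thesis .
qed

end

section \<open>Block orbits and periodic points\<close>

text \<open>Words of any length over a finite alphabet are tested, so that goodness passes along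
  words in that alphabet; up to laws only finitely many relations are involved.\<close>

definition good :: "int set \<Rightarrow> int \<Rightarrow> ('a \<Rightarrow> 'a) \<Rightarrow> ('a \<Rightarrow> 'a) \<Rightarrow> 'a \<Rightarrow> bool" where
  "good S G A T x \<longleftrightarrow> (\<forall>is js. set is \<subseteq> {- G..G} \<and> set js \<subseteq> {- G..G} \<and> rel_eq S is js \<longrightarrow>
     acts A T is x = acts A T js x)"

lemma goodD:
  "good S G A T x \<Longrightarrow> set is \<subseteq> {- G..G} \<Longrightarrow> set js \<subseteq> {- G..G} \<Longrightarrow> rel_eq S is js \<Longrightarrow>
    acts A T is x = acts A T js x"
  by (auto simp: good_def)

lemma good_acts:
  assumes "good S G A T x" "set ks \<subseteq> {- G..G}"
  shows "good S G A T (acts A T ks x)"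
  unfolding good_def
proof (intro allI impI, elim conjE)
  fix "is" js assume "set is \<subseteq> {- G..G}" "set js \<subseteq> {- G..G}" "rel_eq S is js"
  then have "acts A T (is @ ks) x = acts A T (js @ ks) x"
    using assms by (intro goodD[OF assms(1)] rel_eq_append) auto
  then show "acts A T is (acts A T ks x) = acts A T js (acts A T ks x)"
    by (simp add: acts_append)
qed

text \<open>In the group of the laws these are the words in the letters of modulus at most $m$,
  up to central factors involving letters of modulus at most $w$.\<close>

definition blocks :: "int \<Rightarrow> int \<Rightarrow> int list set" where
  "blocks m w = {is. set is \<subseteq> {- w..w} \<and> (\<forall>i. m < \<bar>i\<bar> \<longrightarrow> even (count_list is i))}"

lemma blocks_Nil: "[] \<in> blocks m w"
  by (simp add: blocks_def)

lemma blocks_append: "is \<in> blocks m w \<Longrightarrow> js \<in> blocks m w \<Longrightarrow> is @ js \<in> blocks m w"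
  by (auto simp: blocks_def)

lemma blocks_mono: "is \<in> blocks m w \<Longrightarrow> m \<le> m' \<Longrightarrow> w \<le> w' \<Longrightarrow> is \<in> blocks m' w'"
  unfolding blocks_def by (fastforce simp: subset_iff)

lemma blocks_single: "\<bar>i\<bar> \<le> m \<Longrightarrow> m \<le> w \<Longrightarrow> [i] \<in> blocks m w"
  by (auto simp: blocks_def)

lemma blocks_range: "is \<in> blocks m w \<Longrightarrow> w \<le> G \<Longrightarrow> set is \<subseteq> {- G..G}"
  by (fastforce simp: blocks_def subset_iff)

lemma count_list_map_shift: "count_list (map (\<lambda>i. i + j) is) (i :: int) = count_list is (i - j)"
  by (induction "is") auto

lemma blocks_shift:
  assumes "is \<in> blocks m w" "\<bar>j\<bar> \<le> d"
  shows "map (\<lambda>i. i + j) is \<in> blocks (m + d) (w + d)"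
proof -
  have "i + j \<in> {- (w + d)..w + d}" if "i \<in> set is" for i
  proof -
    have "i \<in> {- w..w}" using assms(1) that by (auto simp: blocks_def)
    with assms(2) show ?thesis unfolding atLeastAtMost_iff by linarith
  qed
  moreover have "even (count_list is (i - j))" if "m + d < \<bar>i\<bar>" for i
  proof -
    have "m < \<bar>i - j\<bar>" using assms(2) that by simp
    then show ?thesis using assms(1) by (simp add: blocks_def)
  qed
  ultimately show ?thesis
    unfolding blocks_def by (simp add: count_list_map_shift image_subset_iff)
qed

context perm_pair
begin

definition orb :: "int \<Rightarrow> int \<Rightarrow> 'a \<Rightarrow> 'a set" where
  "orb m w x = (\<lambda>is. acts A T is x) ` blocks m w"

lemma orb_sub: "x \<in> \<Omega> \<Longrightarrow> orb m w x \<subseteq> \<Omega>"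
  by (auto simp: orb_def)

lemma finite_orb: "x \<in> \<Omega> \<Longrightarrow> finite (orb m w x)"
  by (rule finite_subset[OF orb_sub finite_\<Omega>])

lemma orb_refl [simp]: "x \<in> orb m w x"
  unfolding orb_def by (rule image_eqI[of _ _ "[]"]) (simp_all add: blocks_Nil)

lemma orb_trans:
  assumes "y \<in> orb m w x" "z \<in> orb m w y"
  shows "z \<in> orb m w x"
proof -
  obtain "is" js where "is \<in> blocks m w" "y = acts A T is x" "js \<in> blocks m w" "z = acts A T js y"
    using assms by (auto simp: orb_def)
  then have "z = acts A T (js @ is) x" "js @ is \<in> blocks m w"
    by (simp_all add: acts_append blocks_append)
  then show ?thesis by (auto simp: orb_def)
qed

text \<open>Reversing a word inverts it only where the laws hold, and \<open>x\<close> need not be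
  good. Since \<open>\<Omega>\<close> is finite, the way back is found among the positive powers of
  the word instead.\<close>

lemma orb_sym:
  assumes "x \<in> \<Omega>" "y \<in> orb m w x"
  shows "x \<in> orb m w y"
proof -
  obtain "is" where i: "is \<in> blocks m w" "y = acts A T is x"
    using assms by (auto simp: orb_def)
  have "inj_on (acts A T is) \<Omega>"
    by (rule inj_on_subset[OF bij_is_inj[OF bij_acts[OF bij_A bij_T]] subset_UNIV])
  moreover have "acts A T is ` \<Omega> \<subseteq> \<Omega>" by (simp add: image_subset_iff)
  ultimately obtain n where n: "0 < n" "(acts A T is ^^ n) x = x"
    using funpow_return[OF finite_\<Omega> _ _ assms(1)] by blast
  have "(acts A T is ^^ k) y \<in> orb m w y" for k
  proof (induction k)
    case (Suc k)
    have "(acts A T is ^^ Suc k) y \<in> orb m w ((acts A T is ^^ k) y)"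
      using i(1) by (auto simp: orb_def)
    with Suc show ?case by (rule orb_trans)
  qed simp
  moreover have "(acts A T is ^^ (n - 1)) y = (acts A T is ^^ n) x"
    using n(1) i(2) by (cases n) (simp_all add: funpow_swap1)
  ultimately show ?thesis using n(2) by metis
qed

lemma orb_eq:
  assumes "x \<in> \<Omega>" "y \<in> orb m w x"
  shows "orb m w y = orb m w x"
proof
  show "orb m w y \<subseteq> orb m w x" by (intro subsetI orb_trans[OF assms(2)])
  show "orb m w x \<subseteq> orb m w y" by (intro subsetI orb_trans[OF orb_sym[OF assms]])
qed

lemma orb_mono: "m \<le> m' \<Longrightarrow> w \<le> w' \<Longrightarrow> orb m w x \<subseteq> orb m' w' x"
  unfolding orb_def using blocks_mono[of _ m w m' w'] by (intro image_mono) blast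

lemma orb_cj: "x \<in> \<Omega> \<Longrightarrow> \<bar>i\<bar> \<le> m \<Longrightarrow> m \<le> w \<Longrightarrow> orb m w (cj A T i x) = orb m w x"
proof -
  assume "x \<in> \<Omega>" "\<bar>i\<bar> \<le> m" "m \<le> w"
  then have "acts A T [i] x \<in> orb m w x"
    using blocks_single unfolding orb_def by blast
  from orb_eq[OF \<open>x \<in> \<Omega>\<close> this] show ?thesis by simp
qed

lemma orb_shift:
  assumes "y \<in> orb m w x" "\<bar>j\<bar> \<le> d"
  shows "zpow T j y \<in> orb (m + d) (w + d) (zpow T j x)"
proof -
  obtain "is" where i: "is \<in> blocks m w" "y = acts A T is x"
    using assms by (auto simp: orb_def)
  then have "zpow T j y = acts A T (map (\<lambda>i. i + j) is) (zpow T j x)"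
    by (simp add: zpow_acts[OF bij_T])
  then show ?thesis using blocks_shift[OF i(1) assms(2)] by (auto simp: orb_def)
qed

lemma orb_good:
  assumes "good S G A T x" "y \<in> orb m w x" "w \<le> G"
  shows "good S G A T y"
proof -
  obtain "is" where "is \<in> blocks m w" "y = acts A T is x" using assms(2) by (auto simp: orb_def)
  then show ?thesis using good_acts[OF assms(1) blocks_range[OF _ assms(3)]] by simp
qed

text \<open>Either translation by $p$ preserves the whole class or it moves at least half of it out of the class:
  the block of the translated letters normalises the block of the class.\<close>

lemma orbit_dichotomy:
  assumes x: "x \<in> \<Omega>" "good S G A T x" and par: "0 \<le> p" "0 \<le> m" "m + p \<le> w" "w + p \<le> G"
  defines "O' \<equiv> orb m w x"
  defines "R \<equiv> {y \<in> O'. zpow T p y \<in> O'}"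
  shows "R = {} \<or> R = O' \<or> card R \<le> card (O' - R)"
proof -
  have False if "\<not> card R \<le> card (O' - R)" "R \<noteq> O'" "R \<noteq> {}"
  proof -
    obtain a where a: "a \<in> O'" "zpow T p a \<in> O'" using \<open>R \<noteq> {}\<close> by (auto simp: R_def)
    obtain b where b: "b \<in> O'" "zpow T p b \<notin> O'" using \<open>R \<noteq> O'\<close> by (auto simp: R_def)
    have O\<Omega>: "O' \<subseteq> \<Omega>" using orb_sub[OF x(1)] by (simp add: O'_def)
    have Oeq: "orb m w y = O'" if "y \<in> O'" for y
      using orb_eq[OF x(1), of y m w] that by (simp add: O'_def)
    obtain ys where ys: "ys \<in> blocks m w" "b = acts A T ys a"
      using Oeq[OF a(1)] b(1) by (auto simp: orb_def)
    \<comment> \<open>\<open>ys\<close> carries the returning point \<open>a\<close> to the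
      non-returning point \<open>b\<close>. If it carried some returning \<open>c\<close> to a
      returning point, comparing the two translated motions would make \<open>b\<close> return.
      Hence it injects \<open>R\<close> into its complement.\<close>
    have maps: "acts A T ys c \<in> O' - R" if c: "c \<in> R" for c
    proof
      show "acts A T ys c \<in> O'"
        using Oeq[of c] c ys(1) by (auto simp: R_def orb_def)
      show "acts A T ys c \<notin> R"
      proof
        assume "acts A T ys c \<in> R"
        then have yc: "zpow T p (acts A T ys c) \<in> O'" by (simp add: R_def)
        \<comment> \<open>After translation by \<open>p\<close> the word may use letters beyond
          \<open>w\<close>, but those of modulus above \<open>m + p\<close> occur an even number of
          times, so \<open>us\<close> conjugates like \<open>ut\<close>.\<close>
        define us where "us = map (\<lambda>i. i + p) ys"
        define ut where "ut = filter (\<lambda>i. \<bar>i\<bar> \<le> m + p) us"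
        have us: "us \<in> blocks (m + p) (w + p)"
          unfolding us_def using ys(1) par by (intro blocks_shift) auto
        have "zpow T p c \<in> O'" using c by (simp add: R_def)
        then obtain zs where zs: "zs \<in> blocks m w" "zpow T p c = acts A T zs (zpow T p a)"
          using Oeq[OF a(2)] by (auto simp: orb_def)
        have ev: "even (count_list us i)" if "\<not> \<bar>i\<bar> \<le> m + p" for i
          using us that by (auto simp: blocks_def)
        have law: "rel_eq S (us @ zs) ((ut @ zs @ rev ut) @ us)"
          unfolding ut_def by (intro rel_eq_law law_eq_conj ev)
        \<comment> \<open>Every letter of \<open>ut\<close> comes back in \<open>rev ut\<close>, so
          the conjugate has the parities of \<open>zs\<close> and is again a block word.\<close>
        have "set ut \<subseteq> {- w..w}" using par by (auto simp: ut_def)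
        then have vs: "ut @ zs @ rev ut \<in> blocks m w"
          using zs(1) by (auto simp: blocks_def count_list_rev)
        have "good S G A T (zpow T p a)"
          using orb_good[OF x(2)] a(2) par by (simp add: O'_def)
        then have "acts A T (us @ zs) (zpow T p a) = acts A T ((ut @ zs @ rev ut) @ us) (zpow T p a)"
        proof (rule goodD[OF _ _ _ law])
          have "w \<le> G" using par by simp
          then show "set (us @ zs) \<subseteq> {- G..G}" "set ((ut @ zs @ rev ut) @ us) \<subseteq> {- G..G}"
            using blocks_range[OF us, of G] blocks_range[OF zs(1), of G] blocks_range[OF vs, of G] par by simp_all
        qed
        moreover have "acts A T (us @ zs) (zpow T p a) = zpow T p (acts A T ys c)"
          by (simp add: acts_append zs(2)[symmetric] us_def zpow_acts[OF bij_T])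
        ultimately have "acts A T (ut @ zs @ rev ut) (acts A T us (zpow T p a)) \<in> O'"
          using yc by (simp add: acts_append)
        moreover have "acts A T us (zpow T p a) = zpow T p b"
          by (simp add: us_def ys(2) zpow_acts[OF bij_T])
        ultimately have *: "acts A T (ut @ zs @ rev ut) (zpow T p b) \<in> O'" by simp
        have "zpow T p b \<in> \<Omega>" using b O\<Omega> by auto
        then have "zpow T p b \<in> orb m w (acts A T (ut @ zs @ rev ut) (zpow T p b))"
          by (rule orb_sym) (use vs in \<open>auto simp: orb_def\<close>)
        then show False unfolding Oeq[OF *] using b(2) by simp
      qed
    qed
    have "finite O'" using finite_orb[OF x(1)] by (simp add: O'_def)
    then have "card R \<le> card (O' - R)"
      using maps inj_on_subset[OF bij_is_inj[OF bij_acts[OF bij_A bij_T]] subset_UNIV]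
      by (intro card_inj_on_le[of "acts A T ys"]) auto
    then show False using \<open>\<not> card R \<le> card (O' - R)\<close> by simp
  qed
  then show ?thesis by blast
qed

section \<open>Points returning to their block orbit\<close>

definition periodic :: "int \<Rightarrow> int \<Rightarrow> int \<Rightarrow> 'a set" where
  "periodic p m w = {x \<in> \<Omega>. zpow T p x \<in> orb m w x}"

lemma periodic_mono: "m \<le> m' \<Longrightarrow> w \<le> w' \<Longrightarrow> periodic p m w \<subseteq> periodic p m' w'"
  using orb_mono by (fastforce simp: periodic_def)

text \<open>Translating a class by \<open>p\<close> costs \<open>p\<close> in both parameters. The
  resulting gap between the two scales is what \<open>exists_scale\<close> makes small.\<close>

lemma periodic_orb:
  assumes "x \<in> periodic p m w" "y \<in> orb m w x" "0 \<le> p"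
  shows "y \<in> periodic p (m + p) (w + p)"
proof -
  have x: "x \<in> \<Omega>" "zpow T p x \<in> orb m w x" using assms by (auto simp: periodic_def)
  have sub: "orb m w z \<subseteq> orb (m + p) (w + p) z" for z using assms(3) by (intro orb_mono) auto
  have "zpow T p y \<in> orb (m + p) (w + p) (zpow T p x)"
    using assms by (intro orb_shift) auto
  also have "\<dots> = orb (m + p) (w + p) x" using x sub by (intro orb_eq) auto
  also have "\<dots> = orb (m + p) (w + p) y" using x sub assms(2) by (intro orb_eq[symmetric]) auto
  finally show ?thesis using x assms(2) orb_sub by (auto simp: periodic_def)
qed

text \<open>The return after \<open>j\<close> steps is iterated; all translations involved are by at
  most \<open>p\<close>, so every step takes place in orbits for the same enlarged parameters. With
  \<open>p = Q!\<close> every return within time \<open>Q\<close> is covered.\<close>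

lemma periodic_of_dvd:
  assumes "x \<in> \<Omega>" "zpow T j x \<in> orb m w x" "0 < j" "j dvd p" "0 < p"
  shows "x \<in> periodic p (m + p) (w + p)"
proof -
  have "j \<le> p" using assms by (simp add: zdvd_imp_le)
  have sub: "orb m w z \<subseteq> orb (m + p) (w + p) z" for z using assms(5) by (intro orb_mono) auto
  have step: "zpow T (j * int n) x \<in> orb (m + p) (w + p) x" if "j * int n \<le> p" for n
    using that
  proof (induction n)
    case (Suc n)
    have "zpow T (j * int n) (zpow T j x) \<in> orb (m + p) (w + p) (zpow T (j * int n) x)"
      using Suc.prems assms by (intro orb_shift) (auto simp: algebra_simps)
    then have *: "zpow T (j * int (Suc n)) x \<in> orb (m + p) (w + p) (zpow T (j * int n) x)"
      by (simp add: zpow_add_apply[OF bij_T] algebra_simps)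
    have "j * int n \<le> p" using Suc.prems assms(3) by (simp add: algebra_simps)
    from orb_trans[OF Suc.IH[OF this] *] show ?case .
  qed simp
  obtain q where q: "p = j * q" using assms(4) by blast
  then have "0 \<le> q" using assms by (simp add: zero_less_mult_iff)
  then show ?thesis using step[of "nat q"] q assms(1) by (simp add: periodic_def)
qed

text \<open>The whole class is required to be periodic at its own scale, which makes the power
  \<open>p\<close> of \<open>T\<close> map the class into itself.\<close>

definition core :: "int set \<Rightarrow> int \<Rightarrow> int \<Rightarrow> int \<Rightarrow> int \<Rightarrow> 'a set" where
  "core S G p m w = {x \<in> \<Omega>. good S G A T x \<and> orb m w x \<subseteq> periodic p m w}"

text \<open>Since \<open>T\<close> to the power \<open>p\<close> maps a class of the core to itself, this set is a union of orbits of
  bounded size, on which the given permutations need no change.\<close>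

definition stable_part :: "int set \<Rightarrow> int \<Rightarrow> int \<Rightarrow> int \<Rightarrow> int \<Rightarrow> 'a set" where
  "stable_part S G p m w = (\<Union>s\<in>{0..<p}. zpow T s ` core S G p m w)"

lemma core_orb:
  assumes "x \<in> core S G p m w" "y \<in> orb m w x" "w \<le> G"
  shows "y \<in> core S G p m w"
proof -
  have x: "x \<in> \<Omega>" "good S G A T x" "orb m w x \<subseteq> periodic p m w" using assms(1) by (auto simp: core_def)
  have "orb m w y = orb m w x" using orb_eq[OF x(1) assms(2)] .
  moreover have "y \<in> \<Omega>" using orb_sub[OF x(1)] assms(2) by blast
  moreover have "good S G A T y" using orb_good[OF x(2) assms(2,3)] .
  ultimately show ?thesis using x by (simp add: core_def)
qed

lemma core_zpow:
  assumes "x \<in> core S G p m w" "w \<le> G"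
  shows "zpow T p x \<in> core S G p m w"
proof (rule core_orb[OF assms(1) _ assms(2)])
  have "x \<in> periodic p m w" using assms(1) orb_refl by (auto simp: core_def)
  then show "zpow T p x \<in> orb m w x" by (simp add: periodic_def)
qed

lemma stable_part_sub: "stable_part S G p m w \<subseteq> \<Omega>"
  by (auto simp: stable_part_def core_def)

lemma core_sub_stable_part: "0 < p \<Longrightarrow> core S G p m w \<subseteq> stable_part S G p m w"
  by (force simp: stable_part_def)

lemma stable_part_T:
  assumes "w \<le> G"
  shows "T ` stable_part S G p m w \<subseteq> stable_part S G p m w"
proof
  fix y assume "y \<in> T ` stable_part S G p m w"
  then obtain s x where sx: "0 \<le> s" "s < p" "x \<in> core S G p m w" "y = zpow T (s + 1) x"
    by (auto simp: stable_part_def zpow_shift[OF bij_T])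
  show "y \<in> stable_part S G p m w"
  proof (cases "s + 1 = p")
    case True
    then have "y \<in> core S G p m w" "0 < p" using core_zpow assms sx by auto
    then show ?thesis using core_sub_stable_part by blast
  next
    case False
    then show ?thesis using sx by (auto simp: stable_part_def intro!: bexI[of _ "s + 1"])
  qed
qed

lemma stable_part_A:
  assumes "w \<le> G" "p \<le> m" "m \<le> w"
  shows "A ` stable_part S G p m w \<subseteq> stable_part S G p m w"
proof
  fix y assume "y \<in> A ` stable_part S G p m w"
  then obtain s x where sx: "0 \<le> s" "s < p" "x \<in> core S G p m w" "y = A (zpow T s x)"
    by (auto simp: stable_part_def)
  have "y = zpow T s (cj A T (- s) x)"
    using sx by (simp add: cj_def bij_T)
  moreover have "cj A T (- s) x \<in> core S G p m w"
  proof (rule core_orb[OF sx(3) _ assms(1)])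
    have "x \<in> \<Omega>" using sx by (simp add: core_def)
    then have "orb m w (cj A T (- s) x) = orb m w x" using sx assms by (intro orb_cj) auto
    then show "cj A T (- s) x \<in> orb m w x" using orb_refl[of "cj A T (- s) x" m w] by (simp only:)
  qed
  ultimately show "y \<in> stable_part S G p m w" using sx by (auto simp: stable_part_def)
qed

lemma core_period:
  assumes "x \<in> core S G p m w" "w \<le> G" "0 \<le> p" "card (orb m w x) \<le> K"
  shows "zpow T (p * fact K) x = x"
proof -
  have x: "x \<in> \<Omega>" using assms by (simp add: core_def)
  have "zpow T p y \<in> orb m w x" if "y \<in> orb m w x" for y
  proof -
    have "y \<in> periodic p m w" using that assms(1) by (auto simp: core_def)
    then show ?thesis using orb_eq[OF x that] by (simp add: periodic_def)
  qed
  then have "(zpow T p ^^ fact K) x = x"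
    using assms finite_orb[OF x] inj_on_subset[OF bij_is_inj[OF bij_zpow[OF bij_T]] subset_UNIV]
    by (intro funpow_fact_fixed[of "orb m w x"]) auto
  moreover have "(zpow T p ^^ n) x = zpow T (p * int n) x" for n
    by (induction n) (simp_all add: zpow_add_apply[OF bij_T] algebra_simps)
  ultimately show ?thesis by simp
qed

text \<open>A point of the stable part is reached from the core by fewer than \<open>p\<close>
  steps, and moving a word back to the core lowers its letters by as much; hence the margin
  \<open>p\<close> at the lower end.\<close>

lemma stable_part_rel:
  assumes v: "v \<in> stable_part S G p m w" and par: "w \<le> G" "p \<le> m" "m \<le> w" "0 < p"
    and K: "\<And>x. x \<in> \<Omega> \<Longrightarrow> good S G A T x \<Longrightarrow> card (orb m w x) \<le> K"
    and rel: "rel_eq S is js" and "set is \<subseteq> {p - G..G}" "set js \<subseteq> {p - G..G}"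
  shows "acts A T is v = acts A T js v"
proof -
  obtain s x where sx: "0 \<le> s" "s < p" "x \<in> core S G p m w" "v = zpow T s x"
    using v by (auto simp: stable_part_def)
  have *: "acts A T ks v = zpow T s (acts A T (map (\<lambda>i. i + (- s)) ks) x)" for ks
    using sx by (simp add: acts_zpow[OF bij_T])
  have "good S G A T x" using sx by (simp add: core_def)
  then have "acts A T (map (\<lambda>i. i + (- s)) is) x = acts A T (map (\<lambda>i. i + (- s)) js) x"
    by (rule goodD) (use assms sx rel_eq_shift[OF rel, of "- s"] in \<open>fastforce simp: subset_iff\<close>)+
  then show ?thesis by (simp only: *)
qed

lemma stable_part_period:
  assumes v: "v \<in> stable_part S G p m w" and par: "w \<le> G" "0 < p"
    and K: "\<And>x. x \<in> \<Omega> \<Longrightarrow> good S G A T x \<Longrightarrow> card (orb m w x) \<le> K"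
  shows "zpow T (p * fact K) v = v"
proof -
  obtain s x where sx: "0 \<le> s" "s < p" "x \<in> core S G p m w" "v = zpow T s x"
    using v by (auto simp: stable_part_def)
  then have "zpow T (p * fact K) x = x"
    using par K[of x] core_period[OF sx(3) par(1)] by (simp add: core_def)
  then have "zpow T s (zpow T (p * fact K) x) = v" using sx by simp
  then show ?thesis using sx by (simp add: zpow_add_apply[OF bij_T] add.commute)
qed

lemma acts_periodic:
  assumes V: "V \<subseteq> \<Omega>" "A ` V \<subseteq> V" "T ` V \<subseteq> V"
    and per: "\<And>v. v \<in> V \<Longrightarrow> zpow T P v = v" and v: "v \<in> V"
  shows "acts A T is v = acts A T (map (\<lambda>i. i mod P) is) v \<and> acts A T is v \<in> V"
proof -
  note AV = invariant_iff(1)[OF V] and zV = invariant_iff(2)[OF V]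
  have perz: "zpow T (P * q) x = x" if "x \<in> V" for q x
  proof (induction q rule: int_induct[where k = 0])
    case (step1 q)
    then show ?case
      using per[OF that] zpow_add[OF bij_T, of "P * q" P x] by (simp add: algebra_simps)
  next
    case (step2 q)
    then show ?case
      using per[OF that] zpow_add[OF bij_T, of "P * (q - 1)" P x] by (simp add: algebra_simps)
  qed simp
  have zmod: "zpow T i x = zpow T (i mod P) x" if "x \<in> V" for i x
    using perz[OF that, of "i div P"] zpow_add[OF bij_T, of "i mod P" "P * (i div P)" x] by simp
  have zmod': "zpow T (- i) x = zpow T (- (i mod P)) x" if "x \<in> V" for i x
  proof -
    have "- (i mod P) = - i + P * (i div P)" by (simp add: minus_mod_eq_mult_div[symmetric])
    then show ?thesis using zpow_add[OF bij_T, of "- i" "P * (i div P)" x] perz[OF that] by simp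
  qed
  have cjV: "cj A T i x \<in> V" if "x \<in> V" for i x
    using that zV AV by (simp add: cj_def)
  have cjmod: "cj A T i x = cj A T (i mod P) x" if "x \<in> V" for i x
  proof -
    have "A (zpow T (- i) x) \<in> V" using that zV AV by simp
    then show ?thesis using zmod'[OF that, of i] zmod[of _ i] by (simp add: cj_def)
  qed
  show ?thesis
  proof (induction "is")
    case (Cons i "is")
    have a: "acts A T (map (\<lambda>i. i mod P) is) v = acts A T is v" "acts A T is v \<in> V"
      by (rule conjunct1[OF Cons, symmetric], rule conjunct2[OF Cons])
    from cjV[OF a(2), of i] cjmod[OF a(2), of i] show ?case by (simp add: acts_Cons a(1))
  qed (use v in simp)
qed

text \<open>On the stable part \<open>T\<close> has the period \<open>p * fact K\<close>, so letters
  matter only modulo this number, and any law reduces to one with letters in the range where points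
  are good. Commutations at multiples of the period become trivial; the other ones are assumed to
  lie within reach of \<open>G\<close>.\<close>

lemma stable_part_relations:
  assumes v: "v \<in> stable_part S G p m w" and par: "w \<le> G" "p \<le> m" "m \<le> w" "0 < p"
    and K: "\<And>x. x \<in> \<Omega> \<Longrightarrow> good S G A T x \<Longrightarrow> card (orb m w x) \<le> K"
    and G: "p + p * fact K \<le> G"
  shows "law_eq is [] \<Longrightarrow> acts A T is v = v"
    and "k \<in> S \<Longrightarrow> p * fact K dvd k \<or> 0 \<le> k \<and> k \<le> G \<Longrightarrow> acts A T [0, k] v = acts A T [k, 0] v"
proof -
  define P where "P = p * fact K"
  have "0 < P" using par by (simp add: P_def)
  have per: "zpow T P u = u" if "u \<in> stable_part S G p m w" for u
    unfolding P_def by (rule stable_part_period[OF that par(1,4) K])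
  have red: "acts A T is v = acts A T (map (\<lambda>i. i mod P) is) v" for "is"
    by (rule conjunct1[OF acts_periodic[OF stable_part_sub stable_part_A[OF par(1-3)] stable_part_T[OF par(1)] per v]])
  have range: "set (map (\<lambda>i. i mod P) is) \<subseteq> {p - G..G}" for "is" :: "int list"
  proof
    fix j assume "j \<in> set (map (\<lambda>i. i mod P) is)"
    then have "0 \<le> j" "j < P" using \<open>0 < P\<close> by auto
    then show "j \<in> {p - G..G}" using G par by (simp add: P_def)
  qed
  show "acts A T is v = v" if "law_eq is []"
  proof -
    have "rel_eq S (map (\<lambda>i. i mod P) is) []"
      using law_eq_map[OF that] by (intro rel_eq_law) simp
    then have "acts A T (map (\<lambda>i. i mod P) is) v = acts A T [] v"
      using range par G \<open>0 < P\<close> by (intro stable_part_rel[OF v par K]) auto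
    then show ?thesis using red[of "is"] by simp
  qed
  show "acts A T [0, k] v = acts A T [k, 0] v" if k: "k \<in> S" "p * fact K dvd k \<or> 0 \<le> k \<and> k \<le> G"
    using k(2)
  proof
    assume "p * fact K dvd k"
    then have "k mod P = 0" by (simp add: P_def)
    then show ?thesis using red[of "[0, k]"] red[of "[k, 0]"] by simp
  next
    assume "0 \<le> k \<and> k \<le> G"
    then show ?thesis
      using rel_eq_comm[OF k(1), of 0] par G \<open>0 < P\<close> by (intro stable_part_rel[OF v par K]) (auto simp: P_def)
  qed
qed

end

section \<open>Cutting into towers\<close>

text \<open>The number of steps from \<open>x\<close> to the smallest label among those of
  \<open>x, ..., T ^ (Q - 1) x\<close>: a countdown that runs along the orbits of \<open>T\<close>
  and is used to place the cuts.\<close>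

definition offset :: "('a \<Rightarrow> nat) \<Rightarrow> ('a \<Rightarrow> 'a) \<Rightarrow> nat \<Rightarrow> 'a \<Rightarrow> nat" where
  "offset lab T Q x = (LEAST j. j < Q \<and> (\<forall>i<Q. lab (zpow T (int j) x) \<le> lab (zpow T (int i) x)))"

text \<open>The windows of \<open>x\<close> and \<open>T x\<close> together cover the times
  \<open>0\<close> to \<open>Q\<close>. If the minimum over all of them is at neither end, both
  windows contain it, one step nearer for \<open>T x\<close>.\<close>

lemma offset_step:
  assumes T: "bij T"
    and inj: "inj_on (\<lambda>i. lab (zpow T (int i) x)) {0..Q}"
    and no_end: "\<not> (\<exists>e\<in>{0, Q}. \<forall>i\<le>Q. lab (zpow T (int e) x) \<le> lab (zpow T (int i) x))"
  shows "offset lab T Q (T x) + 1 = offset lab T Q x"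
proof -
  define g where "g i = lab (zpow T (int i) x)" for i
  have "Min (g ` {0..Q}) \<in> g ` {0..Q}" by (rule Min_in) auto
  then obtain q where q: "q \<in> {0..Q}" "g q = Min (g ` {0..Q})" by force
  have min: "g q \<le> g i" if "i \<le> Q" for i
    unfolding q(2) using that by (intro Min_le) auto
  have "\<not> (\<forall>i\<le>Q. g e \<le> g i)" if "e \<in> {0, Q}" for e
    using no_end that unfolding g_def by blast
  with min have "q \<notin> {0, Q}" by metis
  then have q': "0 < q" "q < Q" using q by auto
  have uniq: "j = q" if "j \<le> Q" "g j \<le> g q" for j
    using inj_onD[OF inj[folded g_def], of j q] min[OF that(1)] that q by auto
  have "offset lab T Q x = q"
    unfolding offset_def g_def[symmetric]
  proof (rule Least_equality)
    show "q < Q \<and> (\<forall>i<Q. g q \<le> g i)" using q' min by auto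
    show "q \<le> j" if "j < Q \<and> (\<forall>i<Q. g j \<le> g i)" for j
      using uniq[of j] that q' by auto
  qed
  moreover have "offset lab T Q (T x) = q - 1"
  proof -
    have sh: "lab (zpow T (int i) (T x)) = g (i + 1)" for i
      by (simp add: g_def zpow_shift(1)[OF T] add.commute)
    show ?thesis
      unfolding offset_def sh
    proof (rule Least_equality)
      show "q - 1 < Q \<and> (\<forall>i<Q. g (q - 1 + 1) \<le> g (i + 1))" using q' min by auto
      show "q - 1 \<le> j" if "j < Q \<and> (\<forall>i<Q. g (j + 1) \<le> g (i + 1))" for j
      proof -
        have "g (j + 1) \<le> g (q - 1 + 1)" using that q' by (meson less_imp_diff_less)
        then show ?thesis using uniq[of "j + 1"] that q' by simp
      qed
    qed
  qed
  ultimately show ?thesis using q' by simp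
qed

context perm_pair
begin

definition bad :: "int set \<Rightarrow> int \<Rightarrow> 'a set" where
  "bad S G = {x \<in> \<Omega>. \<not> good S G A T x}"

lemma finite_bad: "finite (bad S G)"
  using finite_\<Omega> by (simp add: bad_def)

lemma finite_periodic: "finite (periodic p m w)"
  using finite_\<Omega> by (simp add: periodic_def)

text \<open>The class of a good periodic point outside the stable part is not entirely periodic, so
  by the dichotomy at least half of it fails to be periodic at this scale. By
  \<open>periodic_orb\<close> that half is periodic at the next scale, and distinct classes are
  disjoint. So such points are no more numerous than the points gained by enlarging the
  scale.\<close>

lemma card_periodic_unstable:
  assumes par: "0 < p" "0 \<le> m" "m + p \<le> w" "w + p \<le> G"
  shows "card (periodic p m w - stable_part S G p m w)
    \<le> card (bad S G) + card (periodic p (m + p) (w + p) - periodic p m w)"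
proof -
  define P where "P = periodic p m w"
  define D where "D = periodic p (m + p) (w + p) - P"
  define X where "X = {x \<in> P - stable_part S G p m w. good S G A T x}"
  define \<O> where "\<O> = orb m w ` X"
  have XP: "X \<subseteq> P" and X\<Omega>: "X \<subseteq> \<Omega>" by (auto simp: X_def P_def periodic_def)
  have fin: "finite P" "finite X" "finite D" "finite \<O>"
    using finite_periodic by (auto simp: P_def X_def D_def \<O>_def)
  have fO: "finite U" if "U \<in> \<O>" for U
    using that X\<Omega> finite_orb by (auto simp: \<O>_def)
  have disj: "U \<inter> U' = {}" if UU: "U \<in> \<O>" "U' \<in> \<O>" "U \<noteq> U'" for U U'
  proof (rule ccontr)
    assume "U \<inter> U' \<noteq> {}"
    then obtain y where y: "y \<in> U" "y \<in> U'" by blast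
    obtain x where x: "x \<in> \<Omega>" "U = orb m w x" using UU(1) X\<Omega> unfolding \<O>_def by blast
    obtain x' where x': "x' \<in> \<Omega>" "U' = orb m w x'" using UU(2) X\<Omega> unfolding \<O>_def by blast
    show False using orb_eq[OF x(1), of y m w] orb_eq[OF x'(1), of y m w] x x' y UU(3) by simp
  qed
  have each: "card (U \<inter> P) \<le> card (U - P)" "U - P \<subseteq> D" if U: "U \<in> \<O>" for U
  proof -
    obtain x where x: "x \<in> X" "U = orb m w x" using U by (auto simp: \<O>_def)
    have x\<Omega>: "x \<in> \<Omega>" and gx: "good S G A T x" and xP: "x \<in> P"
      using x(1) XP X\<Omega> by (auto simp: X_def)
    have UP: "{y \<in> U. zpow T p y \<in> U} = U \<inter> P"
      using orb_eq[OF x\<Omega>, of _ m w] orb_sub[OF x\<Omega>, of m w] unfolding x(2) P_def periodic_def by blast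
    have "U \<inter> P \<noteq> {}" using x xP orb_refl by blast
    moreover have "U \<inter> P \<noteq> U"
    proof
      assume "U \<inter> P = U"
      then have "x \<in> core S G p m w" using x gx x\<Omega> by (auto simp: core_def P_def)
      then have "x \<in> stable_part S G p m w" using core_sub_stable_part[OF par(1), of S G m w] by blast
      then show False using x(1) by (simp add: X_def)
    qed
    ultimately show "card (U \<inter> P) \<le> card (U - P)"
      using orbit_dichotomy[OF x\<Omega> gx, of p m w] par unfolding x(2)[symmetric] UP
      by (simp add: Diff_Int_distrib Diff_Int)
    show "U - P \<subseteq> D"
      using periodic_orb[of x p m w] xP par x(2) unfolding D_def P_def by auto
  qed
  have "X \<subseteq> (\<Union>U\<in>\<O>. U \<inter> P)" using XP orb_refl by (auto simp: \<O>_def)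
  then have "card X \<le> card (\<Union>U\<in>\<O>. U \<inter> P)"
    using fin by (intro card_mono) auto
  also have "\<dots> = (\<Sum>U\<in>\<O>. card (U \<inter> P))"
    using fin disj by (intro card_UN_disjoint) auto
  also have "\<dots> \<le> (\<Sum>U\<in>\<O>. card (U - P))" using each(1) by (rule sum_mono)
  also have "\<dots> = card (\<Union>U\<in>\<O>. U - P)"
    using fin disj fO by (intro card_UN_disjoint[symmetric]) auto
  also have "\<dots> \<le> card D" using each(2) fin by (intro card_mono) auto
  finally have "card X \<le> card D" .
  have "P - stable_part S G p m w \<subseteq> bad S G \<union> X"
    by (auto simp: X_def P_def bad_def periodic_def)
  then have "card (P - stable_part S G p m w) \<le> card (bad S G \<union> X)"
    using fin finite_bad by (intro card_mono) auto
  also have "\<dots> \<le> card (bad S G) + card X" by (rule card_Un_le)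
  finally show ?thesis using \<open>card X \<le> card D\<close> by (simp add: P_def D_def)
qed

text \<open>Labels are ranks of block orbits in a suitable order. Along \<open>Q\<close> steps from
  a point outside the enlarged periodic set these orbits are distinct, because a coincidence would
  be a return after at most \<open>Q\<close> steps, and all such times divide
  \<open>p = Q!\<close>.\<close>

lemma exists_labels:
  assumes p: "p = fact Q" and par: "0 \<le> m" "m \<le> w"
    and d: "d = p + int Q"
  shows "\<exists>lab :: 'a \<Rightarrow> nat. (\<forall>x\<in>\<Omega>. \<forall>y\<in>\<Omega>. orb m w x = orb m w y \<longrightarrow> lab x = lab y) \<and>
    Suc Q * card {x \<in> \<Omega> - periodic p (m + d) (w + d). offset lab T Q (T x) + 1 \<noteq> offset lab T Q x}
      \<le> 2 * card \<Omega>"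
proof -
  define X where "X = orb m w ` \<Omega>"
  define Y where "Y = \<Omega> - periodic p (m + d) (w + d)"
  define c where "c y i = orb m w (zpow T (int i) y)" for y i
  have inj: "inj_on (c y) {0..Q}" if y: "y \<in> Y" for y
  proof (rule linorder_inj_onI)
    fix i j assume ij: "i < j" "i \<in> {0..Q}" "j \<in> {0..Q}"
    show "c y i \<noteq> c y j"
    proof
      assume "c y i = c y j"
      then have "zpow T (int j) y \<in> orb m w (zpow T (int i) y)"
        using orb_refl[of "zpow T (int j) y" m w] by (simp add: c_def)
      \<comment> \<open>Shifting the coincidence back by \<open>i\<close> costs at most
        \<open>Q\<close> in the parameters, and passing from the return time \<open>j - i\<close> to
        \<open>p\<close> costs \<open>p\<close>; together this is \<open>d\<close>.\<close>
      then have "zpow T (- int i) (zpow T (int j) y) \<in> orb (m + int Q) (w + int Q) (zpow T (- int i) (zpow T (int i) y))"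
        using ij by (intro orb_shift) auto
      then have *: "zpow T (int (j - i)) y \<in> orb (m + int Q) (w + int Q) y"
        using ij by (simp add: zpow_add_apply[OF bij_T] of_nat_diff)
      have "j - i dvd fact Q" using ij by (intro dvd_fact) auto
      then have "int (j - i) dvd p" unfolding p by (metis of_nat_dvd_iff of_nat_fact)
      then have "y \<in> periodic p (m + int Q + p) (w + int Q + p)"
        using y ij p by (intro periodic_of_dvd[OF _ *]) (auto simp: Y_def)
      then show False using y by (simp add: Y_def d ac_simps)
    qed
  qed auto
  have "c y i \<in> X" if "y \<in> Y" for y i
    using that by (auto simp: c_def X_def Y_def)
  then obtain f :: "'a set \<Rightarrow> nat" where f: "inj_on f X"
    "Suc Q * card {y \<in> Y. \<exists>e\<in>{0, Q}. \<forall>i\<le>Q. f (c y e) \<le> f (c y i)} \<le> 2 * card Y"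
    using exists_order_few_window_ends[of X Y c Q] inj finite_\<Omega> by (auto simp: X_def Y_def)
  define lab where "lab x = f (orb m w x)" for x
  have "{x \<in> Y. offset lab T Q (T x) + 1 \<noteq> offset lab T Q x}
      \<subseteq> {y \<in> Y. \<exists>e\<in>{0, Q}. \<forall>i\<le>Q. f (c y e) \<le> f (c y i)}"
  proof
    fix x assume "x \<in> {x \<in> Y. offset lab T Q (T x) + 1 \<noteq> offset lab T Q x}"
    then have x: "x \<in> Y" "offset lab T Q (T x) + 1 \<noteq> offset lab T Q x" by auto
    have lc: "lab (zpow T (int i) x) = f (c x i)" for i by (simp add: lab_def c_def)
    have "inj_on (\<lambda>i. f (c x i)) {0..Q}"
    proof -
      have "c x ` {0..Q} \<subseteq> X" using x(1) by (auto simp: c_def X_def Y_def)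
      then show ?thesis
        using comp_inj_on[OF inj[OF x(1)] inj_on_subset[OF f(1)]] by (simp add: comp_def)
    qed
    then have "\<exists>e\<in>{0, Q}. \<forall>i\<le>Q. f (c x e) \<le> f (c x i)"
      using offset_step[OF bij_T, of lab x Q] x(2) unfolding lc by blast
    then show "x \<in> {y \<in> Y. \<exists>e\<in>{0, Q}. \<forall>i\<le>Q. f (c y e) \<le> f (c y i)}" using x(1) by blast
  qed
  moreover have "finite Y" "card Y \<le> card \<Omega>"
    using finite_\<Omega> by (auto simp: Y_def intro: card_mono)
  ultimately have "card {x \<in> Y. offset lab T Q (T x) + 1 \<noteq> offset lab T Q x}
      \<le> card {y \<in> Y. \<exists>e\<in>{0, Q}. \<forall>i\<le>Q. f (c y e) \<le> f (c y i)}"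
    by (intro card_mono) auto
  then have "Suc Q * card {x \<in> Y. offset lab T Q (T x) + 1 \<noteq> offset lab T Q x} \<le> 2 * card \<Omega>"
    using f(2) \<open>card Y \<le> card \<Omega>\<close> mult_le_mono2[of _ _ "Suc Q"] by (meson le_trans mult_le_mono2)
  moreover have "\<forall>x\<in>\<Omega>. \<forall>y\<in>\<Omega>. orb m w x = orb m w y \<longrightarrow> lab x = lab y"
    by (simp add: lab_def)
  ultimately show ?thesis unfolding Y_def by blast
qed

text \<open>At time \<open>i + j\<close> the letter \<open>- s\<close> applied at the start has
  become the letter \<open>- s + i + j\<close>, whose modulus is at most \<open>m\<close>. It stays
  inside the block orbit, on which labels are constant. This yields the invariance of the
  bases.\<close>

lemma offset_cj:
  assumes lab: "\<forall>x\<in>\<Omega>. \<forall>y\<in>\<Omega>. orb m w x = orb m w y \<longrightarrow> lab x = lab y"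
    and x: "x \<in> \<Omega>" and s: "0 \<le> s" "s \<le> int l" "i \<le> l" and m: "int Q + int l \<le> m" "m \<le> w"
  shows "offset lab T Q (zpow T (int i) (cj A T (- s) x)) = offset lab T Q (zpow T (int i) x)"
proof -
  have "lab (zpow T (int j) (zpow T (int i) (cj A T (- s) x))) = lab (zpow T (int j) (zpow T (int i) x))"
    if "j < Q" for j
  proof -
    have "zpow T (int j) (zpow T (int i) (cj A T (- s) x))
        = cj A T (- s + (int j + int i)) (zpow T (int j) (zpow T (int i) x))"
      by (simp add: zpow_add_apply[OF bij_T] zpow_cj[OF bij_T] algebra_simps)
    moreover have "orb m w (cj A T (- s + (int j + int i)) (zpow T (int j) (zpow T (int i) x)))
        = orb m w (zpow T (int j) (zpow T (int i) x))"
      using x that s m by (intro orb_cj) auto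
    ultimately show ?thesis using lab x by (metis zpow_in_iff cj_in_iff)
  qed
  then show ?thesis
    unfolding offset_def by (intro arg_cong[where f = Least] ext) (metis (no_types, lifting))
qed

end

context perm_pair
begin

lemma card_zpow_image: "card (zpow T i ` X) = card X"
  by (intro card_image inj_on_subset[OF bij_is_inj[OF bij_zpow[OF bij_T]] subset_UNIV])

text \<open>An uncovered point has a bad point or a break of the countdown within \<open>l\<close>
  steps of \<open>T\<close> in one direction or the other, whence the factor
  \<open>2 * l + 1\<close>. Breaks come from minima at window ends, from points periodic only at the
  larger scale, and from periodic points outside the stable part. In the conclusion \<open>u\<close>
  is the number of uncovered points and \<open>b\<close> the size of the base.\<close>

lemma exists_tower_approximation:
  fixes Q l l' K :: nat
  assumes p: "p = fact Q" and d: "d = p + int Q" and l: "0 < l" "l' \<le> l"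
    and par: "int Q + int l + p \<le> m" "m + p \<le> w" "w + p \<le> G" "p + p * fact K \<le> G"
    and K: "\<And>x. x \<in> \<Omega> \<Longrightarrow> good S G A T x \<Longrightarrow> card (orb m w x) \<le> K"
    and S1: "\<And>k. k \<in> S \<Longrightarrow> int l dvd k \<or> 0 \<le> k \<and> k \<le> int l - int l'"
    and S2: "\<And>k. k \<in> S \<Longrightarrow> p * fact K dvd k \<or> 0 \<le> k \<and> k \<le> G"
  shows "\<exists>A' T' u b. admissible S A' T' \<and> A' permutes \<Omega> \<and> T' permutes \<Omega> \<and> l * b \<le> card \<Omega> \<and>
    card {x \<in> \<Omega>. A x \<noteq> A' x} \<le> u + (l - l') * b \<and> card {x \<in> \<Omega>. T x \<noteq> T' x} \<le> u + b \<and>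
    Suc Q * u \<le> (2 * l + 1) * (Suc Q * (2 * card (bad S G) +
      2 * card (periodic p (m + d) (w + d) - periodic p m w)) + 2 * card \<Omega>)"
proof -
  have p0: "0 < p" by (simp add: p)
  define V where "V = stable_part S G p m w"
  have VT: "T ` V \<subseteq> V" and VA: "A ` V \<subseteq> V" and V\<Omega>: "V \<subseteq> \<Omega>"
    unfolding V_def using stable_part_T[of w G S p m] stable_part_A[of w G p m S] stable_part_sub par p0 by simp_all
  note V_iff = invariant_iff(1,2)[OF V\<Omega> VA VT]
  obtain lab where lab: "\<forall>x\<in>\<Omega>. \<forall>y\<in>\<Omega>. orb m w x = orb m w y \<longrightarrow> lab x = lab y"
    and ends: "Suc Q * card {x \<in> \<Omega> - periodic p (m + d) (w + d).
      offset lab T Q (T x) + 1 \<noteq> offset lab T Q x} \<le> 2 * card \<Omega>"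
    using exists_labels[OF p _ _ d, of m w] par p0 by auto
  define off where "off = offset lab T Q"
  \<comment> \<open>Starting towers where the countdown is \<open>l - 1\<close> modulo
    \<open>l\<close> lets its residue determine the level: at level \<open>s\<close> it is
    \<open>l - 1 - s\<close>. Hence the levels are disjoint.\<close>
  define B where "B = {b \<in> \<Omega>. b \<notin> V \<and> good S G A T b \<and>
    (\<forall>i<l. off (zpow T (int i) b) + i = off b) \<and> off b mod l = l - 1}"
  have off_level: "off (zpow T s b) + nat s = off b" if "b \<in> B" "0 \<le> s" "s < int l" for b s
    using that by (auto simp: B_def dest!: spec[of _ "nat s"])
  interpret tw: tower \<Omega> A T S "int l" "int l'" B V
  proof
    show "0 \<le> int l'" "int l' \<le> int l" "0 < int l" "B \<subseteq> \<Omega>" "V \<subseteq> \<Omega>" "A ` V \<subseteq> V" "T ` V \<subseteq> V" "V \<inter> B = {}"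
      using l V\<Omega> VA VT by (auto simp: B_def)
  next
    fix b b' s s' assume b: "b \<in> B" "b' \<in> B" and s: "0 \<le> s" "s < int l" "0 \<le> s'" "s' < int l"
      and eq: "zpow T s b = zpow T s' b'"
    have level: "int (off (zpow T s b)) mod int l = int l - 1 - s" if "b \<in> B" "0 \<le> s" "s < int l" for b s
    proof -
      have "int (off b) mod int l = int l - 1"
        using that(1) l by (simp add: B_def of_nat_mod[symmetric] of_nat_diff del: of_nat_mod)
      then have "(int (off b) - s) mod int l = (int l - 1 - s) mod int l"
        by (metis mod_diff_left_eq)
      moreover have "int (off (zpow T s b)) = int (off b) - s"
        using off_level[OF that] that by linarith
      ultimately show ?thesis using that by simp
    qed
    have "int l - 1 - s = int l - 1 - s'"
      using level[OF b(1) s(1,2)] level[OF b(2) s(3,4)] eq by simp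
    then show "s = s' \<and> b = b'" using eq by (simp add: bij_T)
  next
    fix b s assume b: "b \<in> B" and s: "0 \<le> s" "s < int l'"
    have b': "b \<in> \<Omega>" "b \<notin> V" "good S G A T b" "off b mod l = l - 1"
      "\<And>i. i < l \<Longrightarrow> off (zpow T (int i) b) + i = off b"
      using b by (auto simp: B_def)
    have off: "off (zpow T (int i) (cj A T (- s) b)) = off (zpow T (int i) b)" if "i < l" for i
      unfolding off_def using that s l par p0 b'(1) by (intro offset_cj[OF lab, where l = l]) auto
    then have "off (cj A T (- s) b) = off b" using off[of 0] l by simp
    moreover have "cj A T (- s) b \<notin> V"
      using b'(2) by (simp add: cj_def V_iff)
    moreover have "good S G A T (cj A T (- s) b)"
      using good_acts[OF b'(3), of "[- s]"] s l par p0 by simp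
    ultimately show "cj A T (- s) b \<in> B" using b' off by (simp add: B_def)
  next
    fix b "is" js assume "b \<in> B" "set is \<subseteq> {- int l..0}" "set js \<subseteq> {- int l..0}" "rel_eq S is js"
    then show "acts A T is b = acts A T js b"
      using par p0 by (intro goodD[where S = S and G = G]) (auto simp: B_def subset_iff dest!: bspec)
  next
    fix v "is" assume "v \<in> V" "law_eq is []"
    then show "acts A T is v = v"
      unfolding V_def using par p0 by (intro stable_part_relations(1)[OF _ _ _ _ _ K, where v = v and p = p]) auto
  next
    fix v k assume "v \<in> V" "k \<in> S"
    then show "acts A T [0, k] v = acts A T [k, 0] v"
      unfolding V_def using par p0 S2[of k] by (intro stable_part_relations(2)[OF _ _ _ _ _ K, where v = v and p = p]) auto
  next
    fix k assume "k \<in> S"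
    then show "int l dvd k \<or> 0 \<le> k \<and> k \<le> int l - int l'" by (rule S1)
  qed
  define P where "P = periodic p m w"
  define P' where "P' = periodic p (m + d) (w + d)"
  define Brk where "Brk = {x \<in> \<Omega> - V. off (T x) + 1 \<noteq> off x}"
  define E where "E = {x \<in> \<Omega> - P'. off (T x) + 1 \<noteq> off x}"
  define U where "U = \<Omega> - V - tw.towers"
  have fin: "finite P" "finite P'" "finite E" "finite Brk"
    using finite_periodic finite_\<Omega> by (auto simp: P_def P'_def E_def Brk_def)
  \<comment> \<open>The set \<open>P' - P\<close> ends up counted twice: directly, and in the bound
    for \<open>P - V\<close>.\<close>
  have "Brk \<subseteq> E \<union> (P' - P) \<union> (P - V)" by (auto simp: Brk_def E_def)
  then have "card Brk \<le> card (E \<union> (P' - P) \<union> (P - V))" using fin by (intro card_mono) auto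
  also have "\<dots> \<le> card (E \<union> (P' - P)) + card (P - V)" by (rule card_Un_le)
  also have "\<dots> \<le> card E + card (P' - P) + card (P - V)" by (simp add: card_Un_le)
  also have "card (P - V) \<le> card (bad S G) + card (periodic p (m + p) (w + p) - periodic p m w)"
    unfolding P_def V_def using par p0 by (intro card_periodic_unstable) auto
  also have "card (periodic p (m + p) (w + p) - periodic p m w) \<le> card (P' - P)"
    using fin periodic_mono[of "m + p" "m + d" "w + p" "w + d" p] d
    by (intro card_mono) (auto simp: P_def P'_def)
  finally have Brk: "card Brk \<le> card E + card (bad S G) + 2 * card (P' - P)" by simp
  have "U \<subseteq> (\<Union>r\<in>{- int l..int l}. zpow T r ` (bad S G \<union> Brk))"
  proof
    fix x assume "x \<in> U"
    then have x: "x \<in> \<Omega>" "x \<notin> V" "x \<notin> tw.towers" by (auto simp: U_def)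
    \<comment> \<open>The level that the countdown assigns to \<open>x\<close>; \<open>b\<close> is
      the point of the base expected below it.\<close>
    define s where "s = l - 1 - off x mod l"
    define b where "b = zpow T (- int s) x"
    have "off x mod l < l" using l by simp
    then have s: "s < l" "off x mod l + s = l - 1" by (auto simp: s_def)
    have xb: "x = zpow T (int s) b" by (simp add: b_def bij_T)
    have b: "b \<in> \<Omega>" "b \<notin> V" using x by (simp_all add: b_def V_iff)
    have "\<exists>i\<le>l. zpow T (int i) b \<in> bad S G \<union> Brk"
    proof (rule ccontr)
      assume none: "\<not> ?thesis"
      then have step: "off (T (zpow T (int i) b)) + 1 = off (zpow T (int i) b)" if "i \<le> l" for i
        using that b by (auto simp: Brk_def V_iff)
      have steps: "off (zpow T (int i) b) + i = off b" if "i \<le> l" for i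
        using that
      proof (induction i)
        case (Suc i)
        then have "off (zpow T (int (Suc i)) b) + 1 = off (zpow T (int i) b)"
          using step[of i] by (simp add: zpow_shift(2)[OF bij_T] add.commute)
        then show ?case using Suc by simp
      qed simp
      have "off b = off x + s" using steps[of s] s xb by simp
      then have "off b mod l = (off x mod l + s) mod l" by (simp add: mod_simps)
      then have "off b mod l = l - 1" using s l by simp
      moreover have "good S G A T b" using none[simplified, rule_format, of 0] b by (auto simp: bad_def)
      ultimately have "b \<in> B" using b steps by (auto simp: B_def)
      then show False
        using x(3) s unfolding xb tw.towers_def tw.level_def by (metis UN_I atLeastLessThan_iff image_eqI of_nat_0_le_iff of_nat_less_iff)
    qed
    then obtain i where i: "i \<le> l" "zpow T (int i) b \<in> bad S G \<union> Brk" by blast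
    have "x = zpow T (int s - int i) (zpow T (int i) b)"
      by (simp add: xb zpow_add_apply[OF bij_T])
    moreover have "int s - int i \<in> {- int l..int l}" using i s by auto
    ultimately show "x \<in> (\<Union>r\<in>{- int l..int l}. zpow T r ` (bad S G \<union> Brk))"
      using i(2) by blast
  qed
  then have "card U \<le> card (\<Union>r\<in>{- int l..int l}. zpow T r ` (bad S G \<union> Brk))"
    using fin finite_bad by (intro card_mono) auto
  also have "\<dots> \<le> (\<Sum>r\<in>{- int l..int l}. card (zpow T r ` (bad S G \<union> Brk)))"
    by (rule card_UN_le) simp
  also have "\<dots> = (2 * l + 1) * card (bad S G \<union> Brk)"
    by (simp add: card_zpow_image nat_add_distrib nat_mult_distrib)
  also have "\<dots> \<le> (2 * l + 1) * (2 * card (bad S G) + 2 * card (P' - P) + card E)"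
    using Brk card_Un_le[of "bad S G" Brk] by (intro mult_le_mono2) linarith
  finally have "Suc Q * card U \<le> Suc Q * ((2 * l + 1) * (2 * card (bad S G) + 2 * card (P' - P) + card E))"
    by (rule mult_le_mono2)
  also have "\<dots> = (2 * l + 1) * (Suc Q * (2 * card (bad S G) + 2 * card (P' - P)) + Suc Q * card E)"
    by (simp add: algebra_simps)
  also have "\<dots> \<le> (2 * l + 1) * (Suc Q * (2 * card (bad S G) + 2 * card (P' - P)) + 2 * card \<Omega>)"
    using ends unfolding E_def P'_def off_def by (intro mult_le_mono2 add_left_mono)
  finally have U: "Suc Q * card U \<le> \<dots>" .
  have "nat (int l - int l') = l - l'" by simp
  then show ?thesis
    using tw.admissible_tower tw.A'_permutes tw.T'_permutes tw.card_towers
      tw.card_A'_differs[folded U_def] tw.card_T'_differs[folded U_def] U[unfolded P_def P'_def]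
    by (intro exI[of _ tw.A'] exI[of _ tw.T'] exI[of _ "card U"] exI[of _ "card B"])
      (simp only: nat_int simp_thms)
qed

text \<open>The periodic sets grow with the parameters, so the \<open>s\<close> increments along
  this chain are disjoint subsets of \<open>\<Omega>\<close>, and one of them is at most the
  average.\<close>

lemma exists_scale:
  assumes "0 < s" "0 \<le> d"
  shows "\<exists>i<s. s * card (periodic p (m + int i * d + d) (w + int i * d + d) -
    periodic p (m + int i * d) (w + int i * d)) \<le> card \<Omega>"
proof (rule ccontr)
  define P where "P i = periodic p (m + int i * d) (w + int i * d)" for i
  have Suc: "P (Suc i) = periodic p (m + int i * d + d) (w + int i * d + d)" for i
    by (simp add: P_def algebra_simps)
  assume "\<not> ?thesis"
  then have big: "card \<Omega> < s * card (P (Suc i) - P i)" if "i < s" for i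
    using that unfolding Suc by (simp add: P_def not_le)
  have mono: "P i \<subseteq> P j" if "i \<le> j" for i j
    unfolding P_def using that assms(2) by (intro periodic_mono) (auto intro: mult_right_mono)
  have "(\<Sum>i<s. card (P (Suc i) - P i)) = card (\<Union>i\<in>{..<s}. P (Suc i) - P i)"
  proof (rule card_UN_disjoint[symmetric])
    show "\<forall>i\<in>{..<s}. \<forall>j\<in>{..<s}. i \<noteq> j \<longrightarrow> (P (Suc i) - P i) \<inter> (P (Suc j) - P j) = {}"
    proof (intro ballI impI)
      fix i j :: nat assume "i \<noteq> j"
      then have "Suc i \<le> j \<or> Suc j \<le> i" by auto
      then show "(P (Suc i) - P i) \<inter> (P (Suc j) - P j) = {}" using mono by blast
    qed
  qed (auto simp: P_def finite_periodic)
  also have "\<dots> \<le> card \<Omega>"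
    using finite_\<Omega> by (intro card_mono) (auto simp: P_def periodic_def)
  finally have "(\<Sum>i<s. s * card (P (Suc i) - P i)) \<le> s * card \<Omega>"
    by (simp add: sum_distrib_left[symmetric])
  moreover have "(\<Sum>i<s. card \<Omega>) < (\<Sum>i<s. s * card (P (Suc i) - P i))"
    using big assms(1) by (intro sum_strict_mono) auto
  ultimately show False by simp
qed

text \<open>At a good point a word acts as its representative, so the bound depends on the alphabet
  only, not on the set or the permutations.\<close>

lemma card_orb_le:
  assumes R: "finite R" "R \<subseteq> {is. set is \<subseteq> {- W..W}}" "\<forall>is. set is \<subseteq> {- W..W} \<longrightarrow> (\<exists>r\<in>R. law_eq is r)"
    and x: "good S G A T x" and le: "w \<le> W" "W \<le> G"
  shows "card (orb m w x) \<le> card R"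
proof -
  have "orb m w x \<subseteq> (\<lambda>r. acts A T r x) ` R"
  proof
    fix y assume "y \<in> orb m w x"
    then obtain "is" where i: "is \<in> blocks m w" "y = acts A T is x" by (auto simp: orb_def)
    have W: "set is \<subseteq> {- W..W}" using blocks_range[OF i(1) le(1)] .
    then obtain r where r: "r \<in> R" "law_eq is r" using R(3) by blast
    then have "set r \<subseteq> {- W..W}" using R(2) by blast
    with W have "set is \<subseteq> {- G..G}" "set r \<subseteq> {- G..G}" using le(2) by (auto dest!: subsetD)
    then have "acts A T is x = acts A T r x"
      using goodD[OF x _ _ rel_eq_law[OF r(2)]] by blast
    then show "y \<in> (\<lambda>r. acts A T r x) ` R" using r(1) i(2) by blast
  qed
  then show ?thesis using R(1) by (meson card_image_le card_mono finite_imageI le_trans)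
qed

end

text \<open>The order of choice is \<open>l\<close>, \<open>s\<close>, \<open>W\<close>,
  \<open>K\<close>, \<open>G\<close>. The scale is selected last and depends on
  \<open>\<Omega>\<close>, \<open>A\<close> and \<open>T\<close>, so the bound \<open>K\<close> on
  block orbits has to hold at all scales up to \<open>W\<close>. Then \<open>G\<close> has to exceed
  the period \<open>p * fact K\<close> and all distances that are not multiples of it. Thus
  \<open>G\<close> and \<open>\<eta>\<close> are uniform.\<close>

theorem exists_admissible_approximation:
  fixes \<epsilon> :: real
  assumes S1: "\<And>\<epsilon>::real. 0 < \<epsilon> \<Longrightarrow> \<exists>l l'. 0 < l \<and> l' \<le> l \<and> real (l - l') \<le> \<epsilon> * real l \<and> 1 \<le> \<epsilon> * real l \<and>
      (\<forall>k\<in>S. int l dvd k \<or> 0 \<le> k \<and> k \<le> int l - int l')"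
    and S2: "\<And>q. 0 < q \<Longrightarrow> \<exists>G. \<forall>k\<in>S. q dvd k \<or> 0 \<le> k \<and> k \<le> G"
    and \<epsilon>: "0 < \<epsilon>"
  shows "\<exists>G \<eta>. 0 < \<eta> \<and> (\<forall>(\<Omega> :: 'a set) A T. perm_pair \<Omega> A T \<longrightarrow>
     real (card {x \<in> \<Omega>. \<not> good S G A T x}) \<le> \<eta> * real (card \<Omega>) \<longrightarrow>
     (\<exists>A' T'. admissible S A' T' \<and> A' permutes \<Omega> \<and> T' permutes \<Omega> \<and>
       real (card {x \<in> \<Omega>. A x \<noteq> A' x}) \<le> \<epsilon> * real (card \<Omega>) \<and>
       real (card {x \<in> \<Omega>. T x \<noteq> T' x}) \<le> \<epsilon> * real (card \<Omega>)))"
proof -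
  obtain l l' where l: "0 < l" "l' \<le> l" "real (l - l') \<le> \<epsilon> / 4 * real l" "1 \<le> \<epsilon> / 4 * real l"
    and lS: "\<And>k. k \<in> S \<Longrightarrow> int l dvd k \<or> 0 \<le> k \<and> k \<le> int l - int l'"
    using S1[of "\<epsilon> / 4"] \<epsilon> by auto
  define c where "c = 2 * real l + 1"
  have c: "0 < c" by (simp add: c_def)
  obtain s :: nat where s: "0 < s" "c * 2 \<le> \<epsilon> / 6 * real s"
  proof -
    obtain s :: nat where "c * 2 / (\<epsilon> / 6) < real s" using reals_Archimedean2 by blast
    then have "c * 2 < \<epsilon> / 6 * real s" using \<epsilon> by (simp add: field_simps)
    moreover from this have "0 < s" using c \<epsilon> by (cases s) auto
    ultimately show ?thesis using that by force
  qed
  \<comment> \<open>Bad points, growth of the periodic set and window ends are allowed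
    \<open>\<epsilon> / 6\<close> each, so the uncovered part is at most
    \<open>\<epsilon> / 2\<close>; the tops of the towers cost at most another
    \<open>\<epsilon> / 4\<close>.\<close>
  define \<eta> where "\<eta> = \<epsilon> / 6 / (c * 2)"
  \<comment> \<open>One number serves both as window length and as number of scales to choose
    from.\<close>
  define Q where "Q = s"
  define p :: int where "p = fact Q"
  define d where "d = p + int Q"
  define m0 where "m0 = int Q + int l + p"
  define W where "W = m0 + int s * d + p"
  have p0: "0 < p" and d0: "0 \<le> d" by (simp_all add: p_def d_def)
  obtain R where R: "finite R" "R \<subseteq> {is. set is \<subseteq> {- W..W}}"
    "\<forall>is. set is \<subseteq> {- W..W} \<longrightarrow> (\<exists>r\<in>R. law_eq is r)"
    using finite_law_representatives[of "{- W..W}"] by auto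
  define K where "K = card R"
  obtain G0 where G0: "\<And>k. k \<in> S \<Longrightarrow> p * fact K dvd k \<or> 0 \<le> k \<and> k \<le> G0"
    using S2[of "p * fact K"] p0 by auto
  define G where "G = max G0 (max (W + p) (p + p * fact K))"
  have G: "G0 \<le> G" "W + p \<le> G" "p + p * fact K \<le> G" by (auto simp: G_def)
  have "\<exists>A' T'. admissible S A' T' \<and> A' permutes \<Omega> \<and> T' permutes \<Omega> \<and>
       real (card {x \<in> \<Omega>. A x \<noteq> A' x}) \<le> \<epsilon> * real (card \<Omega>) \<and>
       real (card {x \<in> \<Omega>. T x \<noteq> T' x}) \<le> \<epsilon> * real (card \<Omega>)"
    if pp: "perm_pair \<Omega> A T" and few: "real (card {x \<in> \<Omega>. \<not> good S G A T x}) \<le> \<eta> * real (card \<Omega>)"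
    for \<Omega> :: "'a set" and A T
  proof -
    interpret perm_pair \<Omega> A T by (rule pp)
    obtain i where i: "i < s" "s * card (periodic p (m0 + int i * d + d) (m0 + p + int i * d + d) -
        periodic p (m0 + int i * d) (m0 + p + int i * d)) \<le> card \<Omega>"
      using exists_scale[OF s(1) d0, of p m0 "m0 + p"] by auto
    define m where "m = m0 + int i * d"
    define w where "w = m0 + p + int i * d"
    define \<Delta> where "\<Delta> = card (periodic p (m + d) (w + d) - periodic p m w)"
    have id: "0 \<le> int i * d" "int i * d \<le> int s * d"
      using i(1) d0 by (auto intro: mult_right_mono)
    have wW: "w \<le> W" using id by (simp add: w_def W_def)
    obtain A' T' u b where *: "admissible S A' T'" "A' permutes \<Omega>" "T' permutes \<Omega>" "l * b \<le> card \<Omega>"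
      "card {x \<in> \<Omega>. A x \<noteq> A' x} \<le> u + (l - l') * b" "card {x \<in> \<Omega>. T x \<noteq> T' x} \<le> u + b"
      "Suc Q * u \<le> (2 * l + 1) * (Suc Q * (2 * card (bad S G) + 2 * \<Delta>) + 2 * card \<Omega>)"
    proof -
      have par: "int Q + int l + p \<le> m" "m + p \<le> w" "w + p \<le> G" "p + p * fact K \<le> G"
        using id G wW by (auto simp: m_def w_def m0_def)
      have "\<exists>A' T' u b. admissible S A' T' \<and> A' permutes \<Omega> \<and> T' permutes \<Omega> \<and> l * b \<le> card \<Omega> \<and>
        card {x \<in> \<Omega>. A x \<noteq> A' x} \<le> u + (l - l') * b \<and> card {x \<in> \<Omega>. T x \<noteq> T' x} \<le> u + b \<and>
        Suc Q * u \<le> (2 * l + 1) * (Suc Q * (2 * card (bad S G) + 2 * \<Delta>) + 2 * card \<Omega>)"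
        unfolding \<Delta>_def
      proof (rule exists_tower_approximation[OF p_def d_def l(1,2) par])
        show "card (orb m w x) \<le> K" if "x \<in> \<Omega>" "good S G A T x" for x
          unfolding K_def using wW G p0 by (intro card_orb_le[OF R that(2)]) auto
        show "int l dvd k \<or> 0 \<le> k \<and> k \<le> int l - int l'" if "k \<in> S" for k
          using lS[OF that] .
        show "p * fact K dvd k \<or> 0 \<le> k \<and> k \<le> G" if "k \<in> S" for k
          using G0[OF that] G by auto
      qed
      then show ?thesis using that by blast
    qed
    define n where "n = real (card \<Omega>)"
    have n0: "0 \<le> n" by (simp add: n_def)
    have bad: "c * (2 * real (card (bad S G))) \<le> \<epsilon> / 6 * n"
      using few c \<epsilon> by (simp add: bad_def n_def \<eta>_def field_simps)
    have "real s * real \<Delta> \<le> n"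
      using i(2) unfolding \<Delta>_def m_def w_def n_def of_nat_mult[symmetric] of_nat_le_iff .
    then have "c * 2 * real \<Delta> \<le> \<epsilon> / 6 * n"
    proof -
      have "c * 2 * real \<Delta> \<le> \<epsilon> / 6 * real s * real \<Delta>" using s(2) by (intro mult_right_mono) auto
      also have "\<dots> = \<epsilon> / 6 * (real s * real \<Delta>)" by simp
      also have "\<dots> \<le> \<epsilon> / 6 * n" using \<open>real s * real \<Delta> \<le> n\<close> \<epsilon> by (intro mult_left_mono) auto
      finally show ?thesis .
    qed
    moreover have "real (Suc Q) * real u \<le> c * (real (Suc Q) * (2 * real (card (bad S G)) + 2 * real \<Delta>) + 2 * n)"
    proof -
      have "real (Suc Q * u) \<le> real ((2 * l + 1) * (Suc Q * (2 * card (bad S G) + 2 * \<Delta>) + 2 * card \<Omega>))"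
        using *(7) by (rule of_nat_mono)
      then show ?thesis by (simp only: of_nat_mult of_nat_add of_nat_numeral of_nat_1 c_def n_def)
    qed
    moreover have "c * (2 * n) \<le> real (Suc Q) * (\<epsilon> / 6 * n)"
    proof -
      have "c * 2 * n \<le> \<epsilon> / 6 * real s * n" using s(2) n0 by (rule mult_right_mono)
      also have "\<dots> \<le> real (Suc Q) * (\<epsilon> / 6 * n)"
        using n0 \<epsilon> by (simp add: Q_def algebra_simps)
      finally show ?thesis by simp
    qed
    ultimately have "real (Suc Q) * real u \<le> real (Suc Q) * (\<epsilon> / 2 * n)"
    proof -
      assume a: "c * 2 * real \<Delta> \<le> \<epsilon> / 6 * n"
        "real (Suc Q) * real u \<le> c * (real (Suc Q) * (2 * real (card (bad S G)) + 2 * real \<Delta>) + 2 * n)"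
        "c * (2 * n) \<le> real (Suc Q) * (\<epsilon> / 6 * n)"
      have "real (Suc Q) * real u \<le> real (Suc Q) * (c * (2 * real (card (bad S G))) + c * 2 * real \<Delta>) + c * (2 * n)"
        using a(2) by (simp add: algebra_simps)
      also have "\<dots> \<le> real (Suc Q) * (\<epsilon> / 6 * n + \<epsilon> / 6 * n) + real (Suc Q) * (\<epsilon> / 6 * n)"
        using a bad by (intro add_mono mult_left_mono) auto
      also have "\<dots> = real (Suc Q) * (\<epsilon> / 2 * n)" by (simp add: algebra_simps)
      finally show ?thesis .
    qed
    then have u: "real u \<le> \<epsilon> / 2 * n" by (simp add: mult_le_cancel_left_pos)
    have lb: "real l * real b \<le> n"
      using *(4) unfolding n_def of_nat_mult[symmetric] of_nat_le_iff .
    have "real (l - l') * real b \<le> \<epsilon> / 4 * (real l * real b)"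
      using mult_right_mono[OF l(3), of "real b"] by simp
    also have "\<dots> \<le> \<epsilon> / 4 * n" using lb \<epsilon> by (intro mult_left_mono) auto
    finally have b1: "real (l - l') * real b \<le> \<epsilon> / 4 * n" .
    have "real b \<le> \<epsilon> / 4 * (real l * real b)"
      using mult_right_mono[OF l(4), of "real b"] by simp
    also have "\<dots> \<le> \<epsilon> / 4 * n" using lb \<epsilon> by (intro mult_left_mono) auto
    finally have b2: "real b \<le> \<epsilon> / 4 * n" .
    have \<epsilon>n: "0 \<le> \<epsilon> * n" using \<epsilon> n0 by simp
    have "real (card {x \<in> \<Omega>. A x \<noteq> A' x}) \<le> real u + real (l - l') * real b"
      using *(5) unfolding of_nat_mult[symmetric] of_nat_add[symmetric] of_nat_le_iff .
    then have "real (card {x \<in> \<Omega>. A x \<noteq> A' x}) \<le> \<epsilon> * n" using u b1 \<epsilon>n by linarith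
    moreover have "real (card {x \<in> \<Omega>. T x \<noteq> T' x}) \<le> real u + real b"
      using *(6) unfolding of_nat_add[symmetric] of_nat_le_iff .
    then have "real (card {x \<in> \<Omega>. T x \<noteq> T' x}) \<le> \<epsilon> * n" using u b2 \<epsilon>n by linarith
    ultimately show ?thesis using *(1-3) unfolding n_def by blast
  qed
  moreover have "0 < \<eta>" using \<epsilon> c by (simp add: \<eta>_def)
  ultimately show ?thesis by blast
qed

section \<open>The group and its stability\<close>

text \<open>Generators other than the two in use act as the identity, so that every word
  acts.\<close>

fun letter :: "('a \<Rightarrow> 'a) \<Rightarrow> ('a \<Rightarrow> 'a) \<Rightarrow> nat \<times> bool \<Rightarrow> 'a \<Rightarrow> 'a" where
  "letter A T (x, b) = (let f = (if x = 0 then A else if x = 1 then T else id)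
     in if b then f else inv_into UNIV f)"

declare letter.simps [simp del]

definition actw :: "('a \<Rightarrow> 'a) \<Rightarrow> ('a \<Rightarrow> 'a) \<Rightarrow> fword \<Rightarrow> 'a \<Rightarrow> 'a" where
  "actw A T w = foldr (\<lambda>c. (\<circ>) (letter A T c)) w id"

lemma actw_Nil [simp]: "actw A T [] = id"
  by (simp add: actw_def)

lemma actw_Cons: "actw A T (c # w) x = letter A T c (actw A T w x)"
  by (simp add: actw_def)

lemma actw_append: "actw A T (u @ v) x = actw A T u (actw A T v x)"
  by (induction u) (auto simp: actw_Cons)

lemma letter_cancel:
  assumes "bij A" "bij T" "fst c = fst c'" "snd c \<noteq> snd c'"
  shows "letter A T c (letter A T c' x) = x"
  using assms by (cases c; cases c') (auto simp: letter.simps Let_def bij_is_inj bij_is_surj inv_f_f surj_f_inv_f)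

lemma bij_letter: "bij A \<Longrightarrow> bij T \<Longrightarrow> bij (letter A T c)"
  by (cases c) (auto simp: letter.simps Let_def intro: bij_imp_bij_inv)

lemma bij_actw: "bij A \<Longrightarrow> bij T \<Longrightarrow> bij (actw A T w)"
  by (induction w) (auto simp: actw_def intro!: bij_comp bij_letter)

lemma actw_cancel_cons:
  assumes "bij A" "bij T"
  shows "actw A T (cancel_cons c w) x = letter A T c (actw A T w x)"
  using letter_cancel[OF assms] by (cases w) (auto simp: actw_Cons)

lemma actw_free_reduce:
  assumes "bij A" "bij T"
  shows "actw A T (free_reduce w) x = actw A T w x"
  by (induction w) (auto simp: free_reduce_def actw_cancel_cons[OF assms] actw_Cons)

definition inverse_word :: "fword \<Rightarrow> fword" where
  "inverse_word w = rev (map (\<lambda>c. (fst c, \<not> snd c)) w)"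

lemma actw_inverse_word:
  assumes "bij A" "bij T"
  shows "actw A T (inverse_word w) (actw A T w x) = x"
  by (induction w) (auto simp: inverse_word_def actw_append actw_Cons letter_cancel[OF assms])

lemma letters_inverse_word [simp]: "fst ` set (inverse_word w) = fst ` set w"
  by (auto simp: inverse_word_def image_image)

lemma reduced_word_Nil [simp]: "reduced_word []"
  by (simp add: reduced_word_def)

lemma reduced_word_Cons:
  "reduced_word (c # w) \<longleftrightarrow> reduced_word w \<and> (w = [] \<or> \<not> (fst c = fst (hd w) \<and> snd c \<noteq> snd (hd w)))"
proof
  assume r: "reduced_word (c # w)"
  have "reduced_word w"
    unfolding reduced_word_def
  proof (intro allI impI)
    fix i assume "Suc i < length w"
    then show "\<not> (fst (w ! i) = fst (w ! Suc i) \<and> snd (w ! i) \<noteq> snd (w ! Suc i))"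
      using r[unfolded reduced_word_def, rule_format, of "Suc i"] by simp
  qed
  moreover have "w = [] \<or> \<not> (fst c = fst (hd w) \<and> snd c \<noteq> snd (hd w))"
    using r[unfolded reduced_word_def, rule_format, of 0] by (cases w) auto
  ultimately show "reduced_word w \<and> (w = [] \<or> \<not> (fst c = fst (hd w) \<and> snd c \<noteq> snd (hd w)))" ..
next
  assume r: "reduced_word w \<and> (w = [] \<or> \<not> (fst c = fst (hd w) \<and> snd c \<noteq> snd (hd w)))"
  show "reduced_word (c # w)"
    unfolding reduced_word_def
  proof (intro allI impI)
    fix i assume i: "Suc i < length (c # w)"
    show "\<not> (fst ((c # w) ! i) = fst ((c # w) ! Suc i) \<and> snd ((c # w) ! i) \<noteq> snd ((c # w) ! Suc i))"
    proof (cases i)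
      case 0
      then show ?thesis using r i by (cases w) auto
    next
      case (Suc k)
      then show ?thesis using r i by (auto simp: reduced_word_def)
    qed
  qed
qed

lemma reduced_word_cancel_cons: "reduced_word w \<Longrightarrow> reduced_word (cancel_cons c w)"
  by (cases w) (auto simp: reduced_word_Cons)

lemma reduced_word_free_reduce: "reduced_word (free_reduce w)"
  by (induction w) (auto simp: free_reduce_def reduced_word_cancel_cons)

lemma free_reduce_reduced: "reduced_word w \<Longrightarrow> free_reduce w = w"
proof (induction w)
  case (Cons c w)
  then have "free_reduce (c # w) = cancel_cons c w"
    by (simp add: free_reduce_def reduced_word_Cons)
  also have "\<dots> = c # w"
    using Cons.prems by (cases w) (auto simp: reduced_word_Cons)
  finally show ?case .
qed (simp add: free_reduce_def)

lemma letters_free_reduce: "fst ` set (free_reduce w) \<subseteq> fst ` set w"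
proof (induction w)
  case (Cons c w)
  have "set (cancel_cons c v) \<subseteq> insert c (set v)" for v by (cases v) auto
  then have "set (free_reduce (c # w)) \<subseteq> insert c (set (free_reduce w))"
    by (simp add: free_reduce_def)
  then show ?case using Cons by auto
qed (simp add: free_reduce_def)

lemma free_group_carrier: "w \<in> carrier (free_group n) \<longleftrightarrow> fst ` set w \<subseteq> {0..<n} \<and> reduced_word w"
  by (simp add: free_group_def)

lemma free_reduce_carrier: "fst ` set w \<subseteq> {0..<n} \<Longrightarrow> free_reduce w \<in> carrier (free_group n)"
  by (simp add: free_group_carrier reduced_word_free_reduce order.trans[OF letters_free_reduce])

section \<open>The group as a quotient of the free group of rank two\<close>

definition tword :: "int \<Rightarrow> fword" where
  "tword i = replicate (nat \<bar>i\<bar>) (1, 0 \<le> i)"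

fun lword :: "int list \<Rightarrow> fword" where
  "lword [] = []"
| "lword (i # is) = tword i @ [(0, True)] @ tword (- i) @ lword is"

lemma actw_tword: "actw A T (tword i) = zpow T i"
proof -
  have "actw A T (replicate n (1, True)) = T ^^ n" "actw A T (replicate n (1, False)) = inv_into UNIV T ^^ n" for n
    by (induction n) (auto simp: actw_def letter.simps)
  then show ?thesis by (auto simp: tword_def zpow_def)
qed

lemma actw_lword: "actw A T (lword is) x = acts A T is x"
  by (induction "is") (auto simp: actw_append actw_Cons actw_tword acts_Cons cj_def letter.simps)

lemma letters_lword: "fst ` set (lword is) \<subseteq> {0..<2}"
  by (induction "is") (auto simp: tword_def)

text \<open>The group is given by the common kernel of all admissible pairs instead of a
  presentation: every admissible pair on the naturals then acts through it by construction.\<close>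

definition word_eq :: "int set \<Rightarrow> fword \<Rightarrow> fword \<Rightarrow> bool" where
  "word_eq S u v \<longleftrightarrow> (\<forall>A T :: nat \<Rightarrow> nat. admissible S A T \<longrightarrow> actw A T u = actw A T v)"

lemma word_eq_refl [simp]: "word_eq S u u"
  by (simp add: word_eq_def)

lemma word_eq_sym: "word_eq S u v \<Longrightarrow> word_eq S v u"
  by (simp add: word_eq_def)

lemma word_eq_trans: "word_eq S u v \<Longrightarrow> word_eq S v w \<Longrightarrow> word_eq S u w"
  by (simp add: word_eq_def)

lemma word_eq_append: "word_eq S u u' \<Longrightarrow> word_eq S v v' \<Longrightarrow> word_eq S (u @ v) (u' @ v')"
  by (simp add: word_eq_def fun_eq_iff actw_append)

lemma word_eq_free_reduce: "word_eq S (free_reduce w) w"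
  by (simp add: word_eq_def fun_eq_iff actw_free_reduce admissible_def)

lemma word_eq_inverse_word: "word_eq S (inverse_word w @ w) []"
  by (simp add: word_eq_def fun_eq_iff actw_append actw_inverse_word admissible_def)

text \<open>The least code of an equivalent word stands for the class, so that the carrier consists
  of natural numbers.\<close>

definition word_class :: "int set \<Rightarrow> fword \<Rightarrow> nat" where
  "word_class S w = (LEAST m. word_eq S (from_nat m) w)"

lemma word_eq_from_nat_class: "word_eq S (from_nat (word_class S w)) w"
  unfolding word_class_def by (rule LeastI[of _ "to_nat w"]) simp

lemma word_class_eq_iff: "word_class S u = word_class S v \<longleftrightarrow> word_eq S u v"
proof
  assume "word_class S u = word_class S v"
  then show "word_eq S u v"
    using word_eq_from_nat_class[of S u] word_eq_from_nat_class[of S v] word_eq_sym word_eq_trans by metis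
next
  assume "word_eq S u v"
  then have "word_eq S w u \<longleftrightarrow> word_eq S w v" for w
    using word_eq_sym word_eq_trans by blast
  then show "word_class S u = word_class S v" by (simp add: word_class_def)
qed

definition shift_group :: "int set \<Rightarrow> nat monoid" where
  "shift_group S = \<lparr>carrier = word_class S ` {w. fst ` set w \<subseteq> {0..<2}},
     monoid.mult = (\<lambda>i j. word_class S (from_nat i @ from_nat j)), one = word_class S []\<rparr>"

lemma shift_group_mult:
  "word_class S u \<otimes>\<^bsub>shift_group S\<^esub> word_class S v = word_class S (u @ v)"
  by (simp add: shift_group_def word_class_eq_iff word_eq_append word_eq_from_nat_class)

lemma shift_group_one: "\<one>\<^bsub>shift_group S\<^esub> = word_class S []"
  by (simp add: shift_group_def)

lemma shift_group_carrierE: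
  assumes "g \<in> carrier (shift_group S)"
  obtains w where "fst ` set w \<subseteq> {0..<2}" "g = word_class S w"
  using assms by (auto simp: shift_group_def)

lemma shift_group_carrierI: "fst ` set w \<subseteq> {0..<2} \<Longrightarrow> word_class S w \<in> carrier (shift_group S)"
  by (auto simp: shift_group_def)

lemma group_shift_group: "group (shift_group S)"
proof (rule groupI)
  fix x y assume "x \<in> carrier (shift_group S)" "y \<in> carrier (shift_group S)"
  then obtain u v where "fst ` set u \<subseteq> {0..<2}" "x = word_class S u" "fst ` set v \<subseteq> {0..<2}" "y = word_class S v"
    by (metis shift_group_carrierE)
  then show "x \<otimes>\<^bsub>shift_group S\<^esub> y \<in> carrier (shift_group S)"
    by (simp add: shift_group_mult) (rule shift_group_carrierI, auto)
next
  show "\<one>\<^bsub>shift_group S\<^esub> \<in> carrier (shift_group S)"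
    unfolding shift_group_one by (rule shift_group_carrierI) simp
next
  fix x y z
  assume "x \<in> carrier (shift_group S)" "y \<in> carrier (shift_group S)" "z \<in> carrier (shift_group S)"
  then obtain u v w where "x = word_class S u" "y = word_class S v" "z = word_class S w"
    by (metis shift_group_carrierE)
  then show "x \<otimes>\<^bsub>shift_group S\<^esub> y \<otimes>\<^bsub>shift_group S\<^esub> z = x \<otimes>\<^bsub>shift_group S\<^esub> (y \<otimes>\<^bsub>shift_group S\<^esub> z)"
    by (simp add: shift_group_mult)
next
  fix x assume "x \<in> carrier (shift_group S)"
  then obtain u where u: "fst ` set u \<subseteq> {0..<2}" "x = word_class S u" by (rule shift_group_carrierE)
  then show "\<one>\<^bsub>shift_group S\<^esub> \<otimes>\<^bsub>shift_group S\<^esub> x = x"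
    by (simp add: shift_group_mult shift_group_one)
  have "word_class S (inverse_word u) \<otimes>\<^bsub>shift_group S\<^esub> x = \<one>\<^bsub>shift_group S\<^esub>"
    by (simp add: u shift_group_mult shift_group_one word_class_eq_iff word_eq_inverse_word)
  moreover have "word_class S (inverse_word u) \<in> carrier (shift_group S)"
    using u by (intro shift_group_carrierI) simp
  ultimately show "\<exists>y\<in>carrier (shift_group S). y \<otimes>\<^bsub>shift_group S\<^esub> x = \<one>\<^bsub>shift_group S\<^esub>" by blast
qed

lemma word_class_hom: "word_class S \<in> hom (free_group 2) (shift_group S)"
proof (rule homI)
  fix u assume "u \<in> carrier (free_group 2)"
  then show "word_class S u \<in> carrier (shift_group S)"
    by (intro shift_group_carrierI) (simp add: free_group_carrier)
next
  fix u v assume "u \<in> carrier (free_group 2)" "v \<in> carrier (free_group 2)"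
  show "word_class S (u \<otimes>\<^bsub>free_group 2\<^esub> v) = word_class S u \<otimes>\<^bsub>shift_group S\<^esub> word_class S v"
    by (simp add: shift_group_mult word_class_eq_iff) (simp add: free_group_def word_eq_free_reduce)
qed

lemma word_class_surj: "word_class S ` carrier (free_group 2) = carrier (shift_group S)"
proof
  show "word_class S ` carrier (free_group 2) \<subseteq> carrier (shift_group S)"
    using word_class_hom by (auto simp: hom_def)
  show "carrier (shift_group S) \<subseteq> word_class S ` carrier (free_group 2)"
  proof
    fix g assume "g \<in> carrier (shift_group S)"
    then obtain w where w: "fst ` set w \<subseteq> {0..<2}" "g = word_class S w" by (rule shift_group_carrierE)
    then have "g = word_class S (free_reduce w)"
      by (simp add: word_class_eq_iff word_eq_free_reduce word_eq_sym)
    then show "g \<in> word_class S ` carrier (free_group 2)" using free_reduce_carrier[OF w(1)] by blast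
  qed
qed

text \<open>Members of \<open>BijGroup\<close> are \<open>undefined\<close> outside
  \<open>\<Omega>\<close>, whereas \<open>permutes\<close> wants fixed points there; only the latter
  gives bijections of the whole type, as inverses over \<open>UNIV\<close> need.\<close>

definition extension :: "'a set \<Rightarrow> ('a \<Rightarrow> 'a) \<Rightarrow> 'a \<Rightarrow> 'a" where
  "extension \<Omega> f x = (if x \<in> \<Omega> then f x else x)"

lemma extension_permutes: "f \<in> Bij \<Omega> \<Longrightarrow> extension \<Omega> f permutes \<Omega>"
  by (rule bij_imp_permutes) (auto simp: Bij_def extension_def cong: bij_betw_cong)

lemma restrict_permutes_Bij: "f permutes \<Omega> \<Longrightarrow> restrict f \<Omega> \<in> Bij \<Omega>"
  by (auto simp: Bij_def permutes_imp_bij)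

lemma BijGroup_mult_apply:
  "f \<in> Bij \<Omega> \<Longrightarrow> g \<in> Bij \<Omega> \<Longrightarrow> x \<in> \<Omega> \<Longrightarrow> (f \<otimes>\<^bsub>BijGroup \<Omega>\<^esub> g) x = f (g x)"
  by (simp add: BijGroup_def compose_def)

lemma letter_permutes:
  "A permutes \<Omega> \<Longrightarrow> T permutes \<Omega> \<Longrightarrow> letter A T c permutes \<Omega>"
  by (cases c) (auto simp: letter.simps Let_def permutes_inv permutes_id)

lemma actw_permutes:
  "A permutes \<Omega> \<Longrightarrow> T permutes \<Omega> \<Longrightarrow> actw A T w permutes \<Omega>"
  by (induction w) (auto simp: actw_def permutes_id intro!: permutes_compose letter_permutes)

text \<open>A homomorphism from the free group is determined by two permutations. The values at
  inverse letters are recovered from triviality on the empty word and free cancellation.\<close>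

lemma free_group_hom_apply:
  assumes \<rho>: "\<rho> \<in> hom (free_group 2) (BijGroup \<Omega>)"
  defines "A \<equiv> extension \<Omega> (\<rho> (free_gen 0))" and "T \<equiv> extension \<Omega> (\<rho> (free_gen 1))"
  assumes w: "w \<in> carrier (free_group 2)" and x: "x \<in> \<Omega>"
  shows "\<rho> w x = actw A T w x"
proof -
  interpret B: group "BijGroup \<Omega>" by (rule group_BijGroup)
  have \<rho>_in: "\<rho> u \<in> Bij \<Omega>" if "u \<in> carrier (free_group 2)" for u
    using \<rho> that by (auto simp: hom_def BijGroup_def)
  have \<rho>_mult: "\<rho> (free_reduce (u @ v)) y = \<rho> u (\<rho> v y)"
    if "u \<in> carrier (free_group 2)" "v \<in> carrier (free_group 2)" "y \<in> \<Omega>" for u v y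
    using hom_mult[OF \<rho> that(1,2)] BijGroup_mult_apply[OF \<rho>_in \<rho>_in] that by (simp add: free_group_def)
  have Nil: "[] \<in> carrier (free_group 2)" by (simp add: free_group_carrier)
  have single: "[c] \<in> carrier (free_group 2)" if "fst c < 2" for c
    using that by (simp add: free_group_carrier reduced_word_Cons)
  have AT: "A permutes \<Omega>" "T permutes \<Omega>"
    using single[of "(0, True)"] single[of "(1, True)"]
    by (auto simp: A_def T_def free_gen_def intro!: extension_permutes \<rho>_in)
  have \<rho>_mem: "\<rho> u y \<in> \<Omega>" if "u \<in> carrier (free_group 2)" "y \<in> \<Omega>" for u y
    using \<rho>_in[OF that(1)] that(2) by (auto simp: Bij_def bij_betw_def)
  have \<rho>_inj: "y = z" if "u \<in> carrier (free_group 2)" "y \<in> \<Omega>" "z \<in> \<Omega>" "\<rho> u y = \<rho> u z" for u y z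
    using \<rho>_in[OF that(1)] that by (auto simp: Bij_def bij_betw_def inj_on_def)
  have one: "\<rho> [] y = y" if "y \<in> \<Omega>" for y
    using \<rho>_mult[OF Nil Nil that] \<rho>_inj[OF Nil \<rho>_mem[OF Nil that] that] by (simp add: free_reduce_def)
  have pos: "\<rho> [(k, True)] y = letter A T (k, True) y" if "k < 2" "y \<in> \<Omega>" for k y
  proof -
    consider "k = 0" | "k = 1" using \<open>k < 2\<close> by linarith
    then show ?thesis
      using \<open>y \<in> \<Omega>\<close> by cases (simp_all add: A_def T_def extension_def free_gen_def letter.simps)
  qed
  have gen: "\<rho> [c] y = letter A T c y" if c: "fst c < 2" and y: "y \<in> \<Omega>" for c y
  proof (cases "snd c")
    case True
    then show ?thesis using pos[of "fst c" y] c y by (metis prod.collapse)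
  next
    case False
    then obtain k where k: "c = (k, False)" by (metis prod.collapse)
    have k2: "k < 2" using c k by simp
    have k1: "[(k, True)] \<in> carrier (free_group 2)" "[(k, False)] \<in> carrier (free_group 2)"
      using k2 single by auto
    have z: "\<rho> [(k, False)] y \<in> \<Omega>" using \<rho>_mem[OF k1(2) y] .
    have "letter A T (k, True) (\<rho> [(k, False)] y) = \<rho> [(k, True)] (\<rho> [(k, False)] y)"
      using pos[OF k2 z] by simp
    also have "\<dots> = \<rho> (free_reduce ([(k, True)] @ [(k, False)])) y"
      using \<rho>_mult[OF k1 y] by simp
    also have "\<dots> = y" using one[OF y] by (simp add: free_reduce_def)
    finally have "letter A T (k, False) y = letter A T (k, False) (letter A T (k, True) (\<rho> [(k, False)] y))"
      by (simp only:)
    also have "\<dots> = \<rho> [(k, False)] y"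
      using letter_cancel[OF permutes_bij[OF AT(1)] permutes_bij[OF AT(2)], of "(k, False)" "(k, True)"] by simp
    finally show ?thesis using k by simp
  qed
  show ?thesis
    using w
  proof (induction w)
    case Nil
    then show ?case using one[OF x] by simp
  next
    case (Cons c w)
    then have cw: "fst c < 2" "w \<in> carrier (free_group 2)" "reduced_word (c # w)"
      by (auto simp: free_group_carrier reduced_word_Cons)
    have "\<rho> (c # w) x = \<rho> [c] (\<rho> w x)"
      using \<rho>_mult[OF single[OF cw(1)] cw(2) x] free_reduce_reduced[OF cw(3)] by simp
    also have "\<dots> = letter A T c (actw A T w x)"
      using gen[OF cw(1) \<rho>_mem[OF cw(2) x]] Cons.IH[OF cw(2)] by simp
    finally show ?case by (simp add: actw_Cons)
  qed
qed

lemma shift_group_hom: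
  fixes A T :: "nat \<Rightarrow> nat"
  assumes "admissible S A T" "A permutes \<Omega>" "T permutes \<Omega>"
  shows "(\<lambda>g. restrict (actw A T (from_nat g)) \<Omega>) \<in> hom (shift_group S) (BijGroup \<Omega>)"
    and "x \<in> \<Omega> \<Longrightarrow> restrict (actw A T (from_nat (word_class S w))) \<Omega> x = actw A T w x"
proof -
  have cl: "actw A T (from_nat (word_class S w)) = actw A T w" for w
    using word_eq_from_nat_class[of S w] assms(1) by (simp add: word_eq_def)
  show "x \<in> \<Omega> \<Longrightarrow> restrict (actw A T (from_nat (word_class S w))) \<Omega> x = actw A T w x"
    by (simp add: cl)
  have Bij: "restrict (actw A T w) \<Omega> \<in> Bij \<Omega>" for w
    by (intro restrict_permutes_Bij actw_permutes assms)
  show "(\<lambda>g. restrict (actw A T (from_nat g)) \<Omega>) \<in> hom (shift_group S) (BijGroup \<Omega>)"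
  proof (rule homI)
    fix g h assume "g \<in> carrier (shift_group S)" "h \<in> carrier (shift_group S)"
    then obtain u v where uv: "g = word_class S u" "h = word_class S v" by (metis shift_group_carrierE)
    show "restrict (actw A T (from_nat (g \<otimes>\<^bsub>shift_group S\<^esub> h))) \<Omega>
        = restrict (actw A T (from_nat g)) \<Omega> \<otimes>\<^bsub>BijGroup \<Omega>\<^esub> restrict (actw A T (from_nat h)) \<Omega>"
      using Bij[of u] Bij[of v] permutes_in_image[OF actw_permutes[OF assms(2,3)], of v]
      by (auto simp: uv shift_group_mult cl BijGroup_def compose_def actw_append fun_eq_iff)
  qed (simp add: BijGroup_def Bij)
qed

text \<open>A word is brought to its representative one letter at a time from the right, each step
  using a relation between some \<open>i # r\<close> and a representative. These finitely many
  relations, with those between representatives, imply all the others at the point.\<close>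

lemma good_of_representatives:
  assumes R: "R \<subseteq> {is. set is \<subseteq> {- G..G}}" "\<forall>is. set is \<subseteq> {- G..G} \<longrightarrow> (\<exists>r\<in>R. law_eq is r)"
    and J: "J = insert [] (R \<union> (\<lambda>(i, r). i # r) ` ({- G..G} \<times> R))"
    and x: "\<And>js r. js \<in> J \<Longrightarrow> r \<in> R \<Longrightarrow> rel_eq S js r \<Longrightarrow> acts A T js x = acts A T r x"
  shows "good S G A T x"
proof -
  obtain rp where rp: "\<And>is. set is \<subseteq> {- G..G} \<Longrightarrow> rp is \<in> R \<and> law_eq is (rp is)"
    using R(2) by metis
  have red: "acts A T is x = acts A T (rp is) x" if "set is \<subseteq> {- G..G}" for "is"
    using that
  proof (induction "is")
    case Nil
    show ?case using x[of "[]" "rp []"] rp[of "[]"] by (simp add: J rel_eq_law)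
  next
    case (Cons i "is")
    then have rp1: "rp is \<in> R" "law_eq is (rp is)" and rp2: "rp (i # is) \<in> R" "law_eq (i # is) (rp (i # is))"
      using rp[of "is"] rp[of "i # is"] by auto
    have "law_eq (i # rp is) (rp (i # is))"
      using rp1(2) rp2(2) by (simp add: law_eq_def)
    then have "acts A T (i # rp is) x = acts A T (rp (i # is)) x"
      using Cons.prems rp1(1) rp2(1) by (intro x rel_eq_law) (auto simp: J)
    then show ?case using Cons by (simp add: acts_Cons)
  qed
  show ?thesis
    unfolding good_def
  proof (intro allI impI, elim conjE)
    fix "is" js assume i: "set is \<subseteq> {- G..G}" and j: "set js \<subseteq> {- G..G}" and rel: "rel_eq S is js"
    have "rel_eq S (rp is) (rp js)"
      using rel rp[OF i] rp[OF j] rel_eq_law rel_eq_sym rel_eq_trans by metis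
    then have "acts A T (rp is) x = acts A T (rp js) x"
      using rp[OF i] rp[OF j] by (intro x) (auto simp: J)
    then show "acts A T is x = acts A T js x" using red[OF i] red[OF j] by simp
  qed
qed

theorem stable_shift_group:
  assumes S1: "\<And>\<epsilon>::real. 0 < \<epsilon> \<Longrightarrow> \<exists>l l'. 0 < l \<and> l' \<le> l \<and> real (l - l') \<le> \<epsilon> * real l \<and> 1 \<le> \<epsilon> * real l \<and>
      (\<forall>k\<in>S. int l dvd k \<or> 0 \<le> k \<and> k \<le> int l - int l')"
    and S2: "\<And>q. 0 < q \<Longrightarrow> \<exists>G. \<forall>k\<in>S. q dvd k \<or> 0 \<le> k \<and> k \<le> G"
  shows "stable_wrt 2 (shift_group S) (word_class S)"
  unfolding stable_wrt_def
proof (intro allI impI)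
  fix \<epsilon> :: real assume \<epsilon>: "0 < \<epsilon>"
  obtain G \<eta> where \<eta>: "0 < \<eta>" and approx: "\<And>(\<Omega> :: nat set) A T. perm_pair \<Omega> A T \<Longrightarrow>
     real (card {x \<in> \<Omega>. \<not> good S G A T x}) \<le> \<eta> * real (card \<Omega>) \<Longrightarrow>
     (\<exists>A' T'. admissible S A' T' \<and> A' permutes \<Omega> \<and> T' permutes \<Omega> \<and>
       real (card {x \<in> \<Omega>. A x \<noteq> A' x}) \<le> \<epsilon> / 2 * real (card \<Omega>) \<and>
       real (card {x \<in> \<Omega>. T x \<noteq> T' x}) \<le> \<epsilon> / 2 * real (card \<Omega>))"
    using exists_admissible_approximation[OF S1 S2, where 'a = nat and \<epsilon> = "\<epsilon> / 2"] \<epsilon> by auto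
  obtain R where R: "finite R" "R \<subseteq> {is. set is \<subseteq> {- G..G}}"
    "\<forall>is. set is \<subseteq> {- G..G} \<longrightarrow> (\<exists>r\<in>R. law_eq is r)"
    using finite_law_representatives[of "{- G..G}"] by auto
  define J where "J = insert [] (R \<union> (\<lambda>(i, r). i # r) ` ({- G..G} \<times> R))"
  \<comment> \<open>Failure of the identity between \<open>js\<close> and \<open>r\<close> at a
    point means that the relator "inverse of \<open>r\<close> times \<open>js\<close>" moves that
    point.\<close>
  define W where "W = {w \<in> (\<lambda>(r, js). inverse_word (lword r) @ lword js) ` (R \<times> J). word_eq S w []}"
  define E where "E = free_reduce ` W"
  \<comment> \<open>A union bound over \<open>E\<close> must stay below \<open>\<eta>\<close>; the
    added 1 covers an empty \<open>E\<close>.\<close>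
  define \<delta> where "\<delta> = min 1 (\<eta> / (real (card E) + 1))"
  have "finite E" using R(1) by (simp add: E_def W_def J_def)
  have \<delta>: "0 < \<delta>" "\<delta> \<le> 1" "real (card E) * \<delta> \<le> \<eta>"
  proof -
    have "real (card E) * \<delta> \<le> real (card E) * (\<eta> / (real (card E) + 1))"
      unfolding \<delta>_def by (intro mult_left_mono) auto
    also have "\<dots> \<le> \<eta>" using \<eta> by (simp add: field_simps)
    finally show "real (card E) * \<delta> \<le> \<eta>" .
  qed (use \<eta> in \<open>auto simp: \<delta>_def\<close>)
  have lettersW: "fst ` set w \<subseteq> {0..<2}" if w: "w \<in> W" for w
  proof -
    obtain r js where "w = inverse_word (lword r) @ lword js" using w by (auto simp: W_def)
    then show ?thesis using letters_lword by (simp add: image_Un)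
  qed
  have "valid_pair 2 (shift_group S) (word_class S) \<epsilon> \<delta> E"
    unfolding valid_pair_def
  proof (intro conjI allI impI ballI)
    show "E \<subseteq> {r \<in> carrier (free_group 2). word_class S r = \<one>\<^bsub>shift_group S\<^esub>}"
    proof
      fix r assume "r \<in> E"
      then obtain w where w: "w \<in> W" "r = free_reduce w" by (auto simp: E_def)
      then have "word_eq S r []" using word_eq_free_reduce[of S w] word_eq_trans by (auto simp: W_def)
      then show "r \<in> {r \<in> carrier (free_group 2). word_class S r = \<one>\<^bsub>shift_group S\<^esub>}"
        using w free_reduce_carrier[OF lettersW] by (simp add: shift_group_one word_class_eq_iff)
    qed
  next
    fix \<Omega> :: "nat set" and \<rho>
    assume fin: "finite \<Omega>" and \<rho>: "\<rho> \<in> hom (free_group 2) (BijGroup \<Omega>)"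
      and near: "\<forall>r\<in>E. hamming \<Omega> (\<rho> r) \<one>\<^bsub>BijGroup \<Omega>\<^esub> < \<delta>"
    define A where "A = extension \<Omega> (\<rho> (free_gen 0))"
    define T where "T = extension \<Omega> (\<rho> (free_gen 1))"
    have \<rho>_in: "\<rho> u \<in> Bij \<Omega>" if "u \<in> carrier (free_group 2)" for u
      using \<rho> that by (auto simp: hom_def BijGroup_def)
    have gens: "free_gen 0 \<in> carrier (free_group 2)" "free_gen 1 \<in> carrier (free_group 2)"
      by (auto simp: free_gen_def free_group_carrier reduced_word_Cons)
    have pp: "perm_pair \<Omega> A T"
      unfolding A_def T_def using fin gens by unfold_locales (auto intro: extension_permutes \<rho>_in)
    interpret perm_pair \<Omega> A T by (rule pp)
    have app: "\<rho> w x = actw A T w x" if "w \<in> carrier (free_group 2)" "x \<in> \<Omega>" for w x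
      unfolding A_def T_def using free_group_hom_apply[OF \<rho> that] .
    have "{x \<in> \<Omega>. \<not> good S G A T x} \<subseteq> (\<Union>r\<in>E. {x \<in> \<Omega>. \<rho> r x \<noteq> \<one>\<^bsub>BijGroup \<Omega>\<^esub> x})"
    proof
      fix x assume "x \<in> {x \<in> \<Omega>. \<not> good S G A T x}"
      then have x: "x \<in> \<Omega>" "\<not> good S G A T x" by auto
      then obtain js r where js: "js \<in> J" "r \<in> R" "rel_eq S js r" "acts A T js x \<noteq> acts A T r x"
        using good_of_representatives[OF R(2,3) J_def, of S A T x] by blast
      define w where "w = inverse_word (lword r) @ lword js"
      have "word_eq S (lword js) (lword r)"
        using js(3) by (simp add: word_eq_def rel_eq_def fun_eq_iff actw_lword)
      then have "word_eq S w []"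
        unfolding w_def using word_eq_inverse_word word_eq_append word_eq_refl word_eq_trans by metis
      then have w: "w \<in> W" using js by (auto simp: W_def w_def)
      have "actw A T w x \<noteq> x"
      proof
        assume "actw A T w x = x"
        then have "actw A T (inverse_word (lword r)) (actw A T (lword js) x) =
            actw A T (inverse_word (lword r)) (actw A T (lword r) x)"
          by (simp add: w_def actw_append actw_inverse_word[OF bij_A bij_T])
        then have "actw A T (lword js) x = actw A T (lword r) x"
          using bij_is_inj[OF bij_actw[OF bij_A bij_T]] by (simp add: inj_eq)
        then show False using js(4) by (simp add: actw_lword)
      qed
      then have "\<rho> (free_reduce w) x \<noteq> x"
        using app[OF free_reduce_carrier[OF lettersW[OF w]] x(1)] by (simp add: actw_free_reduce[OF bij_A bij_T])
      then show "x \<in> (\<Union>r\<in>E. {x \<in> \<Omega>. \<rho> r x \<noteq> \<one>\<^bsub>BijGroup \<Omega>\<^esub> x})"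
        using w x(1) by (auto simp: E_def BijGroup_def)
    qed
    then have "card {x \<in> \<Omega>. \<not> good S G A T x} \<le> card (\<Union>r\<in>E. {x \<in> \<Omega>. \<rho> r x \<noteq> \<one>\<^bsub>BijGroup \<Omega>\<^esub> x})"
      using fin \<open>finite E\<close> by (intro card_mono) auto
    also have "\<dots> \<le> (\<Sum>r\<in>E. card {x \<in> \<Omega>. \<rho> r x \<noteq> \<one>\<^bsub>BijGroup \<Omega>\<^esub> x})"
      by (rule card_UN_le) fact
    finally have "real (card {x \<in> \<Omega>. \<not> good S G A T x})
        \<le> (\<Sum>r\<in>E. real (card {x \<in> \<Omega>. \<rho> r x \<noteq> \<one>\<^bsub>BijGroup \<Omega>\<^esub> x}))"
      unfolding of_nat_sum[symmetric] of_nat_le_iff .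
    also have "\<dots> \<le> (\<Sum>r\<in>E. \<delta> * real (card \<Omega>))"
    proof (rule sum_mono)
      fix r assume "r \<in> E"
      then have h: "hamming \<Omega> (\<rho> r) \<one>\<^bsub>BijGroup \<Omega>\<^esub> < \<delta>" using near by blast
      show "real (card {x \<in> \<Omega>. \<rho> r x \<noteq> \<one>\<^bsub>BijGroup \<Omega>\<^esub> x}) \<le> \<delta> * real (card \<Omega>)"
      proof (cases "\<Omega> = {}")
        case False
        then have "0 < real (card \<Omega>)" using fin by (simp add: card_gt_0_iff)
        then show ?thesis using h by (simp add: hamming_def field_simps)
      qed simp
    qed
    also have "\<dots> = real (card E) * \<delta> * real (card \<Omega>)" by simp
    also have "\<dots> \<le> \<eta> * real (card \<Omega>)" using \<delta>(3) by (intro mult_right_mono) auto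
    finally obtain A' T' where *: "admissible S A' T'" "A' permutes \<Omega>" "T' permutes \<Omega>"
      "real (card {x \<in> \<Omega>. A x \<noteq> A' x}) \<le> \<epsilon> / 2 * real (card \<Omega>)"
      "real (card {x \<in> \<Omega>. T x \<noteq> T' x}) \<le> \<epsilon> / 2 * real (card \<Omega>)"
      using approx[OF pp] by blast
    define \<phi> where "\<phi> g = restrict (actw A' T' (from_nat g)) \<Omega>" for g
    have "\<phi> \<in> hom (shift_group S) (BijGroup \<Omega>)"
      unfolding \<phi>_def by (rule shift_group_hom(1)[OF *(1-3)])
    moreover have "hamming \<Omega> (\<rho> (free_gen k)) (\<phi> (word_class S (free_gen k))) < \<epsilon>" if "k \<in> {0..<2}" for k
    proof -
      \<comment> \<open>Asking for \<open>\<epsilon> / 2\<close> before gives the strict inequality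
        here. For empty \<open>\<Omega>\<close> the quotient is 0 by the convention on division by
        0.\<close>
      have half: "real (card X) / real (card \<Omega>) < \<epsilon>" if "real (card X) \<le> \<epsilon> / 2 * real (card \<Omega>)" for X :: "nat set"
      proof (cases "card \<Omega> = 0")
        case False
        then have "real (card X) / real (card \<Omega>) \<le> \<epsilon> / 2" using that by (simp add: field_simps)
        also have "\<epsilon> / 2 < \<epsilon>" using \<epsilon> by simp
        finally show ?thesis .
      qed (use \<epsilon> in simp)
      have \<phi>: "\<phi> (word_class S (free_gen k)) x = actw A' T' (free_gen k) x" if "x \<in> \<Omega>" for x
        unfolding \<phi>_def by (rule shift_group_hom(2)[OF *(1-3) that])
      consider "k = 0" | "k = 1" using \<open>k \<in> {0..<2}\<close> by fastforce
      then show ?thesis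
      proof cases
        case 1
        have "{x \<in> \<Omega>. \<rho> (free_gen k) x \<noteq> \<phi> (word_class S (free_gen k)) x} = {x \<in> \<Omega>. A x \<noteq> A' x}"
          using \<phi> 1 by (auto simp: A_def extension_def actw_def free_gen_def letter.simps)
        then show ?thesis unfolding hamming_def using half[OF *(4)] by simp
      next
        case 2
        have "{x \<in> \<Omega>. \<rho> (free_gen k) x \<noteq> \<phi> (word_class S (free_gen k)) x} = {x \<in> \<Omega>. T x \<noteq> T' x}"
          using \<phi> 2 by (auto simp: T_def extension_def actw_def free_gen_def letter.simps)
        then show ?thesis unfolding hamming_def using half[OF *(5)] by simp
      qed
    qed
    ultimately show "\<exists>\<phi>\<in>hom (shift_group S) (BijGroup \<Omega>).
        \<forall>x\<in>{0..<2}. hamming \<Omega> (\<rho> (free_gen x)) (\<phi> (word_class S (free_gen x))) < \<epsilon>" by blast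
  qed (use \<delta> \<open>finite E\<close> in auto)
  then show "\<exists>\<delta> E. valid_pair 2 (shift_group S) (word_class S) \<epsilon> \<delta> E" by blast
qed

section \<open>Lower bound on the growth\<close>

text \<open>Carries a permutation along an embedding and fixes the remaining points. It moves pairs
  from \<open>int \<times> heis\<close> to the naturals, over which \<open>word_eq\<close>
  quantifies.\<close>

definition transport :: "('a \<Rightarrow> 'b) \<Rightarrow> ('a \<Rightarrow> 'a) \<Rightarrow> 'b \<Rightarrow> 'b" where
  "transport e f y = (if y \<in> range e then e (f (inv_into UNIV e y)) else y)"

lemma transport_apply: "inj e \<Longrightarrow> transport e f (e x) = e (f x)"
  by (simp add: transport_def)

lemma transport_outside: "y \<notin> range e \<Longrightarrow> transport e f y = y"
  by (simp add: transport_def)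

lemma bij_transport:
  assumes e: "inj e" and f: "bij f"
  shows "bij (transport e f)"
proof -
  have *: "transport e g (transport e h y) = y" if "\<And>x. g (h x) = x" for g h y
    using that by (cases "y \<in> range e") (auto simp: transport_apply[OF e] transport_outside)
  show ?thesis
    by (rule bij_betw_byWitness[where f' = "transport e (inv_into UNIV f)"])
      (use f in \<open>auto simp: * bij_is_inj bij_is_surj inv_f_f surj_f_inv_f\<close>)
qed

lemma letter_transport:
  assumes e: "inj e" and AT: "bij A" "bij T"
  shows "letter (transport e A) (transport e T) c (e x) = e (letter A T c x)"
proof -
  have inv: "inv_into UNIV (transport e f) (e x) = e (inv_into UNIV f x)" if "bij f" for f x
  proof (rule inv_f_eq[OF bij_is_inj[OF bij_transport[OF e that]]])
    show "transport e f (e (inv_into UNIV f x)) = e x"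
      using that by (simp add: transport_apply[OF e] bij_is_surj surj_f_inv_f)
  qed
  show ?thesis
    by (cases c) (auto simp: letter.simps Let_def inv AT transport_apply[OF e])
qed

lemma letter_transport_outside:
  assumes e: "inj e" and AT: "bij A" "bij T" and y: "y \<notin> range e"
  shows "letter (transport e A) (transport e T) c y = y"
proof -
  have inv: "inv_into UNIV (transport e f) y = y" if "bij f" for f
    using inv_f_eq[OF bij_is_inj[OF bij_transport[OF e that]] transport_outside[OF y]] .
  show ?thesis
    by (cases c) (auto simp: letter.simps Let_def inv AT transport_outside[OF y])
qed

lemma actw_transport:
  assumes "inj e" "bij A" "bij T"
  shows "actw (transport e A) (transport e T) w (e x) = e (actw A T w x)"
  by (induction w) (auto simp: actw_Cons letter_transport[OF assms])

lemma actw_transport_outside: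
  assumes "inj e" "bij A" "bij T" "y \<notin> range e"
  shows "actw (transport e A) (transport e T) w y = y"
  by (induction w) (auto simp: actw_Cons letter_transport_outside[OF assms])

lemma acts_transport:
  assumes "inj e" "bij A" "bij T"
  shows "acts (transport e A) (transport e T) is (e x) = e (acts A T is x)"
  using actw_transport[OF assms, of "lword is"] by (simp add: actw_lword)

lemma acts_transport_outside:
  assumes "inj e" "bij A" "bij T" "y \<notin> range e"
  shows "acts (transport e A) (transport e T) is y = y"
  using actw_transport_outside[OF assms, of "lword is"] by (simp add: actw_lword)

lemma admissible_transport:
  assumes e: "inj e" and adm: "admissible S A T"
  shows "admissible S (transport e A) (transport e T)"
proof -
  have AT: "bij A" "bij T" using adm by (auto simp: admissible_def)
  have eq: "acts (transport e A) (transport e T) is y = acts (transport e A) (transport e T) js y"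
    if "acts A T is = acts A T js" for "is" js y
    using that acts_transport[OF e AT] acts_transport_outside[OF e AT]
    by (cases "y \<in> range e") auto
  have "acts (transport e A) (transport e T) is = id" if "law_eq is []" for "is"
    using eq[of "is" "[]"] adm that by (auto simp: admissible_def)
  moreover have "acts (transport e A) (transport e T) [0, k] = acts (transport e A) (transport e T) [k, 0]"
    if "k \<in> S" for k
    using eq[of "[0, k]" "[k, 0]"] adm that by (auto simp: admissible_def)
  ultimately show ?thesis
    using bij_transport[OF e] AT by (simp add: admissible_def)
qed

lemma word_eq_admissible:
  fixes A T :: "'a :: countable \<Rightarrow> 'a"
  assumes "word_eq S u v" "admissible S A T"
  shows "actw A T u x = actw A T v x"
proof -
  have e: "inj (to_nat :: 'a \<Rightarrow> nat)" by simp
  have AT: "bij A" "bij T" using assms by (auto simp: admissible_def)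
  have "actw (transport to_nat A) (transport to_nat T) u = actw (transport to_nat A) (transport to_nat T) v"
    using assms(1) admissible_transport[OF e assms(2)] by (simp add: word_eq_def)
  then show ?thesis
    using actw_transport[OF e AT, of u x] actw_transport[OF e AT, of v x] by simp
qed

text \<open>The laws act on copies of the Heisenberg group indexed by the integers; only the
  commutations restrict the labelling \<open>h\<close>.\<close>

definition line_A :: "(int \<Rightarrow> heis) \<Rightarrow> int \<times> heis \<Rightarrow> int \<times> heis" where
  "line_A h z = (fst z, hmul (h (fst z)) (snd z))"

definition line_T :: "int \<times> heis \<Rightarrow> int \<times> heis" where
  "line_T z = (fst z + 1, snd z)"

lemma bij_line_T: "bij line_T"
  by (rule bij_betw_byWitness[where f' = "\<lambda>z. (fst z - 1, snd z)"]) (auto simp: line_T_def)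

lemma involutive_cancel: "involutive h \<Longrightarrow> hmul (h s) (hmul (h s) x) = x"
  by (simp add: involutive_def hmul_assoc[symmetric])

lemma line_A_involution: "involutive h \<Longrightarrow> line_A h (line_A h z) = z"
  by (simp add: line_A_def involutive_cancel)

lemma bij_line_A: "involutive h \<Longrightarrow> bij (line_A h)"
  by (rule involuntory_imp_bij) (rule line_A_involution)

lemma zpow_line_T: "zpow line_T i z = (fst z + i, snd z)"
proof (induction i rule: int_induct[where k = 0])
  case (step1 i)
  then have "zpow line_T (i + 1) z = line_T (fst z + i, snd z)"
    by (simp only: zpow_Suc_left[OF bij_line_T])
  then show ?case by (simp add: line_T_def[of "(fst z + i, snd z)"])
next
  case (step2 i)
  have "line_T (zpow line_T (i - 1) z) = line_T (fst z + (i - 1), snd z)"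
    using step2 zpow_Suc_left[OF bij_line_T, of "i - 1" z] by (simp add: line_T_def[of "(fst z + (i - 1), snd z)"])
  then show ?case using bij_is_inj[OF bij_line_T] by (simp only: inj_eq)
qed simp

text \<open>The translations within a letter cancel, so a word acts inside each copy by left
  multiplication, letter \<open>i\<close> acting on copy \<open>s\<close> through
  \<open>h (s - i)\<close>.\<close>

lemma acts_line: "acts (line_A h) line_T is z = (fst z, hmul (hprod (\<lambda>i. h (fst z - i)) is) (snd z))"
  by (induction "is") (auto simp: acts_Cons cj_def zpow_line_T line_A_def hmul_assoc)

lemma admissible_line:
  assumes h: "involutive h"
    and comm: "\<And>k s. k \<in> S \<Longrightarrow> hmul (h s) (h (s - k)) = hmul (h (s - k)) (h s)"
  shows "admissible S (line_A h) line_T"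
  unfolding admissible_def
proof (intro conjI allI impI ballI bij_line_A[OF h] bij_line_T)
  fix "is" assume "law_eq is []"
  moreover have "involutive (\<lambda>i. h (s - i))" for s using h by (simp add: involutive_def)
  ultimately have "hprod (\<lambda>i. h (s - i)) is = hone" for s by (simp add: law_eq_def)
  then show "acts (line_A h) line_T is = id" by (auto simp: acts_line)
next
  fix k assume "k \<in> S"
  then show "acts (line_A h) line_T [0, k] = acts (line_A h) line_T [k, 0]"
    using comm by (auto simp: acts_line fun_eq_iff hmul_assoc[symmetric])
qed

text \<open>On the cycle of length \<open>2 e\<close> this labelling violates the commutation at distance \<open>k\<close>
  exactly when \<open>k\<close> is congruent to \<open>e\<close> modulo \<open>2 e\<close>.\<close>

definition antipodal :: "int \<Rightarrow> int \<Rightarrow> heis" where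
  "antipodal e s = (if s mod (2 * e) = 0 then (True, False, False)
     else if s mod (2 * e) = e then (False, True, False) else hone)"

lemma involutive_antipodal: "involutive (antipodal e)"
  by (simp add: involutive_def antipodal_def hone_def)

text \<open>Non-trivial labels sit only at multiples of \<open>e\<close>, so two of them are a
  multiple of \<open>e\<close> apart.\<close>

lemma antipodal_comm:
  assumes "0 < e" "\<not> e dvd k"
  shows "hmul (antipodal e s) (antipodal e (s - k)) = hmul (antipodal e (s - k)) (antipodal e s)"
proof (cases "antipodal e s = hone \<or> antipodal e (s - k) = hone")
  case False
  have dv: "e dvd s" if "antipodal e s \<noteq> hone" for s
  proof -
    have "s mod (2 * e) = 0 \<or> s mod (2 * e) = e" using that by (auto simp: antipodal_def split: if_splits)
    then have "e dvd s mod (2 * e)" by auto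
    then show ?thesis by (simp add: dvd_mod_iff)
  qed
  have "e dvd s - (s - k)" by (rule dvd_diff) (use dv False in blast)+
  then show ?thesis using assms by simp
qed auto

section \<open>The finite cyclic action and the relations it violates\<close>

definition cycle_A :: "int \<Rightarrow> int \<times> heis \<Rightarrow> int \<times> heis" where
  "cycle_A e z = (if fst z \<in> {0..<2 * e} then line_A (antipodal e) z else z)"

definition cycle_T :: "int \<Rightarrow> int \<times> heis \<Rightarrow> int \<times> heis" where
  "cycle_T e z = (if fst z \<in> {0..<2 * e} then ((fst z + 1) mod (2 * e), snd z) else z)"

lemma cycle_A_involution: "cycle_A e (cycle_A e z) = z"
  by (cases "fst z \<in> {0..<2 * e}")
    (auto simp: cycle_A_def line_A_def involutive_cancel[OF involutive_antipodal])

lemma bij_cycle_A: "bij (cycle_A e)"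
  by (rule involuntory_imp_bij) (rule cycle_A_involution)

lemma bij_cycle_T:
  assumes "0 < e"
  shows "bij (cycle_T e)"
proof (rule bij_betw_byWitness[where
    f' = "\<lambda>z. if fst z \<in> {0..<2 * e} then ((fst z - 1) mod (2 * e), snd z) else z"])
qed (use assms in \<open>auto simp: cycle_T_def mod_simps\<close>)

text \<open>A word of length at most $M - |s|$ cannot distinguish the cycle from the line carrying the
  periodic labelling cut off outside $[-M, M]$.\<close>

lemma actw_line_cycle:
  assumes e: "0 < e" and h: "\<And>s. \<bar>s\<bar> \<le> M \<Longrightarrow> h s = antipodal e s" "involutive h"
    and len: "\<bar>fst z\<bar> + int (length w) \<le> M"
  shows "\<bar>fst (actw (line_A h) line_T w z)\<bar> \<le> \<bar>fst z\<bar> + int (length w) \<and>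
    actw (cycle_A e) (cycle_T e) w (fst z mod (2 * e), snd z) =
      (fst (actw (line_A h) line_T w z) mod (2 * e), snd (actw (line_A h) line_T w z))"
  using len
proof (induction w)
  case (Cons c w)
  define y where "y = actw (line_A h) line_T w z"
  have y: "\<bar>fst y\<bar> \<le> \<bar>fst z\<bar> + int (length w)"
    and cyc: "actw (cycle_A e) (cycle_T e) w (fst z mod (2 * e), snd z) = (fst y mod (2 * e), snd y)"
    using Cons by (auto simp: y_def)
  have rng: "fst y mod (2 * e) \<in> {0..<2 * e}" using e by simp
  have anti: "antipodal e (fst y mod (2 * e)) = h (fst y)"
    using h(1)[of "fst y"] y Cons.prems by (simp add: antipodal_def)
  have inv_A: "inv_into UNIV (line_A h) = line_A h" "inv_into UNIV (cycle_A e) = cycle_A e"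
    by (rule inv_equality; simp add: line_A_involution[OF h(2)] cycle_A_involution)+
  have inv_T: "inv_into UNIV line_T z = (fst z - 1, snd z)" for z
    by (rule inv_f_eq[OF bij_is_inj[OF bij_line_T]]) (simp add: line_T_def)
  have inv_C: "inv_into UNIV (cycle_T e) (s mod (2 * e), x) = ((s - 1) mod (2 * e), x)" for s x
    by (rule inv_f_eq[OF bij_is_inj[OF bij_cycle_T[OF e]]]) (use e in \<open>simp add: cycle_T_def mod_simps\<close>)
  have A: "cycle_A e (fst y mod (2 * e), snd y) = (fst (line_A h y) mod (2 * e), snd (line_A h y))"
    using rng anti by (simp add: cycle_A_def line_A_def)
  have T: "cycle_T e (fst y mod (2 * e), snd y) = (fst (line_T y) mod (2 * e), snd (line_T y))"
    using rng by (simp add: cycle_T_def line_T_def mod_simps)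
  have "letter (cycle_A e) (cycle_T e) c (fst y mod (2 * e), snd y) =
      (fst (letter (line_A h) line_T c y) mod (2 * e), snd (letter (line_A h) line_T c y))"
    by (cases c) (auto simp: letter.simps Let_def inv_A inv_T inv_C A T)
  moreover have "\<bar>fst (letter (line_A h) line_T c y)\<bar> \<le> \<bar>fst y\<bar> + 1"
    by (cases c) (auto simp: letter.simps Let_def inv_A inv_T line_A_def line_T_def)
  ultimately show ?case
    using y cyc by (auto simp: actw_Cons y_def[symmetric])
qed simp

text \<open>The relation is tested on a line instead. Cutting the labels off outside
  \<open>[-M, M]\<close> leaves only distances up to \<open>2 * M\<close> to be checked, and those
  in \<open>S\<close> are not multiples of \<open>e\<close>, so the line is admissible. A word this
  short, started in the first period, does not notice the cut.\<close>

lemma short_relation_on_cycle: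
  assumes e: "0 < e" and S: "\<And>k. k \<in> S \<Longrightarrow> \<bar>k\<bar> \<le> 2 * M \<Longrightarrow> \<not> e dvd k"
    and w: "word_eq S w []" and len: "2 * e + int (length w) \<le> M" and s: "0 \<le> s" "s < 2 * e"
  shows "actw (cycle_A e) (cycle_T e) w (s, x) = (s, x)"
proof -
  define h where "h s = (if \<bar>s\<bar> \<le> M then antipodal e s else hone)" for s
  have inv: "involutive h"
    using involutive_antipodal[of e] by (auto simp: involutive_def h_def)
  have "admissible S (line_A h) line_T"
  proof (rule admissible_line[OF inv])
    fix k s assume k: "k \<in> S"
    show "hmul (h s) (h (s - k)) = hmul (h (s - k)) (h s)"
    proof (cases "\<bar>s\<bar> \<le> M \<and> \<bar>s - k\<bar> \<le> M")
      case True
      then have "\<bar>k\<bar> \<le> 2 * M" by linarith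
      then show ?thesis using antipodal_comm[OF e S[OF k]] True by (simp add: h_def)
    qed (auto simp: h_def)
  qed
  then have "actw (line_A h) line_T w (s, x) = (s, x)"
    using word_eq_admissible[OF w] by simp
  then show ?thesis
    using actw_line_cycle[OF e _ inv, of M "(s, x)" w] s len by (auto simp: h_def)
qed

text \<open>On copy 0 the letters \<open>0\<close> and \<open>k\<close> act through the labels of
  the copies \<open>0\<close> and \<open>e\<close>, the two non-commuting generators of the
  Heisenberg group.\<close>

lemma cycle_commutator:
  assumes e: "0 < e" and k: "k mod (2 * e) = e"
  shows "acts (cycle_A e) (cycle_T e) [0, k] (0, x) \<noteq> acts (cycle_A e) (cycle_T e) [k, 0] (0, x)"
proof -
  have zT: "zpow (cycle_T e) i (s mod (2 * e), x) = ((s + i) mod (2 * e), x)" for i s x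
  proof (induction i rule: int_induct[where k = 0])
    case (step1 i)
    then have "zpow (cycle_T e) (i + 1) (s mod (2 * e), x) = cycle_T e ((s + i) mod (2 * e), x)"
      by (simp only: zpow_Suc_left[OF bij_cycle_T[OF e]])
    also have "\<dots> = ((s + (i + 1)) mod (2 * e), x)"
      using e by (simp add: cycle_T_def mod_simps ac_simps)
    finally show ?case .
  next
    case (step2 i)
    have "cycle_T e (zpow (cycle_T e) (i - 1) (s mod (2 * e), x)) = ((s + i) mod (2 * e), x)"
      using step2 zpow_Suc_left[OF bij_cycle_T[OF e], of "i - 1"] by simp
    also have "\<dots> = cycle_T e ((s + (i - 1)) mod (2 * e), x)"
      using e by (simp add: cycle_T_def mod_simps)
    finally show ?case using bij_is_inj[OF bij_cycle_T[OF e]] by (simp only: inj_eq)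
  qed simp
  have 0: "zpow (cycle_T e) i (0, x) = (i mod (2 * e), x)" for i x
    using zT[of i 0 x] by simp
  have "(- k) mod (2 * e) = e"
    using k e by (simp add: zmod_zminus1_eq_if)
  then have "cj (cycle_A e) (cycle_T e) k (0, x) = (0, hmul (False, True, False) x)" for x
    using zT[of k e] e k by (simp add: cj_def 0 cycle_A_def line_A_def antipodal_def mod_add_right_eq[symmetric])
  moreover have "cycle_A e (0, x) = (0, hmul (True, False, False) x)" for x
    using e by (simp add: cycle_A_def line_A_def antipodal_def)
  ultimately show ?thesis
    by (cases x) (auto simp: acts_Cons)
qed

lemma actw_hom:
  assumes "A permutes \<Omega>" "T permutes \<Omega>"
  shows "(\<lambda>w. restrict (actw A T w) \<Omega>) \<in> hom (free_group n) (BijGroup \<Omega>)"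
proof (rule homI)
  have Bij: "restrict (actw A T w) \<Omega> \<in> Bij \<Omega>" for w
    by (intro restrict_permutes_Bij actw_permutes assms)
  show "restrict (actw A T u) \<Omega> \<in> carrier (BijGroup \<Omega>)" for u
    by (simp add: BijGroup_def Bij)
  show "restrict (actw A T (u \<otimes>\<^bsub>free_group n\<^esub> v)) \<Omega> =
      restrict (actw A T u) \<Omega> \<otimes>\<^bsub>BijGroup \<Omega>\<^esub> restrict (actw A T v) \<Omega>" for u v
    using Bij[of u] Bij[of v] permutes_in_image[OF actw_permutes[OF assms], of v]
      actw_free_reduce[OF permutes_bij[OF assms(1)] permutes_bij[OF assms(2)]]
    by (auto simp: BijGroup_def compose_def free_group_def actw_append fun_eq_iff)
qed

lemma length_le_word_norm: "finite E \<Longrightarrow> r \<in> E \<Longrightarrow> length r \<le> word_norm E"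
  unfolding word_norm_def by (rule member_le_sum) auto

text \<open>If \<open>E\<close> had small norm, all its elements would act trivially on the cycle,
  which has \<open>2 * e\<close> copies of 8 points. Validity would then give a genuine action at
  distance less than \<open>1 / x\<close> on the generators. Since \<open>1 / x\<close> is at most
  the inverse of the number of points, both actions would agree, although the commutation at
  distance \<open>k\<close> fails on the cycle.\<close>

theorem valid_pair_norm_bound:
  assumes e: "0 < e" and S: "\<And>k. k \<in> S \<Longrightarrow> \<bar>k\<bar> \<le> 2 * M \<Longrightarrow> \<not> e dvd k"
    and k: "k \<in> S" "k mod (2 * e) = e" and x: "16 * real_of_int e \<le> x"
    and valid: "valid_pair 2 (shift_group S) (word_class S) (1 / x) \<delta> E"
  shows "M < 2 * e + int (word_norm E)"
proof (rule ccontr)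
  assume M: "\<not> M < 2 * e + int (word_norm E)"
  define c where "c = (to_nat :: int \<times> heis \<Rightarrow> nat)"
  have c: "inj c" by (simp add: c_def)
  define X where "X = {0..<2 * e} \<times> (UNIV :: heis set)"
  define \<Omega> where "\<Omega> = c ` X"
  define A where "A = transport c (cycle_A e)"
  define T where "T = transport c (cycle_T e)"
  note bij = bij_cycle_A[of e] bij_cycle_T[OF e]
  have fin: "finite \<Omega>" by (simp add: \<Omega>_def X_def)
  have card: "real (card \<Omega>) = 16 * real_of_int e"
  proof -
    have "card \<Omega> = card X" unfolding \<Omega>_def by (rule card_image) (rule inj_on_subset[OF c subset_UNIV])
    also have "\<dots> = nat (2 * e) * 8"
      by (simp add: X_def card_cartesian_product UNIV_Times_UNIV[symmetric] card_UNIV_bool del: UNIV_Times_UNIV)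
    finally show ?thesis using e by simp
  qed
  have perm: "transport c f permutes \<Omega>" if "bij f" "\<And>z. z \<notin> X \<Longrightarrow> f z = z" for f
  proof (rule bij_imp_permutes)
    have "f z \<in> X" if "z \<in> X" for z
      using that \<open>\<And>z. z \<notin> X \<Longrightarrow> f z = z\<close> bij_is_inj[OF \<open>bij f\<close>] by (metis injD)
    then have "transport c f ` \<Omega> \<subseteq> \<Omega>" by (auto simp: \<Omega>_def transport_apply[OF c])
    moreover have "inj_on (transport c f) \<Omega>"
      by (rule inj_on_subset[OF bij_is_inj[OF bij_transport[OF c \<open>bij f\<close>]] subset_UNIV])
    ultimately show "bij_betw (transport c f) \<Omega> \<Omega>"
      using endo_inj_surj[OF fin] by (simp add: bij_betw_def)
    fix y assume "y \<notin> \<Omega>"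
    then show "transport c f y = y"
    proof (cases "y \<in> range c")
      case True
      then obtain z where z: "y = c z" by blast
      then have "z \<notin> X" using \<open>y \<notin> \<Omega>\<close> by (auto simp: \<Omega>_def)
      then show ?thesis using that(2)[of z] z by (simp add: transport_apply[OF c])
    qed (simp add: transport_outside)
  qed
  have AT: "A permutes \<Omega>" "T permutes \<Omega>"
    unfolding A_def T_def
    by (rule perm, rule bij, force simp: X_def cycle_A_def)
      (rule perm, rule bij, force simp: X_def cycle_T_def)
  define \<rho> where "\<rho> w = restrict (actw A T w) \<Omega>" for w
  have \<rho>: "\<rho> \<in> hom (free_group 2) (BijGroup \<Omega>)"
    unfolding \<rho>_def by (rule actw_hom[OF AT])
  have E: "finite E" "E \<subseteq> {r \<in> carrier (free_group 2). word_class S r = \<one>\<^bsub>shift_group S\<^esub>}" "0 < \<delta>"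
    using valid by (auto simp: valid_pair_def)
  have close: "hamming \<Omega> (\<rho> r) \<one>\<^bsub>BijGroup \<Omega>\<^esub> < \<delta>" if r: "r \<in> E" for r
  proof -
    have "word_eq S r []" using r E(2) by (auto simp: shift_group_one word_class_eq_iff)
    moreover have "2 * e + int (length r) \<le> M"
      using M length_le_word_norm[OF E(1) r] by simp
    ultimately have "actw A T r y = y" if "y \<in> \<Omega>" for y
      using that short_relation_on_cycle[OF e S, where M = M and w = r]
      by (auto simp: \<Omega>_def X_def A_def T_def actw_transport[OF c bij])
    then have none: "{y \<in> \<Omega>. \<rho> r y \<noteq> \<one>\<^bsub>BijGroup \<Omega>\<^esub> y} = {}"
      by (auto simp: \<rho>_def BijGroup_def)
    show ?thesis unfolding hamming_def none using E(3) by simp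
  qed
  note extend = conjunct2[OF conjunct2[OF conjunct2[OF conjunct2[OF valid[unfolded valid_pair_def]]]]]
  obtain \<phi> where \<phi>: "\<phi> \<in> hom (shift_group S) (BijGroup \<Omega>)"
    and near: "\<And>i. i \<in> {0..<2} \<Longrightarrow> hamming \<Omega> (\<rho> (free_gen i)) (\<phi> (word_class S (free_gen i))) < 1 / x"
    using bexE[OF extend[rule_format, OF fin \<rho> close]] by (metis (no_types, lifting))
  define \<psi> where "\<psi> w = \<phi> (word_class S w)" for w
  have \<psi>: "\<psi> \<in> hom (free_group 2) (BijGroup \<Omega>)"
  proof -
    have "\<psi> = \<phi> \<circ> word_class S" by (simp add: \<psi>_def fun_eq_iff)
    then show ?thesis using hom_compose[OF word_class_hom \<phi>] by (simp only:)
  qed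
  have gens: "\<rho> (free_gen i) y = \<psi> (free_gen i) y" if i: "i \<in> {0..<2}" and y: "y \<in> \<Omega>" for i y
  proof (rule ccontr)
    assume "\<rho> (free_gen i) y \<noteq> \<psi> (free_gen i) y"
    then have "{y} \<subseteq> {z \<in> \<Omega>. \<rho> (free_gen i) z \<noteq> \<psi> (free_gen i) z}" using y by auto
    then have "card {y} \<le> card {z \<in> \<Omega>. \<rho> (free_gen i) z \<noteq> \<psi> (free_gen i) z}"
      using fin by (intro card_mono) auto
    then have "1 / real (card \<Omega>) \<le> hamming \<Omega> (\<rho> (free_gen i)) (\<psi> (free_gen i))"
      unfolding hamming_def by (intro divide_right_mono) auto
    moreover have "1 / x \<le> 1 / real (card \<Omega>)"
      using card x e by (intro divide_left_mono) auto
    ultimately show False using near[OF i] by (simp add: \<psi>_def)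
  qed
  have ext: "extension \<Omega> (\<rho> (free_gen i)) = extension \<Omega> (\<psi> (free_gen i))" if "i \<in> {0..<2}" for i
    using gens[OF that] by (auto simp: extension_def)
  have eq: "\<rho> w y = \<psi> w y" if "w \<in> carrier (free_group 2)" "y \<in> \<Omega>" for w y
    using free_group_hom_apply[OF \<rho> that] free_group_hom_apply[OF \<psi> that] ext[of 0] ext[of 1] by simp
  define w where "w = inverse_word (lword [k, 0]) @ lword [0, k]"
  have "word_eq S (lword [0, k]) (lword [k, 0])"
    using rel_eq_comm[OF k(1), of 0] by (simp add: word_eq_def rel_eq_def fun_eq_iff actw_lword del: lword.simps)
  then have "word_eq S w []"
    unfolding w_def using word_eq_inverse_word word_eq_append word_eq_refl word_eq_trans by metis
  then have "word_class S (free_reduce w) = \<one>\<^bsub>shift_group S\<^esub>"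
    using word_eq_free_reduce word_eq_trans by (metis shift_group_one word_class_eq_iff)
  then have "\<psi> (free_reduce w) = \<one>\<^bsub>BijGroup \<Omega>\<^esub>"
    using hom_one[OF \<phi> group_shift_group group_BijGroup] by (simp add: \<psi>_def)
  moreover have "fst ` set w \<subseteq> {0..<2}"
    using letters_lword by (simp add: w_def image_Un del: lword.simps)
  moreover have z: "c (0, hone) \<in> \<Omega>" using e by (simp add: \<Omega>_def X_def)
  ultimately have "\<rho> (free_reduce w) (c (0, hone)) = c (0, hone)"
    using eq[OF free_reduce_carrier z] by (simp add: BijGroup_def)
  then have "actw A T w (c (0, hone)) = c (0, hone)"
    using z by (simp add: \<rho>_def actw_free_reduce[OF permutes_bij[OF AT(1)] permutes_bij[OF AT(2)]])
  then have "actw (cycle_A e) (cycle_T e) w (0, hone) = (0, hone)"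
    using c by (simp add: A_def T_def actw_transport[OF c bij] inj_eq)
  then have "actw (cycle_A e) (cycle_T e) (inverse_word (lword [k, 0])) (acts (cycle_A e) (cycle_T e) [0, k] (0, hone))
      = actw (cycle_A e) (cycle_T e) (inverse_word (lword [k, 0])) (acts (cycle_A e) (cycle_T e) [k, 0] (0, hone))"
    using actw_inverse_word[OF bij, of "lword [k, 0]" "(0, hone)"]
    by (simp only: w_def actw_append actw_lword)
  then have "acts (cycle_A e) (cycle_T e) [0, k] (0, hone) = acts (cycle_A e) (cycle_T e) [k, 0] (0, hone)"
    using bij_is_inj[OF bij_actw[OF bij]] by (simp only: inj_eq)
  then show False using cycle_commutator[OF e k(2)] by blast
qed

text \<open>The factors \<open>2 * j + 3\<close> make every positive integer divide almost all distances, the factors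
  \<open>2 * c j + 1\<close> make them grow, and both are odd so that the power of two stays under control.\<close>

fun distances :: "(nat \<Rightarrow> nat) \<Rightarrow> nat \<Rightarrow> nat" where
  "distances c 0 = 2 * c 0 + 1"
| "distances c (Suc j) = 2 * distances c j * (2 * j + 3) * (2 * c (Suc j) + 1)"

section \<open>Arithmetic of the distances\<close>

lemma distances_odd_part: "\<exists>u. odd u \<and> distances c j = 2 ^ j * u"
proof (induction j)
  case (Suc j)
  then obtain u where "odd u" "distances c j = 2 ^ j * u" by blast
  then have "distances c (Suc j) = 2 ^ Suc j * (u * (2 * j + 3) * (2 * c (Suc j) + 1))"
    by (simp only: distances.simps power_Suc ac_simps)
  moreover have "odd (u * (2 * j + 3) * (2 * c (Suc j) + 1))" using \<open>odd u\<close> by simp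
  ultimately show ?case by blast
qed simp

lemma distances_pos: "0 < distances c j"
  by (induction j) simp_all

lemma distances_gt: "2 * c j < distances c j"
proof (cases j)
  case (Suc i)
  have "1 * (2 * c j + 1) \<le> (2 * distances c i * (2 * i + 3)) * (2 * c j + 1)"
    using distances_pos[of c i] by (intro mult_le_mono1) simp
  then have "2 * c j + 1 \<le> distances c j" by (simp only: Suc distances.simps mult_1)
  then show ?thesis by simp
qed simp

lemma distances_dvd: "i \<le> j \<Longrightarrow> distances c i dvd distances c j"
proof (induction j rule: dec_induct)
  case (step j)
  then show ?case by (simp add: dvd_mult2)
qed simp

lemma distances_mono: "i \<le> j \<Longrightarrow> distances c i \<le> distances c j"
  using distances_dvd distances_pos by (metis dvd_imp_le)

text \<open>Unbounded ratios make each distance a vanishing fraction of the next, as the trivial top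
  of the towers requires.\<close>

lemma distances_ratio: "Suc j * distances c j \<le> distances c (Suc j)"
proof -
  have "Suc j * distances c j \<le> (2 * (2 * j + 3)) * distances c j * 1" by (simp add: algebra_simps)
  also have "\<dots> \<le> (2 * (2 * j + 3)) * distances c j * (2 * c (Suc j) + 1)" by (rule mult_le_mono2) simp
  also have "\<dots> = distances c (Suc j)" by (simp only: distances.simps ac_simps)
  finally show ?thesis .
qed

lemma eventually_dvd_distances:
  assumes "0 < q"
  shows "\<exists>J. \<forall>j\<ge>J. q dvd distances c j"
proof -
  have "\<exists>a b. odd b \<and> q = 2 ^ a * b"
    using assms
  proof (induction q rule: less_induct)
    case (less q)
    show ?case
    proof (cases "odd q")
      case True
      then show ?thesis by (intro exI[of _ 0] exI[of _ q]) simp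
    next
      case False
      then obtain r where r: "q = 2 * r" by blast
      then obtain a b where "odd b" "r = 2 ^ a * b" using less.IH[of r] less.prems by auto
      then show ?thesis using r by (intro exI[of _ "Suc a"] exI[of _ b]) simp
    qed
  qed
  then obtain a b where ab: "odd b" "q = 2 ^ a * b" by blast
  have b: "b dvd distances c (Suc b)"
  proof (cases "b = 1")
    case False
    obtain v where v: "b = 2 * v + 1" using ab(1) by (rule oddE)
    \<comment> \<open>Every odd number from 3 on is of the form \<open>2 * i + 3\<close> and so
      occurs among the factors.\<close>
    define i where "i = v - 1"
    have i: "b = 2 * i + 3" using False v by (cases v) (auto simp: i_def)
    have "b dvd distances c (Suc i)" unfolding i by simp
    moreover have "distances c (Suc i) dvd distances c (Suc b)" by (rule distances_dvd) (simp add: i)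
    ultimately show ?thesis by (rule dvd_trans)
  qed simp
  have "q dvd distances c j" if "max a (Suc b) \<le> j" for j
    unfolding ab(2)
  proof (rule divides_mult)
    have "2 ^ a dvd distances c a" using distances_odd_part[of c a] by auto
    then show "2 ^ a dvd distances c j" using distances_dvd[of a j c] that dvd_trans by auto
    show "b dvd distances c j" using b distances_dvd[of "Suc b" j c] that dvd_trans by auto
    show "coprime (2 ^ a) b" using ab(1) by simp
  qed
  then show ?thesis by blast
qed

lemma distances_not_dvd: "i < j \<Longrightarrow> \<not> 2 ^ j dvd distances c i"
proof
  assume ij: "i < j" and d: "2 ^ j dvd distances c i"
  obtain u where u: "odd u" "distances c i = 2 ^ i * u" using distances_odd_part by blast
  have "(2::nat) ^ Suc i dvd 2 ^ j" using ij by (intro le_imp_power_dvd) simp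
  then have "2 ^ i * 2 dvd 2 ^ i * u" using d u(2) by (metis dvd_trans power_Suc2)
  then have "2 dvd u" by simp
  then show False using u(1) by simp
qed

text \<open>Being an odd multiple of \<open>2 ^ j\<close>, this distance joins opposite copies of
  the cycle with \<open>e = 2 ^ j\<close>.\<close>

lemma distances_mod: "int (distances c j) mod (2 * 2 ^ j) = 2 ^ j"
proof -
  obtain u where u: "odd u" "distances c j = 2 ^ j * u" using distances_odd_part by blast
  from u(1) obtain v where "u = 2 * v + 1" by (rule oddE)
  then have "int (distances c j) = 2 ^ j + int v * (2 * 2 ^ j)" using u by (simp add: algebra_simps)
  then show ?thesis by simp
qed

text \<open>The tower height \<open>l\<close> is the distance of index \<open>j + 1\<close>, and the
  trivial top is as high as the distance of index \<open>j\<close>. Later distances are multiples of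
  \<open>l\<close>, and earlier ones are no larger than the top, which is a small fraction of
  \<open>l\<close> once \<open>j > 1 / \<epsilon>\<close>.\<close>

lemma stable_distances:
  fixes c :: "nat \<Rightarrow> nat"
  defines "S \<equiv> range (\<lambda>j. int (distances c j))"
  shows "stable_wrt 2 (shift_group S) (word_class S)"
proof (rule stable_shift_group)
  fix \<epsilon> :: real assume \<epsilon>: "0 < \<epsilon>"
  obtain j :: nat where j: "1 / \<epsilon> < real j" using reals_Archimedean2 by blast
  define a where "a = distances c j"
  define l where "l = distances c (Suc j)"
  have "real j * real a \<le> real l"
  proof -
    have "real (Suc j * a) \<le> real l" unfolding a_def l_def using distances_ratio by (rule of_nat_mono)
    then show ?thesis by (simp add: algebra_simps)
  qed
  have a: "real a \<le> \<epsilon> * real l"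
  proof -
    have "1 * real a \<le> \<epsilon> * real j * real a"
      using j \<epsilon> by (intro mult_right_mono) (auto simp: field_simps)
    also have "\<dots> \<le> \<epsilon> * real l" using \<open>real j * real a \<le> real l\<close> \<epsilon> by (simp add: mult.assoc)
    finally show ?thesis by simp
  qed
  moreover have "1 \<le> a" using distances_pos[of c j] by (simp add: a_def)
  moreover have "0 < l" "a \<le> l"
    using distances_pos[of c "Suc j"] distances_mono[of j "Suc j" c] by (simp_all only: a_def l_def)
  moreover have "int l dvd k \<or> 0 \<le> k \<and> k \<le> int l - int (l - a)" if kS: "k \<in> S" for k
  proof -
    obtain i where i: "k = int (distances c i)" using kS by (auto simp: S_def)
    show ?thesis
    proof (cases "Suc j \<le> i")
      case True
      then show ?thesis using distances_dvd[OF True, of c] i by (simp only: l_def of_nat_dvd_iff simp_thms)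
    next
      case False
      then have "distances c i \<le> a" unfolding a_def by (intro distances_mono) simp
      then show ?thesis using i \<open>a \<le> l\<close> by simp
    qed
  qed
  ultimately show "\<exists>l l'. 0 < l \<and> l' \<le> l \<and> real (l - l') \<le> \<epsilon> * real l \<and> 1 \<le> \<epsilon> * real l \<and>
      (\<forall>k\<in>S. int l dvd k \<or> 0 \<le> k \<and> k \<le> int l - int l')"
    by (intro exI[of _ l] exI[of _ "l - a"]) auto
next
  fix q :: int assume q: "0 < q"
  then obtain J where J: "\<And>j. J \<le> j \<Longrightarrow> nat q dvd distances c j"
    using eventually_dvd_distances[of "nat q" c] by auto
  have "q dvd k \<or> 0 \<le> k \<and> k \<le> int (distances c J)" if kS: "k \<in> S" for k
  proof -
    obtain i where i: "k = int (distances c i)" using kS by (auto simp: S_def)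
    show ?thesis
    proof (cases "J \<le> i")
      case True
      then have "int (nat q) dvd k" unfolding i of_nat_dvd_iff by (rule J)
      then show ?thesis using q by simp
    next
      case False
      then show ?thesis using i distances_mono[of i J c] by simp
    qed
  qed
  then show "\<exists>G. \<forall>k\<in>S. q dvd k \<or> 0 \<le> k \<and> k \<le> G" by blast
qed

text \<open>Take \<open>e = 2 ^ j\<close> and \<open>M = c j\<close>. By \<open>distances_gt\<close>
  only distances of index below \<open>j\<close> are at most \<open>2 * c j\<close>, and
  \<open>2 ^ j\<close> divides none of those.\<close>

lemma distances_norm_bound:
  fixes c :: "nat \<Rightarrow> nat"
  defines "S \<equiv> range (\<lambda>j. int (distances c j))"
  assumes x: "16 * 2 ^ j \<le> x" and valid: "valid_pair 2 (shift_group S) (word_class S) (1 / x) \<delta> E"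
  shows "c j < 2 * 2 ^ j + word_norm E"
proof -
  have "int (c j) < 2 * 2 ^ j + int (word_norm E)"
  proof (rule valid_pair_norm_bound[OF _ _ _ distances_mod[of c j] _ valid])
    fix k assume k: "k \<in> S" "\<bar>k\<bar> \<le> 2 * int (c j)"
    then obtain i where i: "k = int (distances c i)" by (auto simp: S_def)
    have "i < j"
    proof (rule ccontr)
      assume "\<not> i < j"
      then have "distances c j \<le> distances c i" by (intro distances_mono) simp
      then show False using distances_gt[of c j] k(2) i by simp
    qed
    then have "\<not> int (2 ^ j) dvd int (distances c i)"
      unfolding of_nat_dvd_iff by (rule distances_not_dvd)
    then show "\<not> 2 ^ j dvd k" using i by simp
  qed (use x in \<open>auto simp: S_def\<close>)
  then show ?thesis by (metis (mono_tags, lifting) of_nat_add of_nat_less_iff of_nat_mult of_nat_numeral of_nat_power)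
qed

theorem theorem1p3:
  shows "\<exists>C::real > 0. \<forall>F :: real \<Rightarrow> real.
           mono_on {1..} F \<and> (\<forall>x\<ge>1. 0 < F x) \<longrightarrow>
           (\<exists>(n::nat) (G :: nat monoid) (\<pi> :: fword \<Rightarrow> nat).
              group G \<and>
              \<pi> \<in> hom (free_group n) G \<and> \<pi> ` carrier (free_group n) = carrier G \<and>
              stable_wrt n G \<pi> \<and>
              (\<forall>x\<ge>C. stability_growth n G \<pi> x \<ge> F x))"
proof (intro exI[of _ "16 :: real"] conjI allI impI)
  fix F :: "real \<Rightarrow> real"
  assume F: "mono_on {1..} F \<and> (\<forall>x\<ge>1. 0 < F x)"
  \<comment> \<open>The value of \<open>F\<close> at the upper end of the range of \<open>x\<close>
    served by scale \<open>j\<close>, plus the \<open>2 * 2 ^ j\<close> lost in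
    \<open>distances_norm_bound\<close>.\<close>
  define c where "c j = nat \<lceil>F (16 * 2 ^ Suc j)\<rceil> + 2 * 2 ^ j" for j
  define S where "S = range (\<lambda>j. int (distances c j))"
  have stable: "stable_wrt 2 (shift_group S) (word_class S)"
    unfolding S_def by (rule stable_distances)
  have "F x \<le> stability_growth 2 (shift_group S) (word_class S) x" if x: "16 \<le> x" for x
    unfolding stability_growth_def
  proof (rule cInf_greatest)
    have "0 < 1 / x" using x by simp
    then show "{real (word_norm E) / \<delta> |\<delta> E. valid_pair 2 (shift_group S) (word_class S) (1 / x) \<delta> E} \<noteq> {}"
      using stable by (auto simp: stable_wrt_def)
  next
    fix y assume "y \<in> {real (word_norm E) / \<delta> |\<delta> E. valid_pair 2 (shift_group S) (word_class S) (1 / x) \<delta> E}"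
    then obtain \<delta> E where y: "y = real (word_norm E) / \<delta>"
      and valid: "valid_pair 2 (shift_group S) (word_class S) (1 / x) \<delta> E" by blast
    have \<delta>: "0 < \<delta>" "\<delta> \<le> 1" using valid by (auto simp: valid_pair_def)
    \<comment> \<open>Rounding serves to find the scale with
      \<open>16 * 2 ^ j \<le> x < 16 * 2 ^ (j + 1)\<close>; it exists because
      \<open>x \<ge> 16\<close>.\<close>
    define m where "m = nat \<lfloor>x / 16\<rfloor>"
    have m: "real m \<le> x / 16" "x / 16 < real m + 1"
      using x of_int_floor_le[of "x / 16"] by (simp_all add: m_def)
    have "1 \<le> m" using x by (simp add: m_def le_nat_iff le_floor_iff)
    then obtain j where "2 ^ j \<le> m" "m + 1 \<le> 2 ^ (j + 1)"
      using ex_power_ivl1[of 2 m] by (auto simp: Suc_le_eq)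
    then have "real (2 ^ j) \<le> real m" "real (m + 1) \<le> real (2 ^ (j + 1))"
      by (simp_all only: of_nat_le_iff)
    then have "2 ^ j \<le> real m" "real m + 1 \<le> 2 ^ Suc j"
      by (simp_all only: of_nat_power of_nat_numeral of_nat_add of_nat_1 Suc_eq_plus1)
    then have j: "16 * 2 ^ j \<le> x" "x < 16 * 2 ^ Suc j"
      using m by linarith+
    have "1 \<le> x" "1 \<le> (16 * 2 ^ Suc j :: real)" using x j(2) by linarith+
    then have "F x \<le> F (16 * 2 ^ Suc j)"
      using F j(2) by (auto simp: mono_on_def)
    also have "\<dots> \<le> real (nat \<lceil>F (16 * 2 ^ Suc j)\<rceil>)" by (rule real_nat_ceiling_ge)
    also have "\<dots> \<le> real (word_norm E)"
    proof -
      have "c j < 2 * 2 ^ j + word_norm E"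
        using distances_norm_bound[OF j(1)] valid unfolding S_def by blast
      then have "nat \<lceil>F (16 * 2 ^ Suc j)\<rceil> \<le> word_norm E" by (simp only: c_def)
      then show ?thesis by (simp only: of_nat_le_iff)
    qed
    \<comment> \<open>Dividing by \<open>\<delta> \<le> 1\<close> can only increase the
      norm.\<close>
    also have "\<dots> \<le> y" unfolding y using \<delta> by (simp add: le_divide_eq mult_left_le)
    finally show "F x \<le> y" .
  qed
  then show "\<exists>n (G :: nat monoid) (\<pi> :: fword \<Rightarrow> nat). group G \<and> \<pi> \<in> hom (free_group n) G \<and> \<pi> ` carrier (free_group n) = carrier G \<and>
      stable_wrt n G \<pi> \<and> (\<forall>x\<ge>16. F x \<le> stability_growth n G \<pi> x)"
    using group_shift_group[of S] word_class_hom[of S] word_class_surj[of S] stable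
    by (intro exI[of _ 2] exI[of _ "shift_group S"] exI[of _ "word_class S"] conjI allI impI)
qed simp

end
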